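(* Let $A=\oplus_{i=1}^j M_{a_i}(\mathbb{C})$ be a finite dimensional $C^*$-algebra, let $n=\sum_{i=1}^j a_i$ (the dimension of a maximal abelian subalgebra of $A$), and let $\Phi$ be the one-shift endomorphism of the hyperfinite $II_1$ factor $R$ associated with $A$ (constructed in the context). Then $\Phi(R)$ is a $II_1$ factor and the Jones index is $[R:\Phi(R)]=n^2$.
   Context: Construction. Let $A=\oplus_{i=1}^j M_{a_i}(\mathbb{C})$ be embedded block-diagonally in $M_n(\mathbb{C})$, $n=\sum_i a_i$. Let $e_1,\dots,e_n$ be the standard basis of $\mathbb{C}^n$ and $t_i=a_1+\cdots+a_i$. Let $v\in M_n(\mathbb{C})$ be the permutation matrix of the cycle $(t_1\ t_2\ \cdots\ t_j)$, i.e. $ve_{t_i}=e_{t_{i+1}}$ ($i$ mod $j$) and $v$ fixes the other basis vectors. Let $s$ be the diagonal projection onto the span of $e_{t_1},\dots,e_{t_j}$, and $r=svs$. Let $\gamma=\exp(2\pi\sqrt{-1}/j)$ and $w=\sum_{i=1}^j\gamma^{i-1}1_{M_{a_i}(\mathbb{C})}$, a central unitary of $A$; one has $wrw^*=\gamma r$. Let $S_1=\{l(l+1)/2 : l\ge 1\}=\{1,3,6,10,\dots\}$. Regard $\otimes^kM_n(\mathbb{C})\subset\otimes^{k+1}M_n(\mathbb{C})$ via $x\mapsto x\otimes 1$. For $m\ge1$ let $A_m=1^{\otimes(m-1)}\otimes A$, $w_m=1^{\otimes(m-1)}\otimes w$ and $r_m=(w_1^{b_1}w_2^{b_2}\cdots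 w_{m-1}^{b_{m-1}})\otimes r$ in $\otimes^mM_n(\mathbb{C})$, where $b_l=1$ if $m-l\in S_1$ and $b_l=0$ otherwise (so $r_1=r$). These satisfy $[A_l,A_m]=0$ and $[r_l,A_m]=0$ for $l\ne m$, and for $m>l$: $r_mr_l=\gamma r_lr_m$ if $m-l\in S_1$, $r_mr_l=r_lr_m$ otherwise. Let $M_k$ be the $*$-algebra generated by $A_1,r_1,\dots,A_k,r_k$, let $M=\cup_kM_k$ with the trace $\tau$ given on each $M_k\subset\otimes^kM_n(\mathbb{C})$ by the normalized trace, and let $R=M''$ be the weak closure in the GNS representation of $(M,\tau)$, which is the hyperfinite $II_1$ factor. The one-shift $\Phi$ is the unital $*$-endomorphism of $R$ sending $A_k$ to $A_{k+1}$ (by the canonical identification of the two copies of $A$) and $r_k$ to $r_{k+1}$ for every $k\ge1$. *)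

theory Defs
  imports
    "Jordan_Normal_Form.Schur_Decomposition"
    "HOL-Analysis.Inner_Product"
    "HOL-Analysis.Elementary_Topology"
    "HOL-Analysis.Abstract_Topology"
    "HOL-Library.Extended_Nonnegative_Real"
begin

section \<open>Operators on a complex Hilbert space\<close>

text \<open>The real inner product, hence the norm, is the one underlying the complex inner product,
  which is linear in its first argument.\<close>

class complex_hilbert = real_inner + complete_space +
  fixes scaleC :: "complex \<Rightarrow> 'a \<Rightarrow> 'a" (infixr "*\<^sub>C" 75)
    and cinner :: "'a \<Rightarrow> 'a \<Rightarrow> complex"
  assumes scaleC_of_real: "complex_of_real t *\<^sub>C x = t *\<^sub>R x"
    and scaleC_add_right: "c *\<^sub>C (x + y) = c *\<^sub>C x + c *\<^sub>C y"
    and scaleC_add_left: "(c + d) *\<^sub>C x = c *\<^sub>C x + d *\<^sub>C x"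
    and scaleC_scaleC: "c *\<^sub>C d *\<^sub>C x = (c * d) *\<^sub>C x"
    and cinner_commute: "cinner x y = cnj (cinner y x)"
    and cinner_add_left: "cinner (x + y) z = cinner x z + cinner y z"
    and cinner_scaleC_left: "cinner (c *\<^sub>C x) y = c * cinner x y"
    and Re_cinner: "Re (cinner x y) = inner x y"

definition bounded_ops :: "('h::complex_hilbert \<Rightarrow> 'h) set" where
  "bounded_ops = {T. bounded_linear T \<and> (\<forall>c \<xi>. T (c *\<^sub>C \<xi>) = c *\<^sub>C T \<xi>)}"

definition hadj :: "('h::complex_hilbert \<Rightarrow> 'h) \<Rightarrow> 'h \<Rightarrow> 'h" where
  "hadj T = (THE S. \<forall>\<xi> \<eta>. cinner (S \<xi>) \<eta> = cinner \<xi> (T \<eta>))"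

definition commutant :: "('h::complex_hilbert \<Rightarrow> 'h) set \<Rightarrow> ('h \<Rightarrow> 'h) set" where
  "commutant X = {T \<in> bounded_ops. \<forall>x\<in>X. T \<circ> x = x \<circ> T}"

definition von_neumann_algebra :: "('h::complex_hilbert \<Rightarrow> 'h) set \<Rightarrow> bool" where
  "von_neumann_algebra N \<longleftrightarrow>
     N \<subseteq> bounded_ops \<and> (\<forall>x\<in>N. hadj x \<in> N) \<and> commutant (commutant N) = N"

definition factor :: "('h::complex_hilbert \<Rightarrow> 'h) set \<Rightarrow> bool" where
  "factor N \<longleftrightarrow> von_neumann_algebra N \<and> (\<exists>\<xi>::'h. \<xi> \<noteq> 0) \<and>
     N \<inter> commutant N = range (\<lambda>c \<xi>. c *\<^sub>C \<xi>)"

definition projection :: "('h::complex_hilbert \<Rightarrow> 'h) \<Rightarrow> bool" where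
  "projection p \<longleftrightarrow> p \<in> bounded_ops \<and> p \<circ> p = p \<and> hadj p = p"

definition minimal_projection ::
  "('h::complex_hilbert \<Rightarrow> 'h) set \<Rightarrow> ('h \<Rightarrow> 'h) \<Rightarrow> bool" where
  "minimal_projection N p \<longleftrightarrow> p \<in> N \<and> projection p \<and> p \<noteq> (\<lambda>\<xi>. 0) \<and>
     (\<forall>q\<in>N. projection q \<and> p \<circ> q = q \<longrightarrow> q = (\<lambda>\<xi>. 0) \<or> q = p)"

text \<open>A factor is of type I iff it has a minimal projection. Type \<open>II\<^sub>1\<close> means not of type I, and
  finite: the identity is not equivalent to a proper subprojection.\<close>

definition II1_factor :: "('h::complex_hilbert \<Rightarrow> 'h) set \<Rightarrow> bool" where
  "II1_factor N \<longleftrightarrow> factor N \<and> (\<forall>v\<in>N. hadj v \<circ> v = id \<longrightarrow> v \<circ> hadj v = id) \<and>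
     (\<nexists>p. minimal_projection N p)"

definition ultraweak_topology :: "('h::complex_hilbert \<Rightarrow> 'h) topology" where
  "ultraweak_topology = topology_generated_by
     {{x \<in> bounded_ops. (\<Sum>i. cinner (x (\<xi> i)) (\<eta> i)) \<in> V} | \<xi> \<eta> V.
        summable (\<lambda>i::nat. (norm (\<xi> i))\<^sup>2) \<and> summable (\<lambda>i. (norm (\<eta> i))\<^sup>2) \<and> open V}"

text \<open>Endomorphisms of von Neumann algebras are normal, i.e. ultraweakly continuous; a unital
  *-endomorphism of a \<open>II\<^sub>1\<close> factor is automatically so, because it preserves the trace.\<close>

definition unital_star_endomorphism ::
  "('h::complex_hilbert \<Rightarrow> 'h) set \<Rightarrow> (('h \<Rightarrow> 'h) \<Rightarrow> 'h \<Rightarrow> 'h) \<Rightarrow> bool" where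
  "unital_star_endomorphism N \<Phi> \<longleftrightarrow>
     (\<forall>x\<in>N. \<Phi> x \<in> N) \<and>
     (\<forall>x\<in>N. \<forall>y\<in>N. \<Phi> (\<lambda>\<xi>. x \<xi> + y \<xi>) = (\<lambda>\<xi>. \<Phi> x \<xi> + \<Phi> y \<xi>)) \<and>
     (\<forall>c. \<forall>x\<in>N. \<Phi> (\<lambda>\<xi>. c *\<^sub>C x \<xi>) = (\<lambda>\<xi>. c *\<^sub>C \<Phi> x \<xi>)) \<and>
     (\<forall>x\<in>N. \<forall>y\<in>N. \<Phi> (x \<circ> y) = \<Phi> x \<circ> \<Phi> y) \<and>
     (\<forall>x\<in>N. \<Phi> (hadj x) = hadj (\<Phi> x)) \<and>
     \<Phi> id = id \<and>
     continuous_map (subtopology ultraweak_topology N) (subtopology ultraweak_topology N) \<Phi>"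


section \<open>Murray--von Neumann dimension and the Jones index\<close>

text \<open>Throughout, \<open>\<Omega>\<close> is a unit vector whose vector state restricts to the normalized trace of the
  \<open>II\<^sub>1\<close> factor \<open>N\<close>, so that \<open>L2 N \<Omega>\<close> is \<open>L\<^sup>2(N)\<close>, and \<open>K\<close> is a closed \<open>N\<close>-invariant subspace.\<close>

definition L2 :: "('h::complex_hilbert \<Rightarrow> 'h) set \<Rightarrow> 'h \<Rightarrow> 'h set" where
  "L2 N \<Omega> = closure {x \<Omega> | x. x \<in> N}"

text \<open>The sequence \<open>U\<close> lists the components of an \<open>N\<close>-linear isometry from \<open>K\<close> into
  \<open>L\<^sup>2(N) \<otimes> \<ell>\<^sup>2(\<nat>)\<close>, extended by zero to the orthogonal complement of \<open>K\<close>.\<close>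

definition module_isometry ::
  "('h::complex_hilbert \<Rightarrow> 'h) set \<Rightarrow> 'h \<Rightarrow> 'h set \<Rightarrow> (nat \<Rightarrow> 'h \<Rightarrow> 'h) \<Rightarrow> bool" where
  "module_isometry N \<Omega> K U \<longleftrightarrow>
     (\<forall>i. U i \<in> bounded_ops \<and> range (U i) \<subseteq> L2 N \<Omega> \<and> (\<forall>x\<in>N. U i \<circ> x = x \<circ> U i) \<and>
          (\<forall>\<xi>. (\<forall>\<eta>\<in>K. cinner \<xi> \<eta> = 0) \<longrightarrow> U i \<xi> = 0)) \<and>
     (\<forall>\<xi>\<in>K. (\<lambda>i. (norm (U i \<xi>))\<^sup>2) sums (norm \<xi>)\<^sup>2)"

text \<open>\<open>dim\<^sub>N K = Tr(UU\<^sup>*)\<close>. The trace is that of the commutant of \<open>N\<close> on \<open>L\<^sup>2(N) \<otimes> \<ell>\<^sup>2(\<nat>)\<close>, whose value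
  is the sum over the diagonal entries of the vector state of \<open>\<Omega>\<close>. It does not depend on the
  choice of \<open>U\<close>.\<close>

definition vN_dim :: "('h::complex_hilbert \<Rightarrow> 'h) set \<Rightarrow> 'h \<Rightarrow> 'h set \<Rightarrow> ennreal" where
  "vN_dim N \<Omega> K = (THE d. \<exists>U. module_isometry N \<Omega> K U \<and>
     d = (\<Sum>i. ennreal (Re (cinner (U i (hadj (U i) \<Omega>)) \<Omega>))))"

text \<open>\<open>[R : N] = dim\<^sub>N L\<^sup>2(R)\<close>\<close>

definition jones_index ::
  "('h::complex_hilbert \<Rightarrow> 'h) set \<Rightarrow> ('h \<Rightarrow> 'h) set \<Rightarrow> 'h \<Rightarrow> ennreal" where
  "jones_index R N \<Omega> = vN_dim N \<Omega> (L2 R \<Omega>)"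


section \<open>The tower of matrix algebras\<close>

text \<open>Matrices over \<open>\<otimes>\<^sup>k \<complex>\<^sup>n\<close> are \<open>n\<^sup>k \<times> n\<^sup>k\<close> matrices via the Kronecker product.\<close>

definition kron :: "complex mat \<Rightarrow> complex mat \<Rightarrow> complex mat" where
  "kron X Y = Matrix.mat (dim_row X * dim_row Y) (dim_col X * dim_col Y)
     (\<lambda>(p, q). X $$ (p div dim_row Y, q div dim_col Y) * Y $$ (p mod dim_row Y, q mod dim_col Y))"

definition tensor_list :: "complex mat list \<Rightarrow> complex mat" where
  "tensor_list Xs = foldl kron (1\<^sub>m 1) Xs"

inductive_set star_algebra :: "complex mat set \<Rightarrow> complex mat set"
  for S :: "complex mat set" where
  gen: "X \<in> S \<Longrightarrow> X \<in> star_algebra S"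
| add: "X \<in> star_algebra S \<Longrightarrow> Y \<in> star_algebra S \<Longrightarrow> X + Y \<in> star_algebra S"
| smult: "X \<in> star_algebra S \<Longrightarrow> c \<cdot>\<^sub>m X \<in> star_algebra S"
| mult: "X \<in> star_algebra S \<Longrightarrow> Y \<in> star_algebra S \<Longrightarrow> X * Y \<in> star_algebra S"
| adjoint: "X \<in> star_algebra S \<Longrightarrow> mat_adjoint X \<in> star_algebra S"

text \<open>The list \<open>a\<close> holds the block sizes; blocks and basis vectors are numbered from 0, tensor
  positions from 1.\<close>

definition algA :: "nat list \<Rightarrow> complex mat set" where
  "algA a = {diag_block_mat Bs | Bs. length Bs = length a \<and>
     (\<forall>i<length a. Bs ! i \<in> carrier_mat (a ! i) (a ! i))}"

definition corner :: "nat list \<Rightarrow> nat \<Rightarrow> nat" where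
  "corner a i = sum_list (take (Suc i) a) - 1"

definition matv :: "nat list \<Rightarrow> complex mat" where
  "matv a = Matrix.mat (sum_list a) (sum_list a) (\<lambda>(p, q).
     if (\<exists>i<length a. q = corner a i \<and> p = corner a (Suc i mod length a)) \<or>
        (p = q \<and> (\<forall>i<length a. q \<noteq> corner a i)) then 1 else 0)"

definition mats :: "nat list \<Rightarrow> complex mat" where
  "mats a = mat_diag (sum_list a) (\<lambda>p. if \<exists>i<length a. p = corner a i then 1 else 0)"

definition matr :: "nat list \<Rightarrow> complex mat" where
  "matr a = mats a * matv a * mats a"

definition matw :: "nat list \<Rightarrow> complex mat" where
  "matw a = diag_block_mat
     (map (\<lambda>i. exp (2 * of_real pi * \<i> / of_nat (length a)) ^ i \<cdot>\<^sub>m 1\<^sub>m (a ! i)) [0..<length a])"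

definition S1 :: "nat set" where
  "S1 = {l * (l + 1) div 2 | l. l \<ge> 1}"

definition at_site :: "nat list \<Rightarrow> nat \<Rightarrow> complex mat \<Rightarrow> complex mat" where
  "at_site a m X = kron (1\<^sub>m (sum_list a ^ (m - 1))) X"

text \<open>\<open>w\<^sub>1\<^bsup>b\<^sub>1\<^esup> \<cdots> w\<^sub>m\<^sub>-\<^sub>1\<^bsup>b\<^sub>m\<^sub>-\<^sub>1\<^esup> \<otimes> r\<close> is the elementary tensor with factors \<open>w\<^bsup>b\<^sub>l\<^esup>\<close> and last factor \<open>r\<close>.\<close>

definition rgen :: "nat list \<Rightarrow> nat \<Rightarrow> complex mat" where
  "rgen a m = tensor_list
     (map (\<lambda>l. if m - l \<in> S1 then matw a else 1\<^sub>m (sum_list a)) [1..<m] @ [matr a])"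

definition embed :: "nat list \<Rightarrow> nat \<Rightarrow> nat \<Rightarrow> complex mat \<Rightarrow> complex mat" where
  "embed a m k X = kron X (1\<^sub>m (sum_list a ^ (k - m)))"

definition algM :: "nat list \<Rightarrow> nat \<Rightarrow> complex mat set" where
  "algM a k = star_algebra (\<Union>m\<in>{1..k}.
     insert (embed a m k (rgen a m)) ((\<lambda>X. embed a m k (at_site a m X)) ` algA a))"

definition ntrace :: "complex mat \<Rightarrow> complex" where
  "ntrace X = (\<Sum>i<dim_row X. X $$ (i, i)) / of_nat (dim_row X)"


section \<open>The factor and its one-shift\<close>

text \<open>\<open>(\<pi>, \<Omega>)\<close> is the GNS representation of \<open>(M, \<tau>)\<close>, which is determined up to unitary equivalence by
  being a cyclic *-representation with vector state \<open>\<tau>\<close>. As \<open>M\<close> is the union of the algebras \<open>M\<^sub>k\<close>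
  with \<open>X\<close> identified with \<open>X \<otimes> 1\<close>, a representation of \<open>M\<close> is a compatible one of all \<open>M\<^sub>k\<close>.
  For \<open>n \<ge> 2\<close> the size of a matrix determines \<open>k\<close>.\<close>

definition GNS_representation ::
  "nat list \<Rightarrow> (complex mat \<Rightarrow> 'h \<Rightarrow> 'h) \<Rightarrow> 'h::complex_hilbert \<Rightarrow> bool" where
  "GNS_representation a \<pi> \<Omega> \<longleftrightarrow>
     (\<forall>k\<ge>1. \<forall>X\<in>algM a k.
        \<pi> X \<in> bounded_ops \<and>
        (\<forall>Y\<in>algM a k. \<pi> (X + Y) = (\<lambda>\<xi>. \<pi> X \<xi> + \<pi> Y \<xi>) \<and> \<pi> (X * Y) = \<pi> X \<circ> \<pi> Y) \<and>
        (\<forall>c. \<pi> (c \<cdot>\<^sub>m X) = (\<lambda>\<xi>. c *\<^sub>C \<pi> X \<xi>)) \<and>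
        \<pi> (mat_adjoint X) = hadj (\<pi> X) \<and>
        \<pi> (embed a k (Suc k) X) = \<pi> X \<and>
        cinner (\<pi> X \<Omega>) \<Omega> = ntrace X) \<and>
     (\<forall>k\<ge>1. \<pi> (1\<^sub>m (sum_list a ^ k)) = id) \<and>
     closure {\<pi> X \<Omega> | X k. k \<ge> 1 \<and> X \<in> algM a k} = UNIV"

definition algR :: "nat list \<Rightarrow> (complex mat \<Rightarrow> 'h::complex_hilbert \<Rightarrow> 'h) \<Rightarrow> ('h \<Rightarrow> 'h) set" where
  "algR a \<pi> = commutant (commutant (\<pi> ` (\<Union>k\<in>{1..}. algM a k)))"

definition one_shift ::
  "nat list \<Rightarrow> (complex mat \<Rightarrow> 'h::complex_hilbert \<Rightarrow> 'h) \<Rightarrow> (('h \<Rightarrow> 'h) \<Rightarrow> 'h \<Rightarrow> 'h) \<Rightarrow> bool" where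
  "one_shift a \<pi> \<Phi> \<longleftrightarrow> unital_star_endomorphism (algR a \<pi>) \<Phi> \<and>
     (\<forall>k\<ge>1. \<forall>X\<in>algA a. \<Phi> (\<pi> (at_site a k X)) = \<pi> (at_site a (Suc k) X)) \<and>
     (\<forall>k\<ge>1. \<Phi> (\<pi> (rgen a k)) = \<pi> (rgen a (Suc k)))"

end

(* The algebra A and the matrix r generate the full matrix algebra M_n, and w is in A, so every M_k is
   the full matrix algebra of size n^k and R is the weak closure of an increasing union of matrix
   algebras. Averaging over the matrix units of M_k converges to the trace boundedly and weakly; this
   shows that R is a factor and that every normal endomorphism preserves the trace. Hence Phi is
   implemented by an isometry V, and x = V* z V is a preimage of any z in Phi(R)'' by the commutation
   theorem for right multiplications.

   On M_k the endomorphism is X |-> U (1 (x) X) U* for a diagonal unitary U that is block-scalar in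
   the first tensor factor. So the trace factorizes, tau(x Phi(y)) = tau(x) tau(y) for x in M_1, and
   M_(k+1) = Phi(M_k) M_1. The normalized matrix units of M_1 therefore form an orthonormal basis of
   R over Phi(R) with n^2 elements. *)
theory Submission
  imports Defs
    "HOL-Analysis.Elementary_Normed_Spaces"
    "HOL-Analysis.Uniform_Limit"
    "HOL-Analysis.Abstract_Limits"
begin

section \<open>Complex Hilbert spaces\<close>

text \<open>The index is a definite description, so a single isometry does not settle it: every
  module isometry must give the same number. Instead of a trace on the commutant of the range P, the
  proof uses that an operator T in this commutant with T\<Omega> and \<open>hadj T \<Omega>\<close>
  in L2(P) has the same norm at \<Omega> as its adjoint. This turns the sum for any isometry into
  one term |b_s \<Omega>|^2 = 1 per basis element. Bounded approximation in the strong topology is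
  avoided: x\<Omega> -> \<open>hadj x \<Omega>\<close> is isometric on a tracial algebra, so
  T\<Omega> and \<open>hadj T \<Omega>\<close> are limits of t_k\<Omega> and
  \<open>hadj (t_k) \<Omega>\<close> for one sequence t_k, and inner products of such vectors
  suffice for the commutation theorem. The unitary U arises as follows. \<Phi> must send r_m to w
  (x) r_m if m is in S1 and to 1 (x) r_m otherwise. A diagonal unitary W satisfies W r_m W* =
  \<gamma> r_m in the first case and W r_m W* = r_m in the second. With q_0, q_1, ... the block
  units of A, conjugating 1 (x) r_m by the sum of the q_i (x) W^i yields w (x) r_m, the sum of the
  \<gamma>^i q_i (x) r_m, or 1 (x) r_m. Block matrices at any site commute with W and are only
  moved.\<close>

lemma cinner_add_right: "cinner x (y + z) = cinner x y + cinner x z"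
  for x y z :: "'h::complex_hilbert"
  by (metis cinner_add_left cinner_commute complex_cnj_add)

lemma cinner_scaleC_right: "cinner x (c *\<^sub>C y) = cnj c * cinner x y"
  for x y :: "'h::complex_hilbert"
  by (metis cinner_commute cinner_scaleC_left complex_cnj_mult)

lemma cinner_scaleR_left: "cinner (r *\<^sub>R x) y = of_real r * cinner x y"
  for x y :: "'h::complex_hilbert"
  by (metis cinner_scaleC_left scaleC_of_real)

lemma cinner_scaleR_right: "cinner x (r *\<^sub>R y) = of_real r * cinner x y"
  for x y :: "'h::complex_hilbert"
  by (metis cinner_scaleC_right scaleC_of_real complex_cnj_complex_of_real)

lemma scaleC_one [simp]: "1 *\<^sub>C x = x"
  for x :: "'h::complex_hilbert"
  using scaleC_of_real[of 1 x] by simp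

lemma scaleC_zero_left [simp]: "0 *\<^sub>C x = 0"
  for x :: "'h::complex_hilbert"
  using scaleC_of_real[of 0 x] by simp

lemma scaleC_zero_right [simp]: "c *\<^sub>C (0::'h::complex_hilbert) = 0"
  using scaleC_add_right[of c 0 0] by simp

lemma cinner_zero_left [simp]: "cinner 0 (y::'h::complex_hilbert) = 0"
  using cinner_add_left[of 0 0 y] by simp

lemma cinner_zero_right [simp]: "cinner y (0::'h::complex_hilbert) = 0"
  using cinner_add_right[of y 0 0] by simp

lemma cinner_minus_left [simp]: "cinner (- x) y = - cinner x y"
  for x y :: "'h::complex_hilbert"
  using cinner_add_left[of x "-x" y] by (simp add: eq_neg_iff_add_eq_0 add.commute)

lemma cinner_minus_right [simp]: "cinner x (- y) = - cinner x y"
  for x y :: "'h::complex_hilbert"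
  using cinner_add_right[of x y "-y"] by (simp add: eq_neg_iff_add_eq_0 add.commute)

lemma cinner_diff_left: "cinner (x - y) z = cinner x z - cinner y z"
  for x y z :: "'h::complex_hilbert"
  using cinner_add_left[of x "-y" z] by simp

lemma cinner_diff_right: "cinner x (y - z) = cinner x y - cinner x z"
  for x y z :: "'h::complex_hilbert"
  using cinner_add_right[of x y "-z"] by simp

lemma cinner_sum_left: "cinner (\<Sum>i\<in>I. f i) y = (\<Sum>i\<in>I. cinner (f i) y)"
  for y :: "'h::complex_hilbert"
  by (induction I rule: infinite_finite_induct) (simp_all add: cinner_add_left)

lemma cinner_sum_right: "cinner y (\<Sum>i\<in>I. f i) = (\<Sum>i\<in>I. cinner y (f i))"
  for y :: "'h::complex_hilbert"
  by (induction I rule: infinite_finite_induct) (simp_all add: cinner_add_right)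

lemma scaleC_minus_one: "(-1) *\<^sub>C x = - x"
  for x :: "'h::complex_hilbert"
  using scaleC_of_real[of "-1" x] by simp

lemma cinner_self: "cinner x x = of_real ((norm x)\<^sup>2)"
  for x :: "'h::complex_hilbert"
proof (rule complex_eqI)
  show "Re (cinner x x) = Re (of_real ((norm x)\<^sup>2))"
    by (simp add: Re_cinner power2_norm_eq_inner)
  have "cinner x x = cnj (cinner x x)" by (rule cinner_commute)
  hence "Im (cinner x x) = - Im (cinner x x)" by (metis cnj.simps(2))
  thus "Im (cinner x x) = Im (of_real ((norm x)\<^sup>2))" by simp
qed

lemma norm_scaleC: "norm (c *\<^sub>C x) = norm c * norm x"
  for x :: "'h::complex_hilbert"
proof -
  have "complex_of_real ((norm (c *\<^sub>C x))\<^sup>2) = c * cnj c * of_real ((norm x)\<^sup>2)"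
    unfolding cinner_self[symmetric] by (simp add: cinner_scaleC_left cinner_scaleC_right)
  also have "\<dots> = of_real ((norm c * norm x)\<^sup>2)"
    by (simp only: complex_norm_square[symmetric] of_real_mult power_mult_distrib of_real_power)
  finally have "(norm (c *\<^sub>C x))\<^sup>2 = (norm c * norm x)\<^sup>2"
    using of_real_eq_iff by blast
  thus ?thesis by (simp add: power2_eq_iff_nonneg)
qed

lemma cinner_Cauchy_Schwarz: "norm (cinner x y) \<le> norm x * norm y"
  for x y :: "'h::complex_hilbert"
proof (cases "cinner x y = 0")
  case False
  \<comment> \<open>A phase that turns the inner product into its modulus; the real Cauchy-Schwarz
    inequality then applies to c x and y.\<close>
  define c where "c = cnj (sgn (cinner x y))"
  have "norm c = 1" using False by (simp add: c_def norm_sgn)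
  have "c * cinner x y = of_real (norm (cinner x y))"
    using False complex_norm_square[of "cinner x y"] unfolding c_def sgn_div_norm
    by (simp add: scaleR_conv_of_real field_simps power2_eq_square)
  hence "norm (cinner x y) = Re (cinner (c *\<^sub>C x) y)" by (simp add: cinner_scaleC_left)
  also have "\<dots> \<le> norm (c *\<^sub>C x) * norm y"
    unfolding Re_cinner by (rule norm_cauchy_schwarz)
  finally show ?thesis using \<open>norm c = 1\<close> by (simp add: norm_scaleC)
qed simp

lemma bounded_bilinear_cinner: "bounded_bilinear (cinner :: 'h::complex_hilbert \<Rightarrow> _)"
  by unfold_locales
    (auto simp: cinner_add_left cinner_add_right cinner_scaleR_left cinner_scaleR_right
      scaleR_conv_of_real intro!: exI[of _ 1] cinner_Cauchy_Schwarz)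

lemmas tendsto_cinner [tendsto_intros] = bounded_bilinear.tendsto[OF bounded_bilinear_cinner]

lemma bounded_linear_scaleC: "bounded_linear (\<lambda>x::'h::complex_hilbert. c *\<^sub>C x)"
  by (rule bounded_linear_intro[of _ "norm c"])
    (auto simp: scaleC_add_right scaleC_of_real[symmetric] scaleC_scaleC norm_scaleC mult.commute)

lemmas tendsto_scaleC [tendsto_intros] = bounded_linear.tendsto[OF bounded_linear_scaleC]

lemma cinner_ext_left:
  fixes x y :: "'h::complex_hilbert"
  assumes "\<And>z. cinner x z = cinner y z"
  shows "x = y"
proof -
  have "cinner (x - y) (x - y) = 0" unfolding cinner_diff_left by (simp add: assms)
  thus ?thesis by (simp add: cinner_self)
qed

lemma cinner_eq_0_sym: "cinner x y = 0 \<longleftrightarrow> cinner y x = 0"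
  for x y :: "'h::complex_hilbert"
  by (metis cinner_commute complex_cnj_zero)

lemma cinner_orth_dense:
  fixes x :: "'h::complex_hilbert"
  assumes "\<And>s. s \<in> S \<Longrightarrow> cinner x s = 0" "y \<in> closure S"
  shows "cinner x y = 0"
proof -
  obtain s where s: "\<And>n::nat. s n \<in> S" "s \<longlonglongrightarrow> y"
    using assms(2) unfolding closure_sequential by blast
  have "(\<lambda>n. cinner x (s n)) \<longlonglongrightarrow> cinner x y" by (intro tendsto_intros s)
  moreover have "(\<lambda>n. cinner x (s n)) = (\<lambda>n. 0)" using assms(1) s(1) by blast
  ultimately show ?thesis by (simp add: LIMSEQ_const_iff)
qed


section \<open>Bounded operators and their adjoints\<close>

lemma bounded_opsI:
  assumes "\<And>x y. T (x + y) = T x + T y" "\<And>c x. T (c *\<^sub>C x) = c *\<^sub>C T x"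
    "\<And>x. norm (T x) \<le> norm x * K"
  shows "T \<in> bounded_ops"
proof -
  have "bounded_linear T"
    by (rule bounded_linear_intro[of _ K]) (simp_all only: assms scaleC_of_real[symmetric])
  thus ?thesis by (simp add: bounded_ops_def assms(2))
qed

lemma bounded_opsD:
  assumes "T \<in> bounded_ops"
  shows bounded_ops_bounded_linear: "bounded_linear T"
    and bounded_ops_add: "T (x + y) = T x + T y"
    and bounded_ops_diff: "T (x - y) = T x - T y"
    and bounded_ops_zero: "T 0 = 0"
    and bounded_ops_scaleR: "T (r *\<^sub>R x) = r *\<^sub>R T x"
    and bounded_ops_scaleC: "T (c *\<^sub>C x) = c *\<^sub>C T x"
    and bounded_ops_sum: "T (\<Sum>i\<in>I. f i) = (\<Sum>i\<in>I. T (f i))"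
proof -
  show bl: "bounded_linear T" using assms by (auto simp: bounded_ops_def)
  interpret bounded_linear T by fact
  show "T (x + y) = T x + T y" "T (x - y) = T x - T y" "T 0 = 0"
    "T (r *\<^sub>R x) = r *\<^sub>R T x" "T (\<Sum>i\<in>I. f i) = (\<Sum>i\<in>I. T (f i))"
    by (simp_all add: add diff zero scaleR sum)
  show "T (c *\<^sub>C x) = c *\<^sub>C T x" using assms by (auto simp: bounded_ops_def)
qed

lemma bounded_ops_tendsto:
  "T \<in> bounded_ops \<Longrightarrow> (f \<longlongrightarrow> l) F \<Longrightarrow> ((\<lambda>x. T (f x)) \<longlongrightarrow> T l) F"
  by (rule bounded_linear.tendsto[OF bounded_ops_bounded_linear])

lemma bounded_ops_bound:
  assumes "T \<in> bounded_ops"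
  obtains K where "K > 0" "\<And>x. norm (T x) \<le> norm x * K"
  using bounded_linear.pos_bounded[OF bounded_ops_bounded_linear[OF assms]] by blast

lemma bounded_ops_id: "id \<in> bounded_ops" "(\<lambda>x. x) \<in> bounded_ops"
  by (auto intro!: bounded_opsI[of _ 1])

lemma bounded_ops_const_0: "(\<lambda>x. 0) \<in> bounded_ops"
  by (auto intro!: bounded_opsI[of _ 0])

lemma bounded_ops_comp:
  assumes "S \<in> bounded_ops" "T \<in> bounded_ops"
  shows "S \<circ> T \<in> bounded_ops"
  using assms bounded_linear_compose unfolding bounded_ops_def by (auto simp: comp_def)

lemma bounded_ops_plus:
  assumes "S \<in> bounded_ops" "T \<in> bounded_ops"
  shows "(\<lambda>x. S x + T x) \<in> bounded_ops"
  using assms bounded_linear_add unfolding bounded_ops_def by (auto simp: scaleC_add_right)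

lemma bounded_ops_scale:
  assumes "T \<in> bounded_ops"
  shows "(\<lambda>x. c *\<^sub>C T x) \<in> bounded_ops"
  using assms bounded_linear_compose[OF bounded_linear_scaleC] unfolding bounded_ops_def
  by (auto simp: scaleC_scaleC mult.commute)

lemma bounded_ops_uminus:
  assumes "T \<in> bounded_ops"
  shows "(\<lambda>x. - T x) \<in> bounded_ops"
  using bounded_ops_scale[OF assms, of "-1"] by (simp add: scaleC_minus_one)

lemma bounded_ops_minus_op:
  assumes "S \<in> bounded_ops" "T \<in> bounded_ops"
  shows "(\<lambda>x. S x - T x) \<in> bounded_ops"
  using bounded_ops_plus[OF assms(1) bounded_ops_uminus[OF assms(2)]] by simp

section \<open>Orthogonal decomposition and the Riesz representation\<close>

definition complex_subspace :: "'h::complex_hilbert set \<Rightarrow> bool" where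
  "complex_subspace S \<longleftrightarrow> 0 \<in> S \<and> (\<forall>x\<in>S. \<forall>y\<in>S. x + y \<in> S) \<and> (\<forall>c. \<forall>x\<in>S. c *\<^sub>C x \<in> S)"

lemma parallelogram_law:
  "(norm (x + y))\<^sup>2 + (norm (x - y))\<^sup>2 = 2 * (norm x)\<^sup>2 + 2 * (norm (y::'a::real_inner))\<^sup>2"
  by (simp add: power2_norm_eq_inner inner_add_left inner_add_right inner_diff_left inner_diff_right)

text \<open>A minimizing sequence is Cauchy by the parallelogram law, because midpoints stay in the
  subspace and hence keep distance at least d from x.\<close>

lemma nearest_point_exists:
  fixes S :: "'h::complex_hilbert set"
  assumes S: "complex_subspace S" "closed S"
  shows "\<exists>p\<in>S. \<forall>s\<in>S. norm (x - p) \<le> norm (x - s)"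
proof -
  define d where "d = Inf ((\<lambda>s. norm (x - s)) ` S)"
  have S0: "0 \<in> S" and Sadd: "\<And>u v. u \<in> S \<Longrightarrow> v \<in> S \<Longrightarrow> u + v \<in> S"
    and Ssc: "\<And>c u. u \<in> S \<Longrightarrow> c *\<^sub>C u \<in> S"
    using S(1) by (auto simp: complex_subspace_def)
  have bdd: "bdd_below ((\<lambda>s. norm (x - s)) ` S)" by (auto intro: bdd_belowI[of _ 0])
  have dle: "d \<le> norm (x - s)" if "s \<in> S" for s
    unfolding d_def using bdd that by (intro cInf_lower) auto
  have d0: "0 \<le> d" unfolding d_def using S0 by (intro cInf_greatest) auto
  have "\<exists>s\<in>S. norm (x - s) < d + 1 / Suc k" for k
  proof -
    have "Inf ((\<lambda>s. norm (x - s)) ` S) < d + 1 / Suc k" by (simp add: d_def)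
    then obtain y where "y \<in> (\<lambda>s. norm (x - s)) ` S" "y < d + 1 / Suc k"
      using cInf_lessD S0 by (metis empty_iff image_is_empty)
    thus ?thesis by blast
  qed
  then obtain s where sS: "\<And>k. s k \<in> S" and sd: "\<And>k. norm (x - s k) < d + 1 / Suc k" by metis
  have key: "(norm (s k - s l))\<^sup>2 \<le> 2 * (norm (x - s k))\<^sup>2 + 2 * (norm (x - s l))\<^sup>2 - 4 * d\<^sup>2" for k l
  proof -
    let ?m = "(1/2::complex) *\<^sub>C (s k + s l)"
    have m: "?m = (1/2::real) *\<^sub>R (s k + s l)" using scaleC_of_real[of "1/2"] by simp
    have "d \<le> norm (x - ?m)" using dle Ssc Sadd sS by blast
    moreover have "(x - s k) + (x - s l) = 2 *\<^sub>R (x - ?m)"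
      unfolding m by (simp add: algebra_simps scaleR_2)
    ultimately have "(2 * d)\<^sup>2 \<le> (norm ((x - s k) + (x - s l)))\<^sup>2"
      using d0 by (intro power_mono) auto
    moreover have "norm ((x - s k) - (x - s l)) = norm (s k - s l)"
      by (simp add: norm_minus_commute)
    ultimately show ?thesis using parallelogram_law[of "x - s k" "x - s l"]
      by (simp add: power_mult_distrib)
  qed
  have lim: "(\<lambda>k. norm (x - s k)) \<longlonglongrightarrow> d"
  proof (rule tendsto_sandwich[of "\<lambda>k. d" _ _ "\<lambda>k. d + 1 / Suc k"])
    show "(\<lambda>k. d + 1 / real (Suc k)) \<longlonglongrightarrow> d"
      using tendsto_add[OF tendsto_const[of d] LIMSEQ_inverse_real_of_nat] by (simp add: inverse_eq_divide)
  qed (use dle sS less_imp_le[OF sd] in \<open>auto intro!: always_eventually\<close>)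
  have "Cauchy s"
  proof (rule CauchyI)
    fix e :: real assume e: "e > 0"
    have "(\<lambda>k. 2 * (norm (x - s k))\<^sup>2 - 2 * d\<^sup>2) \<longlonglongrightarrow> 2 * d\<^sup>2 - 2 * d\<^sup>2"
      by (intro tendsto_intros lim)
    hence "\<forall>\<^sub>F k in sequentially. 2 * (norm (x - s k))\<^sup>2 - 2 * d\<^sup>2 < e\<^sup>2 / 2"
      using e by (intro order_tendstoD(2)) auto
    then obtain N where N: "\<And>k. k \<ge> N \<Longrightarrow> 2 * (norm (x - s k))\<^sup>2 - 2 * d\<^sup>2 < e\<^sup>2 / 2"
      by (auto simp: eventually_sequentially)
    have "norm (s k - s l) < e" if "k \<ge> N" "l \<ge> N" for k l
    proof -
      have "(norm (s k - s l))\<^sup>2 < e\<^sup>2" using key[of k l] N[OF that(1)] N[OF that(2)] by linarith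
      thus ?thesis using e power2_less_imp_less by (metis less_imp_le)
    qed
    thus "\<exists>N. \<forall>k\<ge>N. \<forall>l\<ge>N. norm (s k - s l) < e" by blast
  qed
  then obtain p where p: "s \<longlonglongrightarrow> p" using Cauchy_convergent convergent_def by blast
  have "p \<in> S" using closed_sequentially[OF S(2)] sS p by blast
  moreover have "(\<lambda>k. norm (x - s k)) \<longlonglongrightarrow> norm (x - p)" by (intro tendsto_intros p)
  hence "norm (x - p) = d" using LIMSEQ_unique lim by blast
  ultimately show ?thesis using dle by auto
qed

text \<open>Moving the nearest point p along s by the multiple c lowers the squared distance by |<x
  - p, s>|^2 / |s|^2, so minimality forces this number to be 0.\<close>

lemma orthogonal_decomposition:
  fixes S :: "'h::complex_hilbert set"
  assumes S: "complex_subspace S" "closed S"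
  shows "\<exists>p\<in>S. \<forall>s\<in>S. cinner (x - p) s = 0"
proof -
  obtain p where pS: "p \<in> S" and p: "\<And>s. s \<in> S \<Longrightarrow> norm (x - p) \<le> norm (x - s)"
    using nearest_point_exists[OF S] by metis
  have Sadd: "\<And>u v. u \<in> S \<Longrightarrow> v \<in> S \<Longrightarrow> u + v \<in> S"
    and Ssc: "\<And>c u. u \<in> S \<Longrightarrow> c *\<^sub>C u \<in> S"
    using S(1) by (auto simp: complex_subspace_def)
  have "cinner (x - p) s = 0" if s: "s \<in> S" for s
  proof (cases "s = 0")
    case False
    let ?c = "cinner (x - p) s"
    define c where "c = ?c / of_real ((norm s)\<^sup>2)"
    have n0: "(norm s)\<^sup>2 \<noteq> 0" using False by simp
    have "norm (x - p) \<le> norm ((x - p) - c *\<^sub>C s)"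
      using p[of "p + c *\<^sub>C s"] Sadd Ssc pS s by (simp add: algebra_simps)
    hence "(norm (x - p))\<^sup>2 \<le> (norm ((x - p) - c *\<^sub>C s))\<^sup>2" by (simp add: power_mono)
    moreover have "complex_of_real ((norm ((x - p) - c *\<^sub>C s))\<^sup>2) =
        of_real ((norm (x - p))\<^sup>2) - ?c * cnj ?c / of_real ((norm s)\<^sup>2)"
      unfolding cinner_self[symmetric] cinner_diff_left[of "x - p"] cinner_diff_right[of _ "x - p"]
        cinner_scaleC_left cinner_scaleC_right
      using n0 unfolding c_def by (simp add: cinner_self[of s] cinner_commute[of s "x-p"] field_simps)
    hence "complex_of_real ((norm ((x - p) - c *\<^sub>C s))\<^sup>2) =
        of_real ((norm (x - p))\<^sup>2 - (norm ?c)\<^sup>2 / (norm s)\<^sup>2)"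
      by (simp add: complex_norm_square[symmetric])
    hence "(norm ((x - p) - c *\<^sub>C s))\<^sup>2 = (norm (x - p))\<^sup>2 - (norm ?c)\<^sup>2 / (norm s)\<^sup>2"
      using of_real_eq_iff by blast
    ultimately have "(norm ?c)\<^sup>2 / (norm s)\<^sup>2 \<le> 0" by linarith
    thus ?thesis using n0 by (auto simp: divide_le_0_iff)
  qed simp
  thus ?thesis using pS by blast
qed

text \<open>The orthogonal complement of the kernel is spanned by one vector y, because u - (f u / f
  y) y always lies in the kernel; rescaling y gives the representing vector.\<close>

lemma Riesz_representation:
  fixes f :: "'h::complex_hilbert \<Rightarrow> complex"
  assumes add: "\<And>x y. f (x + y) = f x + f y" and sc: "\<And>c x. f (c *\<^sub>C x) = c * f x"
    and bd: "\<And>x. norm (f x) \<le> norm x * K"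
  shows "\<exists>z. \<forall>x. f x = cinner x z"
proof (cases "\<forall>x. f x = 0")
  case True
  thus ?thesis by (intro exI[of _ 0]) simp
next
  case False
  then obtain x where x: "f x \<noteq> 0" by blast
  have bl: "bounded_linear f"
    by (rule bounded_linear_intro[of _ K])
      (auto simp: add bd sc scaleC_of_real[symmetric] scaleR_conv_of_real)
  interpret bounded_linear f by fact
  let ?S = "{x. f x = 0}"
  have "complex_subspace ?S" by (auto simp: complex_subspace_def add sc zero)
  moreover have "closed ?S"
    by (intro closed_Collect_eq continuous_intros continuous_on)
  ultimately obtain p where p: "f p = 0" "\<And>s. f s = 0 \<Longrightarrow> cinner (x - p) s = 0"
    using orthogonal_decomposition[of ?S x] by blast
  define y where "y = x - p"
  have fy: "f y \<noteq> 0" using x p by (simp add: y_def diff)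
  hence y0: "(norm y)\<^sup>2 \<noteq> 0" using zero by auto
  have "f u = cinner u ((cnj (f y) / of_real ((norm y)\<^sup>2)) *\<^sub>C y)" for u
  proof -
    have "f (u - (f u / f y) *\<^sub>C y) = 0" using fy by (simp add: diff sc)
    hence "cinner y (u - (f u / f y) *\<^sub>C y) = 0" using p(2) by (simp add: y_def)
    hence "cinner (u - (f u / f y) *\<^sub>C y) y = 0" by (simp add: cinner_eq_0_sym)
    hence "cinner u y = f u / f y * of_real ((norm y)\<^sup>2)"
      by (simp add: cinner_diff_left cinner_scaleC_left cinner_self)
    thus ?thesis using fy y0 by (simp add: cinner_scaleC_right field_simps)
  qed
  thus ?thesis by blast
qed

lemma adjoint_exists:
  assumes "T \<in> bounded_ops"
  shows "\<exists>S. \<forall>\<xi> \<eta>. cinner (S \<xi>) \<eta> = cinner \<xi> (T \<eta>)"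
proof -
  obtain K where K: "K > 0" "\<And>x. norm (T x) \<le> norm x * K" using bounded_ops_bound[OF assms] by blast
  have "\<exists>z. \<forall>\<eta>. cinner (T \<eta>) \<xi> = cinner \<eta> z" for \<xi>
  proof (rule Riesz_representation[of _ "K * norm \<xi>"])
    show "norm (cinner (T x) \<xi>) \<le> norm x * (K * norm \<xi>)" for x
      using order_trans[OF cinner_Cauchy_Schwarz mult_right_mono[OF K(2) norm_ge_zero]]
      by (simp add: mult.assoc)
  qed (simp_all add: bounded_opsD[OF assms] cinner_add_left cinner_scaleC_left)
  then obtain S where "\<And>\<xi> \<eta>. cinner (T \<eta>) \<xi> = cinner \<eta> (S \<xi>)" by metis
  thus ?thesis by (metis cinner_commute)
qed

lemma hadj_eqI:
  assumes "\<And>\<xi> \<eta>. cinner (S \<xi>) \<eta> = cinner \<xi> (T \<eta>)" 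
  shows "hadj T = S"
  unfolding hadj_def
proof (rule the_equality)
  fix S' assume "\<forall>\<xi> \<eta>. cinner (S' \<xi>) \<eta> = cinner \<xi> (T \<eta>)"
  hence "S' x = S x" for x by (intro cinner_ext_left) (simp add: assms)
  thus "S' = S" ..
qed (simp add: assms)

lemma cinner_hadj_left:
  assumes "T \<in> bounded_ops"
  shows "cinner (hadj T \<xi>) \<eta> = cinner \<xi> (T \<eta>)"
proof -
  obtain S where S: "\<And>\<xi> \<eta>. cinner (S \<xi>) \<eta> = cinner \<xi> (T \<eta>)"
    using adjoint_exists[OF assms] by blast
  hence "hadj T = S" by (rule hadj_eqI)
  thus ?thesis using S by simp
qed

lemma cinner_hadj_right:
  assumes "T \<in> bounded_ops"
  shows "cinner \<xi> (hadj T \<eta>) = cinner (T \<xi>) \<eta>"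
  by (metis assms cinner_commute cinner_hadj_left)

lemma hadj_bounded_ops:
  assumes "T \<in> bounded_ops"
  shows "hadj T \<in> bounded_ops"
proof -
  obtain K where K: "K > 0" "\<And>x. norm (T x) \<le> norm x * K" using bounded_ops_bound[OF assms] by blast
  show ?thesis
  proof (rule bounded_opsI[of _ K])
    show "hadj T (x + y) = hadj T x + hadj T y" for x y
      by (rule cinner_ext_left) (simp add: cinner_add_left cinner_hadj_left assms)
    show "hadj T (c *\<^sub>C x) = c *\<^sub>C hadj T x" for c x
      by (rule cinner_ext_left) (simp add: cinner_scaleC_left cinner_hadj_left assms)
    fix x
    have "(norm (hadj T x))\<^sup>2 = norm (cinner (hadj T x) (hadj T x))"
      by (simp add: cinner_self norm_power)
    also have "\<dots> = norm (cinner x (T (hadj T x)))" by (simp add: cinner_hadj_left assms)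
    also have "\<dots> \<le> norm x * (norm (hadj T x) * K)"
      using order_trans[OF cinner_Cauchy_Schwarz mult_left_mono[OF K(2) norm_ge_zero]] .
    finally show "norm (hadj T x) \<le> norm x * K"
      using K(1) by (cases "norm (hadj T x) = 0") (auto simp: power2_eq_square mult_ac)
  qed
qed

lemma hadj_hadj: "T \<in> bounded_ops \<Longrightarrow> hadj (hadj T) = T"
  by (rule hadj_eqI) (simp add: cinner_hadj_right)

lemma hadj_comp:
  "S \<in> bounded_ops \<Longrightarrow> T \<in> bounded_ops \<Longrightarrow> hadj (S \<circ> T) = hadj T \<circ> hadj S"
  by (rule hadj_eqI) (simp add: cinner_hadj_left)

lemma hadj_minus_op:
  "S \<in> bounded_ops \<Longrightarrow> T \<in> bounded_ops \<Longrightarrow> hadj (\<lambda>x. S x - T x) = (\<lambda>x. hadj S x - hadj T x)"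
  by (rule hadj_eqI) (simp add: cinner_hadj_left cinner_diff_left cinner_diff_right)

lemma hadj_scale:
  "T \<in> bounded_ops \<Longrightarrow> hadj (\<lambda>x. c *\<^sub>C T x) = (\<lambda>x. cnj c *\<^sub>C hadj T x)"
  by (rule hadj_eqI) (simp add: cinner_hadj_left cinner_scaleC_left cinner_scaleC_right)

lemma bounded_ops_eq_closure:
  assumes "S \<in> bounded_ops" "T \<in> bounded_ops" "\<And>x. x \<in> D \<Longrightarrow> S x = T x" "y \<in> closure D"
  shows "S y = T y"
proof -
  obtain s where s: "\<And>n::nat. s n \<in> D" "s \<longlonglongrightarrow> y"
    using assms(4) unfolding closure_sequential by blast
  have "(\<lambda>n. S (s n)) \<longlonglongrightarrow> S y" by (rule bounded_ops_tendsto[OF assms(1) s(2)])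
  moreover have "(\<lambda>n. S (s n)) = (\<lambda>n. T (s n))" using assms(3) s(1) by blast
  moreover have "(\<lambda>n. T (s n)) \<longlonglongrightarrow> T y" by (rule bounded_ops_tendsto[OF assms(2) s(2)])
  ultimately show ?thesis by (metis LIMSEQ_unique)
qed

lemma bounded_ops_eq_dense:
  assumes "S \<in> bounded_ops" "T \<in> bounded_ops" "\<And>x. x \<in> D \<Longrightarrow> S x = T x" "closure D = UNIV"
  shows "S = T"
  using bounded_ops_eq_closure[OF assms(1-3)] assms(4) by auto

subsection \<open>Orthogonal projections\<close>

lemma orthogonal_projection_exists:
  fixes S :: "'h::complex_hilbert set"
  assumes S: "complex_subspace S" "closed S"
  obtains P where "projection P" "range P = S" "\<And>s. s \<in> S \<Longrightarrow> P s = s"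
    "\<And>x s. s \<in> S \<Longrightarrow> cinner (x - P x) s = 0"
proof -
  have Sadd: "\<And>u v. u \<in> S \<Longrightarrow> v \<in> S \<Longrightarrow> u + v \<in> S"
    and Ssc: "\<And>c u. u \<in> S \<Longrightarrow> c *\<^sub>C u \<in> S"
    using S(1) by (auto simp: complex_subspace_def)
  have Sdiff: "u - v \<in> S" if "u \<in> S" "v \<in> S" for u v
    using Sadd[OF that(1) Ssc[OF that(2), of "-1"]] by (simp add: scaleC_minus_one)
  obtain P where PS: "\<And>x. P x \<in> S" and P: "\<And>x s. s \<in> S \<Longrightarrow> cinner (x - P x) s = 0"
    using orthogonal_decomposition[OF S] by metis
  \<comment> \<open>P is obtained by choice; uniqueness of the orthogonal decomposition is what
    makes it additive and homogeneous.\<close>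
  have uniq: "P x = p" if "p \<in> S" "\<And>s. s \<in> S \<Longrightarrow> cinner (x - p) s = 0" for x p
  proof -
    have "cinner ((x - p) - (x - P x)) (P x - p) = 0"
      unfolding cinner_diff_left[of "x - p"] using that P PS Sdiff by simp
    thus ?thesis by (simp add: cinner_self)
  qed
  have Pid: "P s = s" if "s \<in> S" for s using that by (intro uniq) auto
  have Psa: "cinner (P x) y = cinner x (P y)" for x y
  proof -
    have "cinner (x - P x) (P y) = 0" "cinner (y - P y) (P x) = 0" using P PS by auto
    thus ?thesis by (simp add: cinner_diff_left) (metis cinner_commute)
  qed
  have bo: "P \<in> bounded_ops"
  proof (rule bounded_opsI[of _ 1])
    show "P (x + y) = P x + P y" for x y
    proof (rule uniq)
      fix s assume "s \<in> S"
      thus "cinner (x + y - (P x + P y)) s = 0"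
        using P[of s x] P[of s y] by (simp add: cinner_diff_left cinner_add_left)
    qed (use Sadd PS in auto)
    show "P (c *\<^sub>C x) = c *\<^sub>C P x" for c x
    proof (rule uniq)
      fix s assume "s \<in> S"
      thus "cinner (c *\<^sub>C x - (c *\<^sub>C P x)) s = 0"
        using P[of s x] by (simp add: cinner_diff_left cinner_scaleC_left right_diff_distrib[symmetric])
    qed (use Ssc PS in auto)
    fix x
    have "complex_of_real ((norm (P x))\<^sup>2) = cinner x (P x)"
      unfolding cinner_self[symmetric] using Psa[of x "P x"] Pid[OF PS] by simp
    hence "(norm (P x))\<^sup>2 = norm (cinner x (P x))"
      by (metis norm_of_real abs_of_nonneg zero_le_power2)
    also have "\<dots> \<le> norm x * norm (P x)" by (rule cinner_Cauchy_Schwarz)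
    finally show "norm (P x) \<le> norm x * 1"
      by (cases "norm (P x) = 0") (auto simp: power2_eq_square)
  qed
  have "projection P"
    unfolding projection_def using bo Pid PS hadj_eqI[of P P] Psa by (auto simp: fun_eq_iff)
  moreover have "range P = S" using PS Pid by (metis image_subset_iff subsetI subset_antisym UNIV_I rangeI)
  ultimately show ?thesis using that Pid P by blast
qed

text \<open>Invariance under T gives T P = P T P, and invariance under \<open>hadj T\<close> gives P
  T = P T P by taking adjoints.\<close>

lemma projection_commutes:
  assumes P: "projection P" "\<And>s. s \<in> S \<Longrightarrow> P s = s" "range P = S"
    and T: "T \<in> bounded_ops" "\<And>s. s \<in> S \<Longrightarrow> T s \<in> S" "\<And>s. s \<in> S \<Longrightarrow> hadj T s \<in> S"
  shows "T \<circ> P = P \<circ> T"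
proof
  fix x
  have Pb: "P \<in> bounded_ops" and Ph: "hadj P = P" using P(1) by (auto simp: projection_def)
  have PS: "P y \<in> S" for y using P(3) by blast
  have "P (T (P x)) = T (P x)" by (rule P(2)[OF T(2)[OF PS]])
  moreover have "P (T (P x)) = P (T x)"
  proof (rule cinner_ext_left)
    fix y
    have Pc: "cinner (P u) v = cinner u (P v)" for u v using cinner_hadj_left[OF Pb, of u v] Ph by simp
    have "cinner (P (T (P x))) y = cinner x (P (hadj T (P y)))"
      by (simp add: Pc cinner_hadj_right[OF T(1), symmetric])
    also have "\<dots> = cinner x (hadj T (P y))" using P(2)[OF T(3)[OF PS]] by simp
    also have "\<dots> = cinner (P (T x)) y" by (simp add: Pc cinner_hadj_right T(1))
    finally show "cinner (P (T (P x))) y = cinner (P (T x)) y" .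
  qed
  ultimately show "(T \<circ> P) x = (P \<circ> T) x" by simp
qed

subsection \<open>Commutants\<close>

lemma commutant_subset: "commutant X \<subseteq> bounded_ops"
  by (auto simp: commutant_def)

lemma commutantD: "T \<in> commutant X \<Longrightarrow> x \<in> X \<Longrightarrow> T (x \<xi>) = x (T \<xi>)"
  by (auto simp: commutant_def fun_eq_iff)

lemma commutantI: "T \<in> bounded_ops \<Longrightarrow> (\<And>x \<xi>. x \<in> X \<Longrightarrow> T (x \<xi>) = x (T \<xi>)) \<Longrightarrow> T \<in> commutant X"
  by (auto simp: commutant_def fun_eq_iff)

lemma commutant_antimono: "X \<subseteq> Y \<Longrightarrow> commutant Y \<subseteq> commutant X"
  by (auto simp: commutant_def)

lemma bicommutant_increasing: "X \<subseteq> bounded_ops \<Longrightarrow> X \<subseteq> commutant (commutant X)"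
  by (auto simp: commutant_def)

lemma triple_commutant: "X \<subseteq> bounded_ops \<Longrightarrow> commutant (commutant (commutant X)) = commutant X"
  by (meson bicommutant_increasing commutant_antimono commutant_subset subset_antisym)

lemma commutant_id: "id \<in> commutant X"
  by (auto simp: commutant_def bounded_ops_id)

lemma commutant_comp: "S \<in> commutant X \<Longrightarrow> T \<in> commutant X \<Longrightarrow> S \<circ> T \<in> commutant X"
  by (auto simp: commutant_def bounded_ops_comp fun_eq_iff)

lemma commutant_plus:
  assumes "X \<subseteq> bounded_ops" "S \<in> commutant X" "T \<in> commutant X"
  shows "(\<lambda>x. S x + T x) \<in> commutant X"
proof (rule commutantI)
  show "(\<lambda>x. S x + T x) \<in> bounded_ops" using assms commutant_subset bounded_ops_plus by blast
  show "S (x \<xi>) + T (x \<xi>) = x (S \<xi> + T \<xi>)" if "x \<in> X" for x \<xi>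
    using that assms(1) by (simp add: commutantD[OF assms(2)] commutantD[OF assms(3)] bounded_ops_add subset_iff)
qed

lemma commutant_scale:
  assumes "X \<subseteq> bounded_ops" "T \<in> commutant X"
  shows "(\<lambda>x. c *\<^sub>C T x) \<in> commutant X"
proof (rule commutantI)
  show "(\<lambda>x. c *\<^sub>C T x) \<in> bounded_ops" using assms commutant_subset bounded_ops_scale by blast
  show "c *\<^sub>C T (x \<xi>) = x (c *\<^sub>C T \<xi>)" if "x \<in> X" for x \<xi>
    using that assms(1) by (simp add: commutantD[OF assms(2)] bounded_ops_scaleC subset_iff)
qed

lemma commutant_hadj:
  assumes "X \<subseteq> bounded_ops" "\<And>x. x \<in> X \<Longrightarrow> hadj x \<in> X" "T \<in> commutant X"
  shows "hadj T \<in> commutant X"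
proof (rule commutantI)
  have T: "T \<in> bounded_ops" using assms commutant_subset by blast
  thus "hadj T \<in> bounded_ops" by (rule hadj_bounded_ops)
  fix x \<xi> assume x: "x \<in> X"
  hence xb: "x \<in> bounded_ops" using assms by blast
  show "hadj T (x \<xi>) = x (hadj T \<xi>)"
  proof (rule cinner_ext_left)
    fix z
    have "cinner (hadj T (x \<xi>)) z = cinner \<xi> (hadj x (T z))"
      by (simp add: cinner_hadj_left[OF T] cinner_hadj_right[OF xb])
    also have "\<dots> = cinner \<xi> (T (hadj x z))" using commutantD[OF assms(3) assms(2)[OF x]] by simp
    also have "\<dots> = cinner (x (hadj T \<xi>)) z"
      by (simp add: cinner_hadj_left[OF T, symmetric] cinner_hadj_right[OF xb])
    finally show "cinner (hadj T (x \<xi>)) z = cinner (x (hadj T \<xi>)) z" .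
  qed
qed

text \<open>If \<open>\<parallel>B\<parallel> \<le> 1\<close>, the iteration \<open>Y\<^sub>n\<^sub>+\<^sub>1 = (B + Y\<^sub>n\<^sup>2) / 2\<close> converges in norm to
  \<open>1 - (1 - B)\<^bsup>1/2\<^esup>\<close>, since its increments are dominated by those of the same iteration with \<open>B = 1\<close>
  in the real numbers. It is applied to \<open>B = 1 - y\<^sup>2 / K\<^sup>2\<close>.\<close>

lemma absolute_value_exists:
  assumes y: "y \<in> bounded_ops" "hadj y = y"
  obtains h where "h \<in> bounded_ops" "h \<circ> h = y \<circ> y"
    "\<And>T. T \<in> bounded_ops \<Longrightarrow> T \<circ> y = y \<circ> T \<Longrightarrow> T \<circ> h = h \<circ> T"
    "\<And>\<xi>. Re (cinner (h \<xi>) \<xi>) \<ge> 0"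
proof -
  obtain K where K: "K > 0" "\<And>x. norm (y x) \<le> norm x * K" using bounded_ops_bound[OF y(1)] by blast
  define B where "B \<xi> = \<xi> - (1 / K\<^sup>2) *\<^sub>R y (y \<xi>)" for \<xi>
  have ysa: "cinner (y u) v = cinner u (y v)" for u v using cinner_hadj_left[OF y(1)] y(2) by metis
  have Bb: "B \<in> bounded_ops"
    unfolding B_def[abs_def] scaleC_of_real[symmetric]
    using bounded_ops_minus_op[OF bounded_ops_id(2) bounded_ops_scale[OF bounded_ops_comp[OF y(1) y(1)]]]
    by (simp add: comp_def)
  \<comment> \<open>With k = 1 / K^2 the squared norm of B\<xi> is |\<xi>|^2 - 2k |y\<xi>|^2 + k^2
    |y y\<xi>|^2, and the last term is at most k |y\<xi>|^2 because K bounds y.\<close>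
  have B1: "norm (B \<xi>) \<le> norm \<xi>" for \<xi>
  proof -
    let ?z = "y (y \<xi>)"
    define k where "k = 1 / K\<^sup>2"
    have i: "inner \<xi> ?z = (norm (y \<xi>))\<^sup>2"
      by (simp only: Re_cinner[symmetric] ysa[symmetric] power2_norm_eq_inner)
    have Bn: "(norm (B \<xi>))\<^sup>2 = (norm \<xi>)\<^sup>2 - 2 * (k * inner \<xi> ?z) + k\<^sup>2 * (norm ?z)\<^sup>2"
      unfolding B_def k_def[symmetric] power2_norm_eq_inner
      by (simp add: inner_diff_left inner_diff_right inner_commute power2_eq_square algebra_simps)
    have "(norm ?z)\<^sup>2 \<le> (norm (y \<xi>) * K)\<^sup>2" by (intro power_mono K) simp
    hence "k\<^sup>2 * (norm ?z)\<^sup>2 \<le> k\<^sup>2 * (norm (y \<xi>) * K)\<^sup>2" by (rule mult_left_mono) simp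
    hence "k\<^sup>2 * (norm ?z)\<^sup>2 \<le> k * (norm (y \<xi>))\<^sup>2"
      using K(1) by (simp add: k_def power_mult_distrib power2_eq_square)
    moreover have "k * (norm (y \<xi>))\<^sup>2 \<ge> 0" by (simp add: k_def)
    ultimately have "(norm (B \<xi>))\<^sup>2 \<le> (norm \<xi>)\<^sup>2" using Bn unfolding i by linarith
    thus ?thesis by (rule power2_le_imp_le) simp
  qed
  have Bsa: "cinner (B u) v = cinner u (B v)" for u v
    by (simp add: B_def cinner_diff_left cinner_diff_right cinner_scaleR_left cinner_scaleR_right ysa)
  define Y where "Y = rec_nat (\<lambda>\<xi>. 0) (\<lambda>n T \<xi>. (1/2) *\<^sub>R (B \<xi> + T (T \<xi>)))"
  have Y0: "Y 0 \<xi> = 0" and YS: "Y (Suc n) \<xi> = (1/2) *\<^sub>R (B \<xi> + Y n (Y n \<xi>))" for n \<xi>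
    by (simp_all add: Y_def)
  define s :: "nat \<Rightarrow> real" where "s = rec_nat 0 (\<lambda>n t. (1 + t\<^sup>2) / 2)"
  have s0: "s 0 = 0" and sS: "s (Suc n) = (1 + (s n)\<^sup>2) / 2" for n by (simp_all add: s_def)
  have s01: "0 \<le> s n \<and> s n \<le> 1" for n
    by (induction n) (auto simp: s0 sS power_le_one)
  have sinc: "s n \<le> s (Suc n)" for n
    unfolding sS using zero_le_power2[of "s n - 1"] by (simp add: power2_eq_square algebra_simps)
  have Yb: "Y n \<in> bounded_ops" for n
  proof (induction n)
    case 0 thus ?case using bounded_ops_const_0 by (simp add: Y0[abs_def])
  next
    case (Suc n)
    have "(\<lambda>\<xi>. complex_of_real (1/2) *\<^sub>C (B \<xi> + (Y n \<circ> Y n) \<xi>)) \<in> bounded_ops"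
      by (intro bounded_ops_scale bounded_ops_plus Bb bounded_ops_comp Suc)
    thus ?case unfolding scaleC_of_real by (simp add: YS[abs_def] comp_def)
  qed
  have Yn: "norm (Y n \<xi>) \<le> s n * norm \<xi>" for n \<xi>
  proof (induction n arbitrary: \<xi>)
    case (Suc n)
    have "norm (Y n (Y n \<xi>)) \<le> s n * (s n * norm \<xi>)"
      using order_trans[OF Suc mult_left_mono[OF Suc]] s01 by blast
    hence "norm (B \<xi> + Y n (Y n \<xi>)) \<le> norm \<xi> + s n * (s n * norm \<xi>)"
      using B1[of \<xi>] norm_triangle_ineq[of "B \<xi>" "Y n (Y n \<xi>)"] by linarith
    moreover have "norm (Y (Suc n) \<xi>) = norm (B \<xi> + Y n (Y n \<xi>)) / 2" by (simp add: YS)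
    ultimately show ?case by (simp add: sS power2_eq_square algebra_simps)
  qed (simp add: Y0 s0)
  have Ystep: "norm (Y (Suc n) \<xi> - Y n \<xi>) \<le> (s (Suc n) - s n) * norm \<xi>" for n \<xi>
  proof (induction n arbitrary: \<xi>)
    case 0 show ?case using B1[of \<xi>] by (simp add: YS Y0 sS s0)
  next
    case (Suc n)
    let ?a = "s (Suc n)" and ?b = "s n"
    \<comment> \<open>The difference of the squares of two iterates is split as (Y' - Y) Y' + Y (Y'
      - Y), which is valid for operators that are not known to commute.\<close>
    have "Y (Suc (Suc n)) \<xi> - Y (Suc n) \<xi> =
      (1/2) *\<^sub>R ((Y (Suc n) (Y (Suc n) \<xi>) - Y n (Y (Suc n) \<xi>)) + Y n (Y (Suc n) \<xi> - Y n \<xi>))"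
      using arg_cong2[OF YS[of "Suc n" \<xi>] YS[of n \<xi>], of "(-)"]
      by (simp only: bounded_ops_diff[OF Yb] scaleR_right_diff_distrib[symmetric]) simp
    moreover have "norm (Y (Suc n) (Y (Suc n) \<xi>) - Y n (Y (Suc n) \<xi>)) \<le> (?a - ?b) * (?a * norm \<xi>)"
      using order_trans[OF Suc mult_left_mono[OF Yn]] sinc[of n] by simp
    moreover have "norm (Y n (Y (Suc n) \<xi> - Y n \<xi>)) \<le> ?b * ((?a - ?b) * norm \<xi>)"
      using order_trans[OF Yn mult_left_mono[OF Suc]] s01 by simp
    ultimately have "norm (Y (Suc (Suc n)) \<xi> - Y (Suc n) \<xi>) \<le>
        (1/2) * ((?a - ?b) * (?a * norm \<xi>) + ?b * ((?a - ?b) * norm \<xi>))"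
      using norm_triangle_ineq[of "Y (Suc n) (Y (Suc n) \<xi>) - Y n (Y (Suc n) \<xi>)" "Y n (Y (Suc n) \<xi> - Y n \<xi>)"]
      by simp
    also have "\<dots> = (?a\<^sup>2 - ?b\<^sup>2) / 2 * norm \<xi>" by (simp add: power2_eq_square algebra_simps)
    also have "(?a\<^sup>2 - ?b\<^sup>2) / 2 = s (Suc (Suc n)) - ?a"
      by (subst sS[of "Suc n"], subst (3) sS[of n]) (simp add: field_simps)
    finally show ?case .
  qed
  have Ydiff: "norm (Y (n + m) \<xi> - Y n \<xi>) \<le> (s (n + m) - s n) * norm \<xi>" for n m \<xi>
  proof (induction m)
    case (Suc m)
    have "norm (Y (n + Suc m) \<xi> - Y n \<xi>) \<le> norm (Y (Suc (n + m)) \<xi> - Y (n + m) \<xi>) + norm (Y (n + m) \<xi> - Y n \<xi>)"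
      using norm_triangle_ineq[of "Y (Suc (n + m)) \<xi> - Y (n + m) \<xi>" "Y (n + m) \<xi> - Y n \<xi>"] by simp
    also have "\<dots> \<le> (s (Suc (n + m)) - s (n + m)) * norm \<xi> + (s (n + m) - s n) * norm \<xi>"
      by (intro add_mono Ystep Suc)
    finally show ?case by (simp add: algebra_simps)
  qed simp
  have "incseq s" by (rule incseq_SucI) (rule sinc)
  hence "convergent s" using s01 by (intro Bseq_mono_convergent) (auto intro!: BseqI'[of _ 1] incseqD)
  hence sC: "Cauchy s" by (rule convergent_Cauchy)
  have "Cauchy (\<lambda>n. Y n \<xi>)" for \<xi>
  proof (rule CauchyI')
    fix e :: real assume e: "e > 0"
    define e' where "e' = e / (norm \<xi> + 1)"
    have p: "norm \<xi> + 1 > 0" using norm_ge_zero[of \<xi>] by linarith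
    hence "e' > 0" using e by (simp add: e'_def)
    then obtain N where N: "\<And>m n. m \<ge> N \<Longrightarrow> n \<ge> N \<Longrightarrow> norm (s m - s n) < e'"
      using CauchyD[OF sC] by blast
    have "dist (Y m \<xi>) (Y n \<xi>) < e" if "m \<ge> N" "n > m" for m n
    proof -
      have "dist (Y m \<xi>) (Y n \<xi>) \<le> (s n - s m) * norm \<xi>"
        using Ydiff[of m "n - m" \<xi>] that by (simp add: dist_norm norm_minus_commute)
      also have "\<dots> \<le> (s n - s m) * (norm \<xi> + 1)"
        using incseqD[OF \<open>incseq s\<close>, of m n] that by (intro mult_left_mono) auto
      also have "\<dots> < e' * (norm \<xi> + 1)" using N[of n m] that p by (intro mult_strict_right_mono) auto
      also have "\<dots> = e" using p by (simp add: e'_def)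
      finally show ?thesis .
    qed
    thus "\<exists>N. \<forall>m\<ge>N. \<forall>n>m. dist (Y m \<xi>) (Y n \<xi>) < e" by blast
  qed
  hence "\<exists>z. (\<lambda>n. Y n \<xi>) \<longlonglongrightarrow> z" for \<xi> using Cauchy_convergent convergent_def by blast
  then obtain Z where Z: "\<And>\<xi>. (\<lambda>n. Y n \<xi>) \<longlonglongrightarrow> Z \<xi>" by metis
  have Y1: "norm (Y n \<xi>) \<le> norm \<xi>" for n \<xi>
    using Yn[of n \<xi>] mult_right_mono[of "s n" 1 "norm \<xi>"] s01[of n] by simp
  have Z1: "norm (Z \<xi>) \<le> norm \<xi>" for \<xi>
    by (rule Lim_bounded[OF tendsto_norm[OF Z], of 0]) (simp add: Y1)
  have Zb: "Z \<in> bounded_ops"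
  proof (rule bounded_opsI[of _ 1])
    show "Z (u + v) = Z u + Z v" for u v
      by (rule LIMSEQ_unique[OF Z]) (simp add: bounded_ops_add[OF Yb] tendsto_add[OF Z Z])
    show "Z (c *\<^sub>C u) = c *\<^sub>C Z u" for c u
      by (rule LIMSEQ_unique[OF Z]) (simp add: bounded_ops_scaleC[OF Yb] tendsto_scaleC[OF Z])
  qed (simp add: Z1)
  have ZZ: "Z \<xi> = (1/2) *\<^sub>R (B \<xi> + Z (Z \<xi>))" for \<xi>
  proof (rule LIMSEQ_unique)
    show "(\<lambda>n. Y (Suc n) \<xi>) \<longlonglongrightarrow> Z \<xi>" using Z by (rule LIMSEQ_Suc)
    \<comment> \<open>The iterates have norm at most 1 uniformly, so the two occurrences of Y n can
      be replaced by the limit one after the other.\<close>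
    have "(\<lambda>n. Y n (Y n \<xi> - Z \<xi>)) \<longlonglongrightarrow> 0"
    proof (rule Lim_null_comparison[of _ "\<lambda>n. norm (Y n \<xi> - Z \<xi>)"])
      show "(\<lambda>n. norm (Y n \<xi> - Z \<xi>)) \<longlonglongrightarrow> 0"
        using tendsto_norm[OF tendsto_diff[OF Z[of \<xi>] tendsto_const[of "Z \<xi>"]]] by simp
    qed (simp add: Y1)
    hence "(\<lambda>n. Y n (Y n \<xi> - Z \<xi>) + Y n (Z \<xi>)) \<longlonglongrightarrow> 0 + Z (Z \<xi>)" using Z by (rule tendsto_add)
    hence "(\<lambda>n. Y n (Y n \<xi>)) \<longlonglongrightarrow> Z (Z \<xi>)" by (simp add: bounded_ops_diff[OF Yb])
    thus "(\<lambda>n. Y (Suc n) \<xi>) \<longlonglongrightarrow> (1/2) *\<^sub>R (B \<xi> + Z (Z \<xi>))"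
      unfolding YS by (intro tendsto_scaleR tendsto_add tendsto_const)
  qed
  have Zcomm: "T (Z \<xi>) = Z (T \<xi>)" if T: "T \<in> bounded_ops" "T \<circ> y = y \<circ> T" for T \<xi>
  proof -
    have Ty: "T (y u) = y (T u)" for u using T(2) by (simp add: fun_eq_iff)
    have TB: "T (B u) = B (T u)" for u
      by (simp add: B_def bounded_ops_diff[OF T(1)] bounded_ops_scaleR[OF T(1)] Ty)
    have TY: "T (Y n u) = Y n (T u)" for n u
    proof (induction n arbitrary: u)
      case 0 show ?case by (simp add: Y0 bounded_ops_zero[OF T(1)])
    next
      case (Suc n) thus ?case
        by (simp add: YS bounded_ops_add[OF T(1)] bounded_ops_scaleR[OF T(1)] TB)
    qed
    show ?thesis
      using bounded_ops_tendsto[OF T(1) Z[of \<xi>]] Z[of "T \<xi>"] unfolding TY by (metis LIMSEQ_unique)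
  qed
  \<comment> \<open>From 2Z = B + Z^2 one gets (1 - Z)^2 = 1 - B = y^2 / K^2. Positivity of h comes
    from the norm of Z being at most 1.\<close>
  define h where "h \<xi> = complex_of_real K *\<^sub>C (\<xi> - Z \<xi>)" for \<xi>
  have hb: "h \<in> bounded_ops"
    unfolding h_def[abs_def] by (intro bounded_ops_scale bounded_ops_minus_op bounded_ops_id Zb)
  have "h (h \<xi>) = y (y \<xi>)" for \<xi>
  proof -
    have "2 *\<^sub>R Z \<xi> = B \<xi> + Z (Z \<xi>)" by (subst ZZ) simp
    hence e: "\<xi> - 2 *\<^sub>R Z \<xi> + Z (Z \<xi>) = (1 / K\<^sup>2) *\<^sub>R y (y \<xi>)" by (simp add: B_def)
    have "h (h \<xi>) = K\<^sup>2 *\<^sub>R (\<xi> - 2 *\<^sub>R Z \<xi> + Z (Z \<xi>))"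
      unfolding h_def scaleC_of_real
      by (simp add: bounded_ops_diff[OF Zb] bounded_ops_scaleR[OF Zb] algebra_simps scaleR_2 power2_eq_square)
    thus ?thesis unfolding e using K(1) by simp
  qed
  hence hh: "h \<circ> h = y \<circ> y" by auto
  have hc: "T \<circ> h = h \<circ> T" if T: "T \<in> bounded_ops" "T \<circ> y = y \<circ> T" for T
    by (rule ext) (simp add: h_def bounded_ops_scaleC[OF T(1)] bounded_ops_diff[OF T(1)] Zcomm[OF T])
  have hp: "Re (cinner (h \<xi>) \<xi>) \<ge> 0" for \<xi>
  proof -
    have "inner (Z \<xi>) \<xi> \<le> norm (Z \<xi>) * norm \<xi>" by (rule norm_cauchy_schwarz)
    also have "\<dots> \<le> norm \<xi> * norm \<xi>" by (intro mult_right_mono Z1) simp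
    finally have "inner (Z \<xi>) \<xi> \<le> inner \<xi> \<xi>" by (simp add: power2_norm_eq_inner[symmetric] power2_eq_square)
    thus ?thesis using K(1) by (simp add: Re_cinner h_def scaleC_of_real inner_diff_left)
  qed
  show ?thesis using that[OF hb hh hc hp] by blast
qed

text \<open>With \<open>h = |y|\<close> one has \<open>(h - y) (h + y) = 0\<close>, and minimality of \<open>p\<close> makes one of the factors
  vanish on the range of \<open>p\<close>.\<close>

lemma minimal_projection_sign:
  assumes X: "X \<subseteq> bounded_ops" "\<And>x. x \<in> X \<Longrightarrow> hadj x \<in> X"
    and p: "minimal_projection (commutant X) p"
    and y: "y \<in> commutant X" "hadj y = y" "p \<circ> y = y" "y \<circ> p = y"
  shows "(\<forall>\<xi>. Re (cinner (y \<xi>) \<xi>) \<ge> 0) \<or> (\<forall>\<xi>. Re (cinner (y \<xi>) \<xi>) \<le> 0)"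
proof -
  have yb: "y \<in> bounded_ops" using y(1) commutant_subset by blast
  have pc: "p \<in> commutant X" and pp: "projection p" using p by (auto simp: minimal_projection_def)
  have pb: "p \<in> bounded_ops" and p2: "\<And>x. p (p x) = p x" and psa: "hadj p = p"
    using pp by (auto simp: projection_def fun_eq_iff)
  have pcin: "cinner (p u) v = cinner u (p v)" for u v using cinner_hadj_left[OF pb, of u v] psa by simp
  have py: "p (y u) = y u" and yp: "y (p u) = y u" for u using y(3,4) by (auto simp: fun_eq_iff)
  obtain h where h: "h \<in> bounded_ops" "h \<circ> h = y \<circ> y"
    "\<And>T. T \<in> bounded_ops \<Longrightarrow> T \<circ> y = y \<circ> T \<Longrightarrow> T \<circ> h = h \<circ> T"
    "\<And>\<xi>. Re (cinner (h \<xi>) \<xi>) \<ge> 0"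
    using absolute_value_exists[OF yb y(2)] by blast
  have hp: "p (h u) = h (p u)" for u using h(3)[OF pb] y(3,4) by (auto simp: fun_eq_iff)
  have hy: "y (h u) = h (y u)" for u using h(3)[OF yb] by (auto simp: fun_eq_iff)
  have hh: "h (h u) = y (y u)" for u using h(2) by (auto simp: fun_eq_iff)
  \<comment> \<open>The part of the range of p on which h and y agree. It is invariant under X, so
    its projection q lies in the commutant of X and is dominated by p.\<close>
  define L where "L = {u. p u = u \<and> h u = y u}"
  have "complex_subspace L"
    by (auto simp: L_def complex_subspace_def bounded_opsD[OF pb] bounded_opsD[OF h(1)] bounded_opsD[OF yb])
  moreover have "closed L"
  proof -
    have "continuous_on UNIV p" "continuous_on UNIV h" "continuous_on UNIV y"
      using bounded_linear.continuous_on[OF bounded_ops_bounded_linear continuous_on_id] pb h(1) yb by blast+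
    thus ?thesis unfolding L_def by (intro closed_Collect_conj closed_Collect_eq continuous_on_id)
  qed
  ultimately obtain q where q: "projection q" "range q = L" "\<And>s. s \<in> L \<Longrightarrow> q s = s"
    by (rule orthogonal_projection_exists) blast
  have qb: "q \<in> bounded_ops" using q(1) by (simp add: projection_def)
  have inv: "x s \<in> L" if "x \<in> X" "s \<in> L" for x s
  proof -
    have xb: "x \<in> bounded_ops" using X that by blast
    have "h (x s) = x (h s)"
      using h(3)[OF xb] commutantD[OF y(1) that(1)] by (auto simp: fun_eq_iff)
    thus ?thesis using that commutantD[OF y(1) that(1)] commutantD[OF pc that(1)] by (auto simp: L_def)
  qed
  have "q \<in> commutant X"
  proof (rule commutantI[OF qb])
    fix x \<xi> assume x: "x \<in> X"
    have "x \<circ> q = q \<circ> x"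
      by (rule projection_commutes[OF q(1) q(3) q(2)]) (use inv X x in auto)
    thus "q (x \<xi>) = x (q \<xi>)" by (metis comp_apply)
  qed
  moreover have qL: "q u \<in> L" for u using q(2) by blast
  hence "p \<circ> q = q" by (auto simp: L_def)
  ultimately consider "q = (\<lambda>\<xi>. 0)" | "q = p"
    using p q(1) unfolding minimal_projection_def by blast
  thus ?thesis
  proof cases
    case 1
    have "y \<xi> = - h (p \<xi>)" for \<xi>
    proof -
      \<comment> \<open>Because h^2 = y^2 and everything commutes, h and y act alike on the vectors
        h p \<xi> + y \<xi>. As q = 0 means L = 0, these vectors vanish.\<close>
      have "h (p \<xi>) + y \<xi> \<in> L"
        unfolding L_def by (simp add: bounded_ops_add[OF pb] bounded_ops_add[OF h(1)] bounded_ops_add[OF yb]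
            py hp p2 hh hy yp add.commute)
      hence "q (h (p \<xi>) + y \<xi>) = h (p \<xi>) + y \<xi>" by (rule q(3))
      thus ?thesis using 1 by (simp add: eq_neg_iff_add_eq_0 add.commute)
    qed
    hence "cinner (y \<xi>) \<xi> = - cinner (h (p \<xi>)) (p \<xi>)" for \<xi>
      by (metis cinner_minus_left hp p2 pcin)
    thus ?thesis using h(4) by simp
  next
    case 2
    have "y \<xi> = h (p \<xi>)" for \<xi> using qL[of \<xi>] 2 by (simp add: L_def yp)
    hence "cinner (y \<xi>) \<xi> = cinner (h (p \<xi>)) (p \<xi>)" for \<xi>
      by (metis hp p2 pcin)
    thus ?thesis using h(4) by simp
  qed
qed

text \<open>On \<xi> + t y\<xi> the form takes the value t (2a + t b) with a = |y\<xi>|^2. If a > 0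
  this changes sign at t = 0, against semidefiniteness; the t chosen below is small enough for |t b|
  < a.\<close>

lemma semidefinite_kernel:
  assumes y: "y \<in> bounded_ops" "hadj y = y"
    and sgn: "(\<forall>\<xi>. Re (cinner (y \<xi>) \<xi>) \<ge> 0) \<or> (\<forall>\<xi>. Re (cinner (y \<xi>) \<xi>) \<le> 0)"
    and z: "cinner (y \<xi>) \<xi> = 0"
  shows "y \<xi> = 0"
proof (rule ccontr)
  assume nz: "y \<xi> \<noteq> 0"
  have ysa: "cinner (y u) v = cinner u (y v)" for u v using cinner_hadj_left[OF y(1)] y(2) by metis
  define b where "b = inner (y (y \<xi>)) (y \<xi>)"
  define a where "a = (norm (y \<xi>))\<^sup>2"
  have a: "a > 0" using nz by (simp add: a_def)
  have i1: "inner (y (y \<xi>)) \<xi> = a" "inner (y \<xi>) \<xi> = 0"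
    unfolding Re_cinner[symmetric] using z ysa[of "y \<xi>" \<xi>] by (simp_all add: a_def cinner_self)
  have q: "Re (cinner (y (\<xi> + t *\<^sub>R y \<xi>)) (\<xi> + t *\<^sub>R y \<xi>)) = t * (2 * a + t * b)" for t
    unfolding Re_cinner
    by (simp add: bounded_ops_add[OF y(1)] bounded_ops_scaleR[OF y(1)] inner_add_left inner_add_right
        i1 b_def a_def power2_norm_eq_inner algebra_simps)
  define t where "t = a / (\<bar>b\<bar> + 1)"
  have t: "t > 0" "t * \<bar>b\<bar> < a"
    using a by (auto simp: t_def field_simps)
  have "\<bar>t * b\<bar> < a" using t by (simp add: abs_mult)
  hence "2 * a + t * b > 0" "2 * a + (-t) * b > 0" using a by (simp_all add: abs_less_iff)
  hence "t * (2 * a + t * b) > 0" "(-t) * (2 * a + (-t) * b) < 0"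
    using t(1) by (simp_all add: mult_pos_neg mult_less_0_iff)
  thus False using sgn q by (metis not_less)
qed


section \<open>Tracial algebras\<close>

text \<open>Cyclicity of \<Omega> is kept out of this locale, so that the range of the endomorphism,
  acting on the whole of L2(R), is an instance too.\<close>

locale tracial =
  fixes M :: "('h::complex_hilbert \<Rightarrow> 'h) set" and \<Omega> :: 'h
  assumes M_bounded: "M \<subseteq> bounded_ops"
    and M_id: "id \<in> M"
    and M_add: "x \<in> M \<Longrightarrow> y \<in> M \<Longrightarrow> (\<lambda>\<xi>. x \<xi> + y \<xi>) \<in> M"
    and M_scale: "x \<in> M \<Longrightarrow> (\<lambda>\<xi>. c *\<^sub>C x \<xi>) \<in> M"
    and M_comp: "x \<in> M \<Longrightarrow> y \<in> M \<Longrightarrow> x \<circ> y \<in> M"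
    and M_hadj: "x \<in> M \<Longrightarrow> hadj x \<in> M"
    and trace_commute: "x \<in> M \<Longrightarrow> y \<in> M \<Longrightarrow> cinner (x (y \<Omega>)) \<Omega> = cinner (y (x \<Omega>)) \<Omega>"
begin

lemma M_bo: "x \<in> M \<Longrightarrow> x \<in> bounded_ops"
  using M_bounded by blast

lemma M_diff:
  assumes "x \<in> M" "y \<in> M"
  shows "(\<lambda>\<xi>. x \<xi> - y \<xi>) \<in> M"
  using M_add[OF assms(1) M_scale[OF assms(2), of "-1"]] by (simp add: scaleC_minus_one)

lemma M_sum: "finite I \<Longrightarrow> (\<And>i. i \<in> I \<Longrightarrow> f i \<in> M) \<Longrightarrow> (\<lambda>\<xi>. \<Sum>i\<in>I. f i \<xi>) \<in> M"
proof (induction I rule: finite_induct)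
  case empty
  show ?case using M_scale[OF M_id, of 0] by simp
next
  case (insert i I)
  thus ?case using M_add[of "f i" "\<lambda>\<xi>. \<Sum>i\<in>I. f i \<xi>"] by simp
qed

lemma norm_hadj_\<Omega>:
  assumes "x \<in> M"
  shows "norm (hadj x \<Omega>) = norm (x \<Omega>)"
proof -
  have "complex_of_real ((norm (hadj x \<Omega>))\<^sup>2) = of_real ((norm (x \<Omega>))\<^sup>2)"
    unfolding cinner_self[symmetric]
    by (metis M_bo M_hadj assms cinner_commute cinner_hadj_left cinner_hadj_right trace_commute)
  hence "(norm (hadj x \<Omega>))\<^sup>2 = (norm (x \<Omega>))\<^sup>2" using of_real_eq_iff by blast
  thus ?thesis by simp
qed

text \<open>The map x\<Omega> -> \<open>hadj x \<Omega>\<close> is isometric, so the adjoints of any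
  sequence with t_k\<Omega> -> T\<Omega> converge at \<Omega> as well. Hypothesis \<open>J\<close>
  identifies their limit with \<open>hadj T \<Omega>\<close> by testing against M\<Omega>, which
  suffices because both vectors lie in its closure.\<close>

lemma simultaneous_approximation:
  assumes T: "T \<in> bounded_ops" "T \<Omega> \<in> closure {x \<Omega> |x. x \<in> M}" "hadj T \<Omega> \<in> closure {x \<Omega> |x. x \<in> M}"
    and J: "\<And>m. m \<in> M \<Longrightarrow> cinner (hadj m \<Omega>) (T \<Omega>) = cinner (hadj T \<Omega>) (m \<Omega>)"
  obtains t :: "nat \<Rightarrow> 'h \<Rightarrow> 'h" where "\<And>k. t k \<in> M" "(\<lambda>k. t k \<Omega>) \<longlonglongrightarrow> T \<Omega>" "(\<lambda>k. hadj (t k) \<Omega>) \<longlonglongrightarrow> hadj T \<Omega>"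
proof -
  let ?C = "{x \<Omega> |x. x \<in> M}"
  obtain v where v: "\<And>k::nat. v k \<in> ?C" "v \<longlonglongrightarrow> T \<Omega>"
    using T(2) unfolding closure_sequential by blast
  then obtain t where t: "\<And>k. t k \<in> M" "\<And>k. v k = t k \<Omega>" by (simp add: Bex_def) metis
  have "v = (\<lambda>k. t k \<Omega>)" using t(2) by blast
  hence tl: "(\<lambda>k. t k \<Omega>) \<longlonglongrightarrow> T \<Omega>" using v(2) by simp
  hence tC: "Cauchy (\<lambda>k. t k \<Omega>)" by (rule LIMSEQ_imp_Cauchy)
  have "norm (hadj (t k) \<Omega> - hadj (t l) \<Omega>) = norm (t k \<Omega> - t l \<Omega>)" for k l
    using norm_hadj_\<Omega>[OF M_diff[OF t(1) t(1)], of k l] by (simp add: hadj_minus_op M_bo t(1))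
  hence "Cauchy (\<lambda>k. hadj (t k) \<Omega>)" using tC unfolding Cauchy_def dist_norm by simp
  then obtain \<zeta> where \<zeta>: "(\<lambda>k. hadj (t k) \<Omega>) \<longlonglongrightarrow> \<zeta>" using Cauchy_convergent convergent_def by blast
  have "\<zeta> \<in> closure ?C"
    unfolding closure_sequential using \<zeta> M_hadj[OF t(1)] by (intro exI[of _ "\<lambda>k. hadj (t k) \<Omega>"]) blast
  have "cinner (\<zeta> - hadj T \<Omega>) u = 0" if "u \<in> ?C" for u
  proof -
    obtain m where m: "m \<in> M" "u = m \<Omega>" using \<open>u \<in> ?C\<close> by blast
    have "cinner (hadj (t k) \<Omega>) (m \<Omega>) = cinner (hadj m \<Omega>) (t k \<Omega>)" for k
      using trace_commute[OF t(1)[of k] m(1)]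
      by (simp add: cinner_hadj_left M_bo t(1) m(1)) (metis cinner_commute)
    moreover have "(\<lambda>k. cinner (hadj (t k) \<Omega>) (m \<Omega>)) \<longlonglongrightarrow> cinner \<zeta> (m \<Omega>)"
      "(\<lambda>k. cinner (hadj m \<Omega>) (t k \<Omega>)) \<longlonglongrightarrow> cinner (hadj m \<Omega>) (T \<Omega>)"
      by (intro tendsto_intros \<zeta> tl)+
    ultimately have "cinner \<zeta> (m \<Omega>) = cinner (hadj m \<Omega>) (T \<Omega>)" using LIMSEQ_unique by simp
    thus ?thesis using J[OF m(1)] m(2) by (simp add: cinner_diff_left)
  qed
  hence "cinner (\<zeta> - hadj T \<Omega>) u = 0" if "u \<in> closure ?C" for u using that by (rule cinner_orth_dense)
  from this[OF \<open>\<zeta> \<in> closure ?C\<close>] this[OF T(3)] have "cinner (\<zeta> - hadj T \<Omega>) (\<zeta> - hadj T \<Omega>) = 0"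
    by (simp add: cinner_diff_right)
  hence "\<zeta> = hadj T \<Omega>" by (simp add: cinner_self)
  thus ?thesis using that t(1) tl \<zeta> by blast
qed

lemma commutant_conjugation:
  assumes "T \<in> commutant M" "m \<in> M"
  shows "cinner (hadj m \<Omega>) (T \<Omega>) = cinner (hadj T \<Omega>) (m \<Omega>)"
proof -
  have "T \<in> bounded_ops" using assms commutant_subset by blast
  have "cinner (hadj m \<Omega>) (T \<Omega>) = cinner \<Omega> (m (T \<Omega>))" by (simp add: cinner_hadj_left M_bo assms)
  also have "\<dots> = cinner \<Omega> (T (m \<Omega>))" by (simp add: commutantD[OF assms])
  finally show ?thesis by (simp add: cinner_hadj_left \<open>T \<in> bounded_ops\<close>)
qed

text \<open>The equality of norms known for elements of M survives the limit of a simultaneous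
  approximation. It takes the place of a trace on the commutant in the computation of the
  index.\<close>

lemma commutant_norm_hadj:
  assumes T: "T \<in> commutant M" "T \<Omega> \<in> closure {x \<Omega> |x. x \<in> M}" "hadj T \<Omega> \<in> closure {x \<Omega> |x. x \<in> M}"
  shows "norm (hadj T \<Omega>) = norm (T \<Omega>)"
proof -
  have "T \<in> bounded_ops" using T commutant_subset by blast
  then obtain t where t: "\<And>k::nat. t k \<in> M" "(\<lambda>k. t k \<Omega>) \<longlonglongrightarrow> T \<Omega>" "(\<lambda>k. hadj (t k) \<Omega>) \<longlonglongrightarrow> hadj T \<Omega>"
    using simultaneous_approximation[OF _ T(2,3) commutant_conjugation[OF T(1)]] by blast
  have "(\<lambda>k. norm (t k \<Omega>)) \<longlonglongrightarrow> norm (T \<Omega>)" "(\<lambda>k. norm (hadj (t k) \<Omega>)) \<longlonglongrightarrow> norm (hadj T \<Omega>)"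
    by (intro tendsto_norm t)+
  thus ?thesis unfolding norm_hadj_\<Omega>[OF t(1)] by (metis LIMSEQ_unique)
qed

end

locale tracial_cyclic = tracial +
  assumes cyclic: "closure {x \<Omega> |x. x \<in> M} = UNIV"
begin

section \<open>Operators determined on the dense set of algebra vectors\<close>

lemma approximating_sequence:
  obtains b :: "nat \<Rightarrow> 'a \<Rightarrow> 'a" where "\<And>k. b k \<in> M" "(\<lambda>k. b k \<Omega>) \<longlonglongrightarrow> \<xi>"
proof -
  have "\<xi> \<in> closure {x \<Omega> |x. x \<in> M}" using cyclic by simp
  then obtain v where v: "\<And>k::nat. v k \<in> {x \<Omega> |x. x \<in> M}" "v \<longlonglongrightarrow> \<xi>"
    unfolding closure_sequential by blast
  then obtain t where t: "\<And>k. t k \<in> M" "\<And>k. v k = t k \<Omega>" by (simp add: Bex_def) metis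
  have "v = (\<lambda>k. t k \<Omega>)" using t(2) by blast
  hence "(\<lambda>k. t k \<Omega>) \<longlonglongrightarrow> \<xi>" using v(2) by simp
  thus ?thesis using that t(1) by blast
qed

text \<open>The function takes operators rather than vectors; its bound makes \<open>f x\<close>
  depend on x\<Omega> alone. T\<xi> is the common limit of f along all sequences that approach
  \<xi>, so sums and multiples of such sequences give linearity.\<close>

lemma bounded_extension:
  fixes f :: "('a \<Rightarrow> 'a) \<Rightarrow> 'a"
  assumes add: "\<And>x y. x \<in> M \<Longrightarrow> y \<in> M \<Longrightarrow> f (\<lambda>\<xi>. x \<xi> + y \<xi>) = f x + f y"
    and sc: "\<And>c x. x \<in> M \<Longrightarrow> f (\<lambda>\<xi>. c *\<^sub>C x \<xi>) = c *\<^sub>C f x"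
    and bd: "\<And>x. x \<in> M \<Longrightarrow> norm (f x) \<le> norm (x \<Omega>) * K"
  shows "\<exists>T\<in>bounded_ops. \<forall>x\<in>M. T (x \<Omega>) = f x"
proof -
  have diff: "f (\<lambda>\<xi>. x \<xi> - y \<xi>) = f x - f y" if "x \<in> M" "y \<in> M" for x y
    using add[OF that(1) M_scale[OF that(2), of "-1"]] sc[OF that(2), of "-1"]
    by (simp add: scaleC_minus_one)
  have fle: "norm (f x - f y) \<le> norm (x \<Omega> - y \<Omega>) * K" if "x \<in> M" "y \<in> M" for x y
    using bd[OF M_diff[OF that]] diff[OF that] by simp
  have fnull: "(\<lambda>k. f (x k) - f (y k)) \<longlonglongrightarrow> 0"
    if "\<And>k. x k \<in> M" "\<And>k. y k \<in> M" "(\<lambda>k. x k \<Omega>) \<longlonglongrightarrow> \<xi>" "(\<lambda>k. y k \<Omega>) \<longlonglongrightarrow> \<xi>" for x y :: "nat \<Rightarrow> _" and \<xi>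
  proof (rule Lim_null_comparison[of _ "\<lambda>k. norm (x k \<Omega> - y k \<Omega>) * K"])
    show "(\<lambda>k. norm (x k \<Omega> - y k \<Omega>) * K) \<longlonglongrightarrow> 0"
      using tendsto_mult[OF tendsto_norm[OF tendsto_diff[OF that(3,4)]] tendsto_const[of K]] by simp
  qed (simp add: fle that)
  have "\<exists>z. \<forall>b. (\<forall>k. b k \<in> M) \<longrightarrow> (\<lambda>k. b k \<Omega>) \<longlonglongrightarrow> \<xi> \<longrightarrow> (\<lambda>k::nat. f (b k)) \<longlonglongrightarrow> z" for \<xi>
  proof -
    obtain a where a: "\<And>k. a k \<in> M" "(\<lambda>k. a k \<Omega>) \<longlonglongrightarrow> \<xi>" using approximating_sequence by blast
    have "Cauchy (\<lambda>k. f (a k))"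
    proof (rule CauchyI)
      fix e :: real assume e: "e > 0"
      have p: "\<bar>K\<bar> + 1 > 0" by linarith
      have "Cauchy (\<lambda>k. a k \<Omega>)" using a(2) by (rule LIMSEQ_imp_Cauchy)
      then obtain N where N: "\<And>m n. m \<ge> N \<Longrightarrow> n \<ge> N \<Longrightarrow> norm (a m \<Omega> - a n \<Omega>) < e / (\<bar>K\<bar> + 1)"
        using CauchyD e p by (metis divide_pos_pos)
      have "norm (f (a m) - f (a n)) < e" if "m \<ge> N" "n \<ge> N" for m n
      proof -
        have "norm (f (a m) - f (a n)) \<le> norm (a m \<Omega> - a n \<Omega>) * K" by (simp add: fle a)
        also have "\<dots> \<le> norm (a m \<Omega> - a n \<Omega>) * (\<bar>K\<bar> + 1)" by (intro mult_left_mono) auto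
        also have "\<dots> < e" using N[OF that] p by (simp add: pos_less_divide_eq)
        finally show ?thesis .
      qed
      thus "\<exists>N. \<forall>m\<ge>N. \<forall>n\<ge>N. norm (f (a m) - f (a n)) < e" by blast
    qed
    then obtain z where z: "(\<lambda>k. f (a k)) \<longlonglongrightarrow> z" using Cauchy_convergent convergent_def by blast
    have "(\<lambda>k. f (b k)) \<longlonglongrightarrow> z" if "\<And>k. b k \<in> M" "(\<lambda>k. b k \<Omega>) \<longlonglongrightarrow> \<xi>" for b
      using tendsto_add[OF fnull[OF that(1) a(1) that(2) a(2)] z] by simp
    thus ?thesis by blast
  qed
  then obtain T where T: "\<And>\<xi> b. (\<And>k. b k \<in> M) \<Longrightarrow> (\<lambda>k. b k \<Omega>) \<longlonglongrightarrow> \<xi> \<Longrightarrow> (\<lambda>k. f (b k)) \<longlonglongrightarrow> T \<xi>"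
    by metis
  have "T \<in> bounded_ops"
  proof (rule bounded_opsI[of _ K])
    fix u v :: 'a and c
    obtain a where a: "\<And>k. a k \<in> M" "(\<lambda>k. a k \<Omega>) \<longlonglongrightarrow> u" using approximating_sequence by blast
    obtain b where b: "\<And>k. b k \<in> M" "(\<lambda>k. b k \<Omega>) \<longlonglongrightarrow> v" using approximating_sequence by blast
    have "(\<lambda>k. f (\<lambda>\<xi>. a k \<xi> + b k \<xi>)) \<longlonglongrightarrow> T (u + v)"
      by (rule T) (auto intro: M_add a b tendsto_add)
    moreover have "(\<lambda>k. f (a k) + f (b k)) \<longlonglongrightarrow> T u + T v"
      by (intro tendsto_add T a b)
    ultimately show "T (u + v) = T u + T v" by (simp add: add a b LIMSEQ_unique)
    have "(\<lambda>k. f (\<lambda>\<xi>. c *\<^sub>C a k \<xi>)) \<longlonglongrightarrow> T (c *\<^sub>C u)"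
      by (rule T) (auto intro: M_scale a tendsto_scaleC)
    moreover have "(\<lambda>k. c *\<^sub>C f (a k)) \<longlonglongrightarrow> c *\<^sub>C T u" by (intro tendsto_scaleC T a)
    ultimately show "T (c *\<^sub>C u) = c *\<^sub>C T u" by (simp add: sc a LIMSEQ_unique)
    have "(\<lambda>k. norm (f (a k))) \<longlonglongrightarrow> norm (T u)" by (intro tendsto_norm T a)
    moreover have "(\<lambda>k. norm (a k \<Omega>) * K) \<longlonglongrightarrow> norm u * K" by (intro tendsto_intros a)
    ultimately show "norm (T u) \<le> norm u * K" by (rule LIMSEQ_le) (simp add: bd a)
  qed
  moreover have "T (x \<Omega>) = f x" if "x \<in> M" for x
    using T[of "\<lambda>k. x" "x \<Omega>"] that by (simp add: LIMSEQ_const_iff)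
  ultimately show ?thesis by blast
qed

text \<open>By the trace, x m and its adjoint have the same norm at \<Omega>, so right
  multiplication by m is bounded by any bound of \<open>hadj m\<close>.\<close>

lemma right_multiplication_exists:
  assumes m: "m \<in> M"
  shows "\<exists>T\<in>bounded_ops. \<forall>x\<in>M. T (x \<Omega>) = x (m \<Omega>)"
proof -
  obtain K where K: "\<And>x. norm (hadj m x) \<le> norm x * K"
    using bounded_ops_bound[OF hadj_bounded_ops[OF M_bo[OF m]]] by blast
  have "norm (x (m \<Omega>)) \<le> norm (x \<Omega>) * K" if x: "x \<in> M" for x
  proof -
    have "norm (x (m \<Omega>)) = norm (hadj m (hadj x \<Omega>))"
      using norm_hadj_\<Omega>[OF M_comp[OF x m]] by (simp add: hadj_comp M_bo x m)
    also have "\<dots> \<le> norm (hadj x \<Omega>) * K" by (rule K)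
    finally show ?thesis by (simp add: norm_hadj_\<Omega> x)
  qed
  thus ?thesis by (intro bounded_extension) auto
qed

section \<open>Right multiplications and their commutant\<close>

definition rmul :: "('a \<Rightarrow> 'a) \<Rightarrow> 'a \<Rightarrow> 'a" where
  "rmul m = (SOME T. T \<in> bounded_ops \<and> (\<forall>x\<in>M. T (x \<Omega>) = x (m \<Omega>)))"

lemma
  assumes "m \<in> M"
  shows rmul_bounded_ops: "rmul m \<in> bounded_ops"
    and rmul_apply: "x \<in> M \<Longrightarrow> rmul m (x \<Omega>) = x (m \<Omega>)"
  using someI_ex[of "\<lambda>T. T \<in> bounded_ops \<and> (\<forall>x\<in>M. T (x \<Omega>) = x (m \<Omega>))"]
    right_multiplication_exists[OF assms] unfolding rmul_def by blast+

lemma rmul_\<Omega>: "m \<in> M \<Longrightarrow> rmul m \<Omega> = m \<Omega>"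
  using rmul_apply[OF _ M_id] by simp

lemma eq_on_cyclic:
  assumes "S \<in> bounded_ops" "T \<in> bounded_ops" "\<And>x. x \<in> M \<Longrightarrow> S (x \<Omega>) = T (x \<Omega>)"
  shows "S = T"
  by (rule bounded_ops_eq_dense[OF assms(1,2) _ cyclic]) (use assms(3) in blast)

lemma cinner_ext_cyclic:
  assumes "\<And>x. x \<in> M \<Longrightarrow> cinner u (x \<Omega>) = cinner v (x \<Omega>)"
  shows "u = v"
proof -
  have "cinner (u - v) w = 0" for w
    by (rule cinner_orth_dense[where S = "{x \<Omega> |x. x \<in> M}"]) (use assms cyclic in \<open>auto simp: cinner_diff_left\<close>)
  from this[of "u - v"] show ?thesis by (simp add: cinner_self)
qed

lemma rmul_commutant:
  assumes "m \<in> M"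
  shows "rmul m \<in> commutant M"
proof (rule commutantI[OF rmul_bounded_ops[OF assms]])
  fix y \<xi> assume y: "y \<in> M"
  have "rmul m \<circ> y = y \<circ> rmul m"
  proof (rule eq_on_cyclic)
    fix x assume x: "x \<in> M"
    show "(rmul m \<circ> y) (x \<Omega>) = (y \<circ> rmul m) (x \<Omega>)"
      using rmul_apply[OF assms M_comp[OF y x]] rmul_apply[OF assms x] by simp
  qed (intro bounded_ops_comp rmul_bounded_ops assms M_bo y)+
  thus "rmul m (y \<xi>) = y (rmul m \<xi>)" by (metis comp_apply)
qed

lemma hadj_rmul:
  assumes m: "m \<in> M"
  shows "hadj (rmul m) = rmul (hadj m)"
proof (rule eq_on_cyclic)
  fix x assume x: "x \<in> M"
  show "hadj (rmul m) (x \<Omega>) = rmul (hadj m) (x \<Omega>)"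
  proof (rule cinner_ext_cyclic)
    fix y assume y: "y \<in> M"
    have "cinner (hadj (rmul m) (x \<Omega>)) (y \<Omega>) = cinner (x \<Omega>) (y (m \<Omega>))"
      by (simp add: cinner_hadj_left rmul_bounded_ops rmul_apply m y)
    also have "\<dots> = cinner ((hadj m \<circ> (hadj y \<circ> x)) \<Omega>) \<Omega>"
      by (simp add: cinner_hadj_left M_bo m y)
    also have "\<dots> = cinner (((hadj y \<circ> x) \<circ> hadj m) \<Omega>) \<Omega>"
      using trace_commute[OF M_hadj[OF m] M_comp[OF M_hadj[OF y] x]] by simp
    also have "\<dots> = cinner (x (hadj m \<Omega>)) (y \<Omega>)" by (simp add: cinner_hadj_left M_bo y)
    finally show "cinner (hadj (rmul m) (x \<Omega>)) (y \<Omega>) = cinner (rmul (hadj m) (x \<Omega>)) (y \<Omega>)"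
      by (simp add: rmul_apply M_hadj m x)
  qed
qed (simp_all add: hadj_bounded_ops rmul_bounded_ops M_hadj m)

text \<open>Commuting with right multiplications means T (x\<Omega>) =
  \<open>rmul x (T \<Omega>)\<close>, so the value at \<Omega> fixes T on a dense set.\<close>

lemma separating:
  assumes "S \<in> commutant (rmul ` M)" "T \<in> commutant (rmul ` M)" "S \<Omega> = T \<Omega>"
  shows "S = T"
proof (rule eq_on_cyclic)
  fix x assume x: "x \<in> M"
  have "S (rmul x \<Omega>) = rmul x (S \<Omega>)" "T (rmul x \<Omega>) = rmul x (T \<Omega>)"
    using commutantD[OF assms(1)] commutantD[OF assms(2)] x by blast+
  thus "S (x \<Omega>) = T (x \<Omega>)" using assms(3) by (simp add: rmul_\<Omega> x)
qed (use assms commutant_subset in blast)+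

text \<open>This supplies hypothesis \<open>J\<close> of \<open>simultaneous_approximation\<close>:
  at \<Omega> the element m may be replaced by \<open>rmul m\<close>, which commutes with T and has
  adjoint \<open>rmul (hadj m)\<close>.\<close>

lemma rmul_commutant_conjugation:
  assumes T: "T \<in> commutant (rmul ` M)" and m: "m \<in> M"
  shows "cinner (hadj m \<Omega>) (T \<Omega>) = cinner (hadj T \<Omega>) (m \<Omega>)"
proof -
  have Tb: "T \<in> bounded_ops" using T commutant_subset by blast
  have "cinner (hadj m \<Omega>) (T \<Omega>) = cinner (hadj (rmul m) \<Omega>) (T \<Omega>)"
    by (simp add: hadj_rmul m rmul_\<Omega> M_hadj)
  also have "\<dots> = cinner \<Omega> (rmul m (T \<Omega>))" by (simp add: cinner_hadj_left rmul_bounded_ops m)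
  also have "rmul m (T \<Omega>) = T (m \<Omega>)" using commutantD[OF T, of "rmul m" \<Omega>] m by (simp add: rmul_\<Omega>)
  finally show ?thesis by (simp add: cinner_hadj_left Tb)
qed

lemma rmul_commutant_approximation:
  assumes T: "T \<in> commutant (rmul ` M)"
  obtains t :: "nat \<Rightarrow> 'a \<Rightarrow> 'a" where "\<And>k. t k \<in> M" "(\<lambda>k. t k \<Omega>) \<longlonglongrightarrow> T \<Omega>" "(\<lambda>k. hadj (t k) \<Omega>) \<longlonglongrightarrow> hadj T \<Omega>"
proof -
  have Tb: "T \<in> bounded_ops" using T commutant_subset by blast
  show ?thesis
    by (rule simultaneous_approximation[OF Tb _ _ rmul_commutant_conjugation[OF T]])
      (auto simp: cyclic intro: that)
qed

lemma commutant_approximation: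
  assumes T: "T \<in> commutant M"
  obtains t :: "nat \<Rightarrow> 'a \<Rightarrow> 'a" where "\<And>k. t k \<in> M" "(\<lambda>k. t k \<Omega>) \<longlonglongrightarrow> T \<Omega>" "(\<lambda>k. hadj (t k) \<Omega>) \<longlonglongrightarrow> hadj T \<Omega>"
proof -
  have Tb: "T \<in> bounded_ops" using T commutant_subset by blast
  show ?thesis
    by (rule simultaneous_approximation[OF Tb _ _ commutant_conjugation[OF T]])
      (auto simp: cyclic intro: that)
qed

text \<open>\<open>\<langle>T S a\<Omega>, b\<Omega>\<rangle>\<close> and \<open>\<langle>S T a\<Omega>, b\<Omega>\<rangle>\<close> are limits of traces of cyclic permutations of the same
  product, because \<open>S\<Omega>, S\<^sup>*\<Omega>\<close> and \<open>T\<Omega>, T\<^sup>*\<Omega>\<close> are limits of \<open>s\<^sub>k\<Omega>, s\<^sub>k\<^sup>*\<Omega>\<close> and \<open>t\<^sub>k\<Omega>, t\<^sub>k\<^sup>*\<Omega>\<close>.\<close>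

theorem commutant_rmul: "commutant (rmul ` M) = commutant (commutant M)"
proof
  show "commutant (commutant M) \<subseteq> commutant (rmul ` M)"
    by (intro commutant_antimono) (auto simp: rmul_commutant)
  show "commutant (rmul ` M) \<subseteq> commutant (commutant M)"
  proof
    fix T assume T: "T \<in> commutant (rmul ` M)"
    have Tb: "T \<in> bounded_ops" using T commutant_subset by blast
    have TR: "T (rmul a \<xi>) = rmul a (T \<xi>)" if "a \<in> M" for a \<xi> using commutantD[OF T] that by blast
    have TaR: "hadj T (rmul a \<xi>) = rmul a (hadj T \<xi>)" if "a \<in> M" for a \<xi>
    proof -
      have "hadj T \<in> commutant (rmul ` M)"
        by (rule commutant_hadj[OF _ _ T]) (auto simp: rmul_bounded_ops hadj_rmul M_hadj)
      thus ?thesis using commutantD that by blast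
    qed
    obtain t where t: "\<And>k::nat. t k \<in> M" "(\<lambda>k. t k \<Omega>) \<longlonglongrightarrow> T \<Omega>" "(\<lambda>k. hadj (t k) \<Omega>) \<longlonglongrightarrow> hadj T \<Omega>"
      using rmul_commutant_approximation[OF T] by blast
    show "T \<in> commutant (commutant M)"
    proof (rule commutantI[OF Tb])
      fix S \<xi> assume S: "S \<in> commutant M"
      have Sb: "S \<in> bounded_ops" using S commutant_subset by blast
      have Sa: "S (a \<xi>) = a (S \<xi>)" "hadj S (a \<xi>) = a (hadj S \<xi>)" if "a \<in> M" for a \<xi>
        using commutantD[OF S that] commutantD[OF commutant_hadj[OF M_bounded M_hadj S] that] by auto
      obtain s where s: "\<And>k::nat. s k \<in> M" "(\<lambda>k. s k \<Omega>) \<longlonglongrightarrow> S \<Omega>" "(\<lambda>k. hadj (s k) \<Omega>) \<longlonglongrightarrow> hadj S \<Omega>"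
        using commutant_approximation[OF S] by blast
      have "T \<circ> S = S \<circ> T"
      proof (rule eq_on_cyclic)
        fix a assume a: "a \<in> M"
        have "T (S (a \<Omega>)) = S (T (a \<Omega>))"
        proof (rule cinner_ext_cyclic)
          fix b assume b: "b \<in> M"
          have "cinner (T (S (a \<Omega>))) (b \<Omega>) = cinner (a (S \<Omega>)) (rmul b (hadj T \<Omega>))"
            using TaR[OF b, of \<Omega>] Sa(1)[OF a, of \<Omega>]
            by (simp add: cinner_hadj_right[OF Tb, symmetric] rmul_\<Omega>[OF b])
          moreover have "(\<lambda>k. cinner (a (s k \<Omega>)) (rmul b (hadj (t k) \<Omega>))) \<longlonglongrightarrow>
              cinner (a (S \<Omega>)) (rmul b (hadj T \<Omega>))"
            by (rule tendsto_cinner[OF bounded_ops_tendsto[OF M_bo[OF a] s(2)]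
                  bounded_ops_tendsto[OF rmul_bounded_ops[OF b] t(3)]])
          moreover have "cinner (S (T (a \<Omega>))) (b \<Omega>) = cinner (rmul a (T \<Omega>)) (b (hadj S \<Omega>))"
            using TR[OF a, of \<Omega>] Sa(2)[OF b, of \<Omega>]
            by (simp add: cinner_hadj_right[OF Sb, symmetric] rmul_\<Omega>[OF a])
          moreover have "(\<lambda>k. cinner (rmul a (t k \<Omega>)) (b (hadj (s k) \<Omega>))) \<longlonglongrightarrow>
              cinner (rmul a (T \<Omega>)) (b (hadj S \<Omega>))"
            by (rule tendsto_cinner[OF bounded_ops_tendsto[OF rmul_bounded_ops[OF a] t(2)]
                  bounded_ops_tendsto[OF M_bo[OF b] s(3)]])
          moreover have "cinner (rmul a (t k \<Omega>)) (b (hadj (s k) \<Omega>)) =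
              cinner (a (s k \<Omega>)) (rmul b (hadj (t k) \<Omega>))" for k
          proof -
            have "cinner (rmul a (t k \<Omega>)) (b (hadj (s k) \<Omega>)) = cinner ((hadj b \<circ> (t k \<circ> a)) \<Omega>) (hadj (s k) \<Omega>)"
              by (simp add: rmul_apply a t(1) cinner_hadj_left M_bo b)
            also have "\<dots> = cinner (s k ((hadj b \<circ> (t k \<circ> a)) \<Omega>)) \<Omega>"
              by (simp add: cinner_hadj_right M_bo s(1))
            also have "\<dots> = cinner ((hadj b \<circ> (t k \<circ> a)) (s k \<Omega>)) \<Omega>"
              by (intro trace_commute M_comp M_hadj a b s t)
            also have "\<dots> = cinner (a (s k \<Omega>)) (hadj (t k) (b \<Omega>))"
              by (simp add: cinner_hadj_left cinner_hadj_right M_bo b t(1))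
            finally show ?thesis by (simp add: rmul_apply b M_hadj t(1))
          qed
          ultimately show "cinner (T (S (a \<Omega>))) (b \<Omega>) = cinner (S (T (a \<Omega>))) (b \<Omega>)"
            using LIMSEQ_unique by simp
        qed
        thus "(T \<circ> S) (a \<Omega>) = (S \<circ> T) (a \<Omega>)" by simp
      qed (intro bounded_ops_comp Tb Sb)+
      thus "T (S \<xi>) = S (T \<xi>)" by (metis comp_apply)
    qed
  qed
qed

abbreviation "vN \<equiv> commutant (commutant M)"

text \<open>The trace property needs an argument: the state of x y is the inner product of y\<Omega>
  with \<open>hadj x \<Omega>\<close>, and by \<open>commutant_rmul\<close> both vectors are limits
  of the corresponding vectors of M.\<close>

lemma vN_tracial_cyclic: "tracial_cyclic vN \<Omega>"
proof
  have c1: "commutant M \<subseteq> bounded_ops" by (rule commutant_subset)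
  have c2: "vN \<subseteq> bounded_ops" by (rule commutant_subset)
  show "vN \<subseteq> bounded_ops" "id \<in> vN" by (fact c2, rule commutant_id)
  show "(\<lambda>\<xi>. x \<xi> + y \<xi>) \<in> vN" if "x \<in> vN" "y \<in> vN" for x y using commutant_plus[OF c1 that] .
  show "(\<lambda>\<xi>. c *\<^sub>C x \<xi>) \<in> vN" if "x \<in> vN" for c x using commutant_scale[OF c1 that] .
  show "x \<circ> y \<in> vN" if "x \<in> vN" "y \<in> vN" for x y using commutant_comp[OF that] .
  show "hadj x \<in> vN" if "x \<in> vN" for x
    by (rule commutant_hadj[OF c1 commutant_hadj[OF M_bounded M_hadj] that])
  show "closure {x \<Omega> |x. x \<in> vN} = UNIV"
    using closure_mono[of "{x \<Omega> |x. x \<in> M}" "{x \<Omega> |x. x \<in> vN}"] cyclic bicommutant_increasing[OF M_bounded]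
    by blast
  fix x y assume x: "x \<in> vN" and y: "y \<in> vN"
  obtain s where s: "\<And>k::nat. s k \<in> M" "(\<lambda>k. s k \<Omega>) \<longlonglongrightarrow> x \<Omega>" "(\<lambda>k. hadj (s k) \<Omega>) \<longlonglongrightarrow> hadj x \<Omega>"
    using rmul_commutant_approximation x unfolding commutant_rmul by blast
  obtain t where t: "\<And>k::nat. t k \<in> M" "(\<lambda>k. t k \<Omega>) \<longlonglongrightarrow> y \<Omega>" "(\<lambda>k. hadj (t k) \<Omega>) \<longlonglongrightarrow> hadj y \<Omega>"
    using rmul_commutant_approximation y unfolding commutant_rmul by blast
  have xb: "x \<in> bounded_ops" and yb: "y \<in> bounded_ops" using x y c2 by auto
  have "cinner (t k \<Omega>) (hadj (s k) \<Omega>) = cinner (s k \<Omega>) (hadj (t k) \<Omega>)" for k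
    using trace_commute[OF s(1)[of k] t(1)[of k]] by (simp add: cinner_hadj_right M_bo s(1) t(1))
  moreover have "(\<lambda>k. cinner (t k \<Omega>) (hadj (s k) \<Omega>)) \<longlonglongrightarrow> cinner (y \<Omega>) (hadj x \<Omega>)"
    "(\<lambda>k. cinner (s k \<Omega>) (hadj (t k) \<Omega>)) \<longlonglongrightarrow> cinner (x \<Omega>) (hadj y \<Omega>)"
    by (intro tendsto_cinner s t)+
  ultimately show "cinner (x (y \<Omega>)) \<Omega> = cinner (y (x \<Omega>)) \<Omega>"
    using LIMSEQ_unique by (simp add: cinner_hadj_right xb yb)
qed

end

section \<open>Ultraweak convergence\<close>

lemma topspace_ultraweak: "topspace ultraweak_topology = bounded_ops"
proof
  show "bounded_ops \<subseteq> topspace (ultraweak_topology :: ('h \<Rightarrow> 'h::complex_hilbert) topology)"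
  proof
    fix x :: "'h \<Rightarrow> 'h" assume x: "x \<in> bounded_ops"
    have "{x \<in> bounded_ops. (\<Sum>i::nat. cinner (x ((\<lambda>i. 0::'h) i)) ((\<lambda>i. 0) i)) \<in> UNIV} \<in>
      {{x \<in> bounded_ops. (\<Sum>i. cinner (x (\<xi> i)) (\<eta> i)) \<in> V} | \<xi> \<eta> V.
        summable (\<lambda>i::nat. (norm (\<xi> i :: 'h))\<^sup>2) \<and> summable (\<lambda>i. (norm (\<eta> i))\<^sup>2) \<and> open V}"
      by (rule CollectI, intro exI[of _ "\<lambda>i. 0"] exI[of _ UNIV]) simp
    thus "x \<in> topspace ultraweak_topology"
      unfolding ultraweak_topology_def topology_generated_by_topspace using x by auto
  qed
qed (auto simp: ultraweak_topology_def)

lemma limitin_topology_generated_by: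
  assumes "l \<in> topspace (topology_generated_by S)"
    and "\<And>U. U \<in> S \<Longrightarrow> l \<in> U \<Longrightarrow> eventually (\<lambda>k. x k \<in> U) F"
  shows "limitin (topology_generated_by S) x l F"
  unfolding limitin_def
proof (intro conjI allI impI)
  fix U assume U: "openin (topology_generated_by S) U \<and> l \<in> U"
  hence "generate_topology_on S U" by (simp add: openin_topology_generated_by_iff)
  hence "l \<in> U \<longrightarrow> eventually (\<lambda>k. x k \<in> U) F"
  proof induction
    case (Int a b)
    thus ?case by (auto intro: eventually_conj)
  next
    case (UN K)
    show ?case
    proof
      assume "l \<in> \<Union>K"
      then obtain k where "k \<in> K" "l \<in> k" by blast
      with UN have "eventually (\<lambda>i. x i \<in> k) F" by blast
      thus "eventually (\<lambda>i. x i \<in> \<Union>K) F" by (rule eventually_mono) (use \<open>k \<in> K\<close> in blast)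
    qed
  qed (use assms(2) in auto)
  thus "eventually (\<lambda>k. x k \<in> U) F" using U by blast
qed (fact assms(1))

text \<open>Ultraweak neighbourhoods involve infinite series, so weak convergence is combined with
  the common bound C: the terms are dominated by C (|\<xi>_i|^2 + |\<eta>_i|^2), and Tannery's
  theorem exchanges limit and sum.\<close>

lemma ultraweak_limitI:
  fixes A :: "nat \<Rightarrow> 'h::complex_hilbert \<Rightarrow> 'h"
  assumes A: "\<And>k. A k \<in> bounded_ops" "\<And>k \<xi>. norm (A k \<xi>) \<le> C * norm \<xi>" "l \<in> bounded_ops"
    and conv: "\<And>\<xi> \<eta>. (\<lambda>k. cinner (A k \<xi>) \<eta>) \<longlonglongrightarrow> cinner (l \<xi>) \<eta>"
  shows "limitin ultraweak_topology A l sequentially"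
  unfolding ultraweak_topology_def
proof (rule limitin_topology_generated_by, fold ultraweak_topology_def)
  show "l \<in> topspace ultraweak_topology" using A(3) topspace_ultraweak by blast
next
  fix U assume UB: "U \<in> {{x \<in> bounded_ops. (\<Sum>i. cinner (x (\<xi> i)) (\<eta> i)) \<in> V} | \<xi> \<eta> V.
        summable (\<lambda>i::nat. (norm (\<xi> i :: 'h))\<^sup>2) \<and> summable (\<lambda>i. (norm (\<eta> i))\<^sup>2) \<and> open V}" "l \<in> U"
  then obtain \<xi> \<eta> V where U: "U = {x \<in> bounded_ops. (\<Sum>i. cinner (x (\<xi> i)) (\<eta> i)) \<in> V}"
    and s: "summable (\<lambda>i::nat. (norm (\<xi> i))\<^sup>2)" "summable (\<lambda>i. (norm (\<eta> i))\<^sup>2)" and V: "open V" by blast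
  have am: "norm (A k (\<xi> i)) * norm (\<eta> i) \<le> C * ((norm (\<xi> i))\<^sup>2 + (norm (\<eta> i))\<^sup>2)" for k i
  proof -
    have C: "C * norm (\<xi> i) \<ge> 0" using order_trans[OF norm_ge_zero A(2)] .
    have xy: "norm (\<xi> i) * norm (\<eta> i) \<le> (norm (\<xi> i))\<^sup>2 + (norm (\<eta> i))\<^sup>2"
      using sum_squares_bound[of "norm (\<xi> i)" "norm (\<eta> i)"] mult_nonneg_nonneg[OF norm_ge_zero[of "\<xi> i"] norm_ge_zero[of "\<eta> i"]]
      by linarith
    show ?thesis
    \<comment> \<open>The sign of C is deduced from the bound at a nonzero vector. At a zero vector
      only C |\<eta>_i| \<ge> 0 is available, and it is enough.\<close>
    proof (cases "\<xi> i = 0")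
      case True
      have "C * norm (\<eta> i) \<ge> 0" using order_trans[OF norm_ge_zero A(2)] .
      hence "C * (norm (\<eta> i))\<^sup>2 \<ge> 0" by (simp add: power2_eq_square mult.assoc[symmetric])
      thus ?thesis using True by (simp add: bounded_ops_zero[OF A(1)])
    next
      case False
      hence "C \<ge> 0" using C by (simp add: zero_le_mult_iff)
      have "norm (A k (\<xi> i)) * norm (\<eta> i) \<le> C * norm (\<xi> i) * norm (\<eta> i)"
        by (rule mult_right_mono[OF A(2)]) simp
      also have "\<dots> \<le> C * ((norm (\<xi> i))\<^sup>2 + (norm (\<eta> i))\<^sup>2)"
        using mult_left_mono[OF xy \<open>C \<ge> 0\<close>] by (simp add: mult.assoc)
      finally show ?thesis .
    qed
  qed
  have "(\<lambda>k. \<Sum>i. cinner (A k (\<xi> i)) (\<eta> i)) \<longlonglongrightarrow> (\<Sum>i. cinner (l (\<xi> i)) (\<eta> i))"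
  proof (rule tannerys_theorem[THEN conjunct2, THEN conjunct2])
    show "summable (\<lambda>i. C * ((norm (\<xi> i))\<^sup>2 + (norm (\<eta> i))\<^sup>2))"
      by (intro summable_mult summable_add s)
    show "\<forall>\<^sub>F (i, k) in at_top \<times>\<^sub>F sequentially. norm (cinner (A k (\<xi> i)) (\<eta> i)) \<le> C * ((norm (\<xi> i))\<^sup>2 + (norm (\<eta> i))\<^sup>2)"
      using order_trans[OF cinner_Cauchy_Schwarz am] by (intro always_eventually) auto
  qed (auto intro: conv)
  moreover have "(\<Sum>i. cinner (l (\<xi> i)) (\<eta> i)) \<in> V" using UB U by simp
  ultimately have "\<forall>\<^sub>F k in sequentially. (\<Sum>i. cinner (A k (\<xi> i)) (\<eta> i)) \<in> V"
    by (rule topological_tendstoD[OF _ V])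
  thus "\<forall>\<^sub>F k in sequentially. A k \<in> U" by (rule eventually_mono) (simp add: U A(1))
qed

lemma ultraweak_limitD:
  fixes A :: "'k \<Rightarrow> 'h::complex_hilbert \<Rightarrow> 'h"
  assumes "limitin ultraweak_topology A l F"
  shows "((\<lambda>k. cinner (A k \<xi>) \<eta>) \<longlongrightarrow> cinner (l \<xi>) \<eta>) F"
proof (rule topological_tendstoI)
  fix V assume V: "open V" "cinner (l \<xi>) \<eta> \<in> V"
  \<comment> \<open>A single vector becomes a square-summable sequence concentrated at index 0, so
    each weak functional is among those that generate the topology.\<close>
  define s where "s \<zeta> i = (if i = (0::nat) then \<zeta> else 0)" for \<zeta> :: 'h and i
  have sum0: "(\<Sum>i. cinner (x (s \<xi> i)) (s \<eta> i)) = cinner (x \<xi>) \<eta>" for x :: "'h \<Rightarrow> 'h"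
    by (subst suminf_finite[of "{0}"]) (auto simp: s_def)
  have ss: "summable (\<lambda>i. (norm (s \<zeta> i))\<^sup>2)" for \<zeta>
    by (rule summable_finite[of "{0}"]) (auto simp: s_def)
  let ?U = "{x \<in> bounded_ops. (\<Sum>i. cinner (x (s \<xi> i)) (s \<eta> i)) \<in> V}"
  have "openin ultraweak_topology ?U"
    unfolding ultraweak_topology_def
    by (rule topology_generated_by_Basis) (use ss V(1) in blast)
  moreover have "l \<in> bounded_ops" using limitin_topspace[OF assms] topspace_ultraweak by blast
  hence "l \<in> ?U" using V(2) by (simp add: sum0)
  ultimately have "\<forall>\<^sub>F k in F. A k \<in> ?U" using assms unfolding limitin_def by blast
  thus "\<forall>\<^sub>F k in F. cinner (A k \<xi>) \<eta> \<in> V" by (rule eventually_mono) (simp add: sum0)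
qed


section \<open>Algebras exhausted by matrix algebras\<close>

lemma norm_sum_orthogonal:
  fixes f :: "'i \<Rightarrow> 'h::complex_hilbert"
  assumes "finite I" "\<And>i j. i \<in> I \<Longrightarrow> j \<in> I \<Longrightarrow> i \<noteq> j \<Longrightarrow> cinner (f i) (f j) = 0"
  shows "(norm (\<Sum>i\<in>I. f i))\<^sup>2 = (\<Sum>i\<in>I. (norm (f i))\<^sup>2)"
proof -
  have "complex_of_real ((norm (\<Sum>i\<in>I. f i))\<^sup>2) = (\<Sum>i\<in>I. \<Sum>j\<in>I. cinner (f i) (f j))"
    unfolding cinner_self[symmetric] cinner_sum_left[of f] unfolding cinner_sum_right ..
  also have "\<dots> = (\<Sum>i\<in>I. cinner (f i) (f i))"
  proof (rule sum.cong[OF refl])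
    fix i assume i: "i \<in> I"
    have "(\<Sum>j\<in>I. cinner (f i) (f j)) = (\<Sum>j\<in>I. if j = i then cinner (f i) (f i) else 0)"
      by (rule sum.cong) (use assms(2) i in auto)
    thus "(\<Sum>j\<in>I. cinner (f i) (f j)) = cinner (f i) (f i)" using i assms(1) by simp
  qed
  also have "\<dots> = of_real (\<Sum>i\<in>I. (norm (f i))\<^sup>2)" by (simp add: cinner_self)
  finally show ?thesis using of_real_eq_iff by blast
qed

text \<open>\<open>E_span\<close> holds from some level on, which is how the increasing union of
  matrix algebras is expressed. \<open>d_unbounded\<close> is what rules out minimal
  projections.\<close>

locale matrix_exhausted = tracial_cyclic M \<Omega>
  for M :: "('h::complex_hilbert \<Rightarrow> 'h) set" and \<Omega> :: 'h +
  fixes d :: "nat \<Rightarrow> nat" and E :: "nat \<Rightarrow> nat \<Rightarrow> nat \<Rightarrow> 'h \<Rightarrow> 'h"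
  assumes unit_vector: "cinner \<Omega> \<Omega> = 1"
    and E_M: "i < d k \<Longrightarrow> j < d k \<Longrightarrow> E k i j \<in> M"
    and E_mult: "i < d k \<Longrightarrow> j < d k \<Longrightarrow> l < d k \<Longrightarrow> p < d k \<Longrightarrow>
      E k i j (E k l p \<xi>) = (if j = l then E k i p \<xi> else 0)"
    and E_hadj: "i < d k \<Longrightarrow> j < d k \<Longrightarrow> hadj (E k i j) = E k j i"
    and E_sum: "(\<Sum>i<d k. E k i i \<xi>) = \<xi>"
    and E_span: "m \<in> M \<Longrightarrow> \<forall>\<^sub>F k in sequentially. \<exists>c. \<forall>\<xi>. m \<xi> = (\<Sum>p<d k. \<Sum>q<d k. c p q *\<^sub>C E k p q \<xi>)"
    and d_pos: "d k > 0"
    and d_unbounded: "\<exists>k. N < d k"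
begin

sublocale R: tracial_cyclic vN \<Omega> by (rule vN_tracial_cyclic)

lemma M_subset_vN: "M \<subseteq> vN"
  by (rule bicommutant_increasing[OF M_bounded])

lemma R_vN: "R.vN = vN"
  using triple_commutant[OF M_bounded] by simp

lemma E_vN: "i < d k \<Longrightarrow> j < d k \<Longrightarrow> E k i j \<in> vN"
  using E_M M_subset_vN by blast

lemma E_bo: "i < d k \<Longrightarrow> j < d k \<Longrightarrow> E k i j \<in> bounded_ops"
  using E_M M_bo by blast

definition tr :: "('h \<Rightarrow> 'h) \<Rightarrow> complex" where "tr x = cinner (x \<Omega>) \<Omega>"

lemma tr_comm: "x \<in> vN \<Longrightarrow> y \<in> vN \<Longrightarrow> tr (x \<circ> y) = tr (y \<circ> x)"
  using R.trace_commute by (simp add: tr_def)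

lemma vN_separating: "x \<in> vN \<Longrightarrow> y \<in> vN \<Longrightarrow> x \<Omega> = y \<Omega> \<Longrightarrow> x = y"
  using separating unfolding commutant_rmul by blast

lemma tr_E: assumes "i < d k" "j < d k" shows "tr (E k i j) = (if i = j then 1 / of_nat (d k) else 0)"
proof -
  have a: "tr (E k i i \<circ> E k i j) = tr (E k i j \<circ> E k i i)" by (intro tr_comm E_vN assms)
  have off: "tr (E k i j) = 0" if "i \<noteq> j"
    using a that assms by (simp add: tr_def E_mult)
  have diag: "tr (E k l l) = tr (E k i i)" if l: "l < d k" for l
    using tr_comm[OF E_vN[OF assms(1) l] E_vN[OF l assms(1)]] assms l by (simp add: tr_def E_mult)
  have "1 = cinner (\<Sum>l<d k. E k l l \<Omega>) \<Omega>" by (simp add: E_sum unit_vector)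
  also have "\<dots> = (\<Sum>l<d k. tr (E k l l))" by (simp add: cinner_sum_left tr_def)
  also have "\<dots> = (\<Sum>l<d k. tr (E k i i))" by (rule sum.cong[OF refl diag]) simp
  also have "\<dots> = of_nat (d k) * tr (E k i i)" by simp
  finally have "tr (E k i i) = 1 / of_nat (d k)" using d_pos[of k] by (simp add: field_simps)
  thus ?thesis using off by (cases "i = j") auto
qed

text \<open>\<open>average k\<close> is the conditional expectation onto the relative commutant of the \<open>k\<close>-th matrix
  algebra. It preserves every tracial functional and converges to the trace, which makes a normal
  trace unique.\<close>

definition average :: "nat \<Rightarrow> ('h \<Rightarrow> 'h) \<Rightarrow> 'h \<Rightarrow> 'h" where
  "average k x = (\<lambda>\<xi>. (1 / of_nat (d k)) *\<^sub>C (\<Sum>j<d k. \<Sum>i<d k. E k i j (x (E k j i \<xi>))))"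

lemma average_vN:
  assumes "x \<in> vN"
  shows "average k x \<in> vN"
proof -
  have "(\<lambda>\<xi>. (1 / of_nat (d k)) *\<^sub>C (\<Sum>j<d k. \<Sum>i<d k. (E k i j \<circ> (x \<circ> E k j i)) \<xi>)) \<in> vN"
    by (intro R.M_scale R.M_sum R.M_comp E_vN assms) auto
  thus ?thesis by (simp add: average_def)
qed

text \<open>For fixed j all terms f (E_ij x E_ji) equal f (x E_jj), so the sum over i cancels the
  factor 1 / d k and the sum over j restores x. The functional is left general because the intended
  case is the trace composed with an endomorphism.\<close>

lemma average_trace_functional:
  fixes f :: "('h \<Rightarrow> 'h) \<Rightarrow> complex"
  assumes add: "\<And>x y. x \<in> vN \<Longrightarrow> y \<in> vN \<Longrightarrow> f (\<lambda>\<xi>. x \<xi> + y \<xi>) = f x + f y"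
    and sc: "\<And>c x. x \<in> vN \<Longrightarrow> f (\<lambda>\<xi>. c *\<^sub>C x \<xi>) = c * f x"
    and comm: "\<And>x y. x \<in> vN \<Longrightarrow> y \<in> vN \<Longrightarrow> f (x \<circ> y) = f (y \<circ> x)"
    and x: "x \<in> vN"
  shows "f (average k x) = f x"
proof -
  have f0: "f (\<lambda>\<xi>. 0) = 0" using sc[OF R.M_id, of 0] by simp
  have fsum: "f (\<lambda>\<xi>. \<Sum>i\<in>I. g i \<xi>) = (\<Sum>i\<in>I. f (g i))" if "finite I" "\<And>i. i \<in> I \<Longrightarrow> g i \<in> vN"
    for I :: "nat set" and g
    using that
  proof (induction I rule: finite_induct)
    case (insert i I)
    thus ?case using add[of "g i" "\<lambda>\<xi>. \<Sum>i\<in>I. g i \<xi>"] R.M_sum[of I g] by simp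
  qed (simp add: f0)
  have "(\<lambda>\<xi>. \<Sum>j<d k. \<Sum>i<d k. (E k i j \<circ> (x \<circ> E k j i)) \<xi>) \<in> vN"
    by (intro R.M_sum R.M_comp E_vN x) auto
  from sc[OF this, of "1 / of_nat (d k)"]
  have "f (average k x) = (1 / of_nat (d k)) * f (\<lambda>\<xi>. \<Sum>j<d k. \<Sum>i<d k. (E k i j \<circ> (x \<circ> E k j i)) \<xi>)"
    by (simp add: average_def)
  also have "f (\<lambda>\<xi>. \<Sum>j<d k. \<Sum>i<d k. (E k i j \<circ> (x \<circ> E k j i)) \<xi>) =
      (\<Sum>j<d k. f (\<lambda>\<xi>. \<Sum>i<d k. (E k i j \<circ> (x \<circ> E k j i)) \<xi>))"
    by (intro fsum R.M_sum R.M_comp E_vN x) auto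
  also have "\<dots> = (\<Sum>j<d k. \<Sum>i<d k. f (E k i j \<circ> (x \<circ> E k j i)))"
    by (intro sum.cong refl fsum R.M_comp E_vN x) auto
  also have "\<dots> = (\<Sum>j<d k. \<Sum>i<d k. f (x \<circ> E k j j))"
  proof (intro sum.cong refl)
    fix j i assume ij: "j \<in> {..<d k}" "i \<in> {..<d k}"
    have "f (E k i j \<circ> (x \<circ> E k j i)) = f ((x \<circ> E k j i) \<circ> E k i j)"
      using ij by (intro comm R.M_comp E_vN x) auto
    also have "(x \<circ> E k j i) \<circ> E k i j = x \<circ> E k j j" using ij by (simp add: fun_eq_iff E_mult)
    finally show "f (E k i j \<circ> (x \<circ> E k j i)) = f (x \<circ> E k j j)" .
  qed
  also have "\<dots> = of_nat (d k) * (\<Sum>j<d k. f (x \<circ> E k j j))"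
    by (simp add: sum_distrib_left)
  also have "(\<Sum>j<d k. f (x \<circ> E k j j)) = f (\<lambda>\<xi>. \<Sum>j<d k. (x \<circ> E k j j) \<xi>)"
    by (intro fsum[symmetric] R.M_comp E_vN x) auto
  also have "(\<lambda>\<xi>. \<Sum>j<d k. (x \<circ> E k j j) \<xi>) = x"
    by (rule ext) (simp add: bounded_ops_sum[OF R.M_bo[OF x], symmetric] E_sum)
  finally show ?thesis using d_pos[of k] by simp
qed

lemma norm_E_le:
  assumes "i < d k" "j < d k"
  shows "norm (E k i j \<xi>) \<le> norm \<xi>"
proof -
  have sq: "complex_of_real ((norm (E k p j \<xi>))\<^sup>2) = cinner (E k j j \<xi>) \<xi>" if "p < d k" for p
    unfolding cinner_self[symmetric] using that assms
    by (metis E_bo E_hadj E_mult cinner_hadj_left)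
  have "(norm (E k j j \<xi>))\<^sup>2 = norm (cinner (E k j j \<xi>) \<xi>)"
    using sq[OF assms(2)] by (metis abs_of_nonneg norm_of_real zero_le_power2)
  also have "\<dots> \<le> norm (E k j j \<xi>) * norm \<xi>" by (rule cinner_Cauchy_Schwarz)
  finally have "norm (E k j j \<xi>) \<le> norm \<xi>"
    by (cases "norm (E k j j \<xi>) = 0") (auto simp: power2_eq_square)
  moreover have "(norm (E k i j \<xi>))\<^sup>2 = (norm (E k j j \<xi>))\<^sup>2"
    using sq[OF assms(1)] sq[OF assms(2)] of_real_eq_iff by metis
  ultimately show ?thesis by simp
qed

text \<open>For fixed j the vectors E_ij x E_ji \<xi> are mutually orthogonal, so their squared
  norms add up to at most K^2 |\<xi>|^2; averaging over the d k values of j keeps this bound. A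
  bound uniform in k is required for ultraweak convergence.\<close>

lemma average_bound:
  assumes x: "\<And>\<xi>. norm (x \<xi>) \<le> K * norm \<xi>"
  shows "norm (average k x \<xi>) \<le> K * norm \<xi>"
proof (cases "\<exists>\<eta>::'h. \<eta> \<noteq> 0")
  case True
  then obtain \<eta> :: 'h where "\<eta> \<noteq> 0" by blast
  hence "K \<ge> 0" using order_trans[OF norm_ge_zero x[of \<eta>]] by (simp add: zero_le_mult_iff)
  have v: "norm (\<Sum>i<d k. E k i j (x (E k j i \<xi>))) \<le> K * norm \<xi>" if j: "j < d k" for j
  proof -
    have "(norm (\<Sum>i<d k. E k i j (x (E k j i \<xi>))))\<^sup>2 = (\<Sum>i<d k. (norm (E k i j (x (E k j i \<xi>))))\<^sup>2)"
    proof (rule norm_sum_orthogonal)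
      fix i l assume il: "i \<in> {..<d k}" "l \<in> {..<d k}" "i \<noteq> l"
      have "cinner (E k i j u) (E k l j v) = 0" for u v
      proof -
        have "cinner (E k i j u) (E k l j v) = cinner (hadj (E k l j) (E k i j u)) v"
          by (rule cinner_hadj_left[symmetric]) (use il j E_bo in auto)
        thus ?thesis using il j by (simp add: E_hadj E_mult)
      qed
      thus "cinner (E k i j (x (E k j i \<xi>))) (E k l j (x (E k j l \<xi>))) = 0" .
    qed simp
    also have "\<dots> \<le> (\<Sum>i<d k. K\<^sup>2 * (norm (E k j i \<xi>))\<^sup>2)"
    proof (rule sum_mono)
      fix i assume i: "i \<in> {..<d k}"
      have "norm (E k i j (x (E k j i \<xi>))) \<le> K * norm (E k j i \<xi>)"
        using order_trans[OF norm_E_le x] i j by simp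
      hence "(norm (E k i j (x (E k j i \<xi>))))\<^sup>2 \<le> (K * norm (E k j i \<xi>))\<^sup>2" by (intro power_mono) auto
      thus "(norm (E k i j (x (E k j i \<xi>))))\<^sup>2 \<le> K\<^sup>2 * (norm (E k j i \<xi>))\<^sup>2" by (simp add: power_mult_distrib)
    qed
    also have "\<dots> = K\<^sup>2 * (\<Sum>i<d k. (norm (E k j i \<xi>))\<^sup>2)" by (simp add: sum_distrib_left)
    also have "(\<Sum>i<d k. (norm (E k j i \<xi>))\<^sup>2) = (norm \<xi>)\<^sup>2"
    proof -
      have "complex_of_real (\<Sum>i<d k. (norm (E k j i \<xi>))\<^sup>2) = (\<Sum>i<d k. cinner (E k i i \<xi>) \<xi>)"
        unfolding of_real_sum cinner_self[symmetric]
      proof (rule sum.cong[OF refl])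
        fix i assume "i \<in> {..<d k}"
        thus "cinner (E k j i \<xi>) (E k j i \<xi>) = cinner (E k i i \<xi>) \<xi>"
          using j cinner_hadj_left[OF E_bo, of j k i "E k j i \<xi>" \<xi>] by (simp add: E_hadj E_mult)
      qed
      also have "\<dots> = complex_of_real ((norm \<xi>)\<^sup>2)"
        by (simp only: cinner_sum_left[symmetric] E_sum cinner_self)
      finally show ?thesis using of_real_eq_iff by blast
    qed
    also have "K\<^sup>2 * (norm \<xi>)\<^sup>2 = (K * norm \<xi>)\<^sup>2" by (simp add: power_mult_distrib)
    finally show ?thesis by (rule power2_le_imp_le) (use \<open>K \<ge> 0\<close> in simp)
  qed
  have "norm (\<Sum>j<d k. \<Sum>i<d k. E k i j (x (E k j i \<xi>))) \<le> (\<Sum>j<d k. K * norm \<xi>)"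
    by (rule sum_norm_le) (use v in simp)
  thus ?thesis using d_pos[of k] by (simp add: average_def norm_scaleC norm_divide field_simps)
next
  case False
  hence "\<And>\<eta>::'h. \<eta> = 0" by blast
  thus ?thesis by (metis norm_zero order_refl mult_zero_right)
qed

lemma compression:
  assumes m: "\<And>\<xi>. m \<xi> = (\<Sum>p<d k. \<Sum>q<d k. c p q *\<^sub>C E k p q \<xi>)" and ij: "i < d k" "j < d k"
  shows "E k j i (m (E k i j \<xi>)) = c i i *\<^sub>C E k j j \<xi>"
proof -
  have b: "E k j i \<in> bounded_ops" by (rule E_bo[OF ij(2,1)])
  have "E k j i (m (E k i j \<xi>)) = (\<Sum>p<d k. \<Sum>q<d k. c p q *\<^sub>C E k j i (E k p q (E k i j \<xi>)))"
    unfolding m by (simp add: bounded_ops_sum[OF b] bounded_ops_scaleC[OF b])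
  also have "\<dots> = (\<Sum>p<d k. \<Sum>q<d k. if q = i then (if p = i then c i i *\<^sub>C E k j j \<xi> else 0) else 0)"
    by (intro sum.cong refl) (use ij in \<open>auto simp: E_mult bounded_ops_zero[OF b]\<close>)
  also have "\<dots> = c i i *\<^sub>C E k j j \<xi>" using ij by simp
  finally show ?thesis .
qed

text \<open>On the dense vectors equality is reached at a finite stage. Once
  \<open>a \<circ> hadj b\<close> lies in the k-th matrix algebra, compressing it between E_ji and
  E_ij leaves a multiple of E_jj, and the trace property brings these factors together.\<close>

lemma average_weakly_eventually:
  assumes x: "x \<in> vN" and ab: "a \<in> M" "b \<in> M"
  shows "\<forall>\<^sub>F k in sequentially. cinner (average k x (a \<Omega>)) (b \<Omega>) = tr x * cinner (a \<Omega>) (b \<Omega>)"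
proof -
  have av: "a \<in> vN" and bv: "b \<in> vN" using ab M_subset_vN by auto
  have "a \<circ> hadj b \<in> M" by (intro M_comp M_hadj ab)
  from E_span[OF this] show ?thesis
  proof (rule eventually_mono)
    fix k assume "\<exists>c. \<forall>\<xi>. (a \<circ> hadj b) \<xi> = (\<Sum>p<d k. \<Sum>q<d k. c p q *\<^sub>C E k p q \<xi>)"
    then obtain c where c: "\<And>\<xi>. (a \<circ> hadj b) \<xi> = (\<Sum>p<d k. \<Sum>q<d k. c p q *\<^sub>C E k p q \<xi>)" by blast
    have summand: "cinner (E k i j (x (E k j i (a \<Omega>)))) (b \<Omega>) = c i i * tr (x \<circ> E k j j)"
      if ij: "i < d k" "j < d k" for i j
    proof -
      have "cinner (E k i j (x (E k j i (a \<Omega>)))) (b \<Omega>) = tr ((hadj b \<circ> E k i j) \<circ> (x \<circ> (E k j i \<circ> a)))"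
        by (simp add: tr_def cinner_hadj_left M_bo ab)
      also have "\<dots> = tr ((x \<circ> (E k j i \<circ> a)) \<circ> (hadj b \<circ> E k i j))"
        by (intro tr_comm R.M_comp R.M_hadj E_vN x av bv ij)
      also have "\<dots> = cinner (x (E k j i ((a \<circ> hadj b) (E k i j \<Omega>)))) \<Omega>" by (simp add: tr_def)
      also have "E k j i ((a \<circ> hadj b) (E k i j \<Omega>)) = c i i *\<^sub>C E k j j \<Omega>" by (rule compression[OF c ij])
      finally show ?thesis by (simp add: bounded_ops_scaleC[OF R.M_bo[OF x]] cinner_scaleC_left tr_def)
    qed
    have "tr x = cinner (x (\<Sum>j<d k. E k j j \<Omega>)) \<Omega>" by (simp add: E_sum tr_def)
    also have "\<dots> = (\<Sum>j<d k. tr (x \<circ> E k j j))"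
      by (simp add: bounded_ops_sum[OF R.M_bo[OF x]] cinner_sum_left tr_def)
    finally have trx: "tr x = (\<Sum>j<d k. tr (x \<circ> E k j j))" .
    have "cinner (a \<Omega>) (b \<Omega>) = tr (a \<circ> hadj b)"
      using tr_comm[OF av R.M_hadj[OF bv]] by (simp add: tr_def cinner_hadj_left M_bo ab)
    also have "\<dots> = (\<Sum>p<d k. \<Sum>q<d k. c p q * tr (E k p q))"
      unfolding tr_def c by (simp add: cinner_sum_left cinner_scaleC_left)
    also have "\<dots> = (\<Sum>p<d k. \<Sum>q<d k. if q = p then c p p / of_nat (d k) else 0)"
      by (intro sum.cong refl) (auto simp: tr_E)
    also have "\<dots> = (\<Sum>p<d k. c p p) / of_nat (d k)" by (simp add: sum_divide_distrib)
    finally have ab': "cinner (a \<Omega>) (b \<Omega>) = (\<Sum>p<d k. c p p) / of_nat (d k)" .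
    have "cinner (average k x (a \<Omega>)) (b \<Omega>) = (1 / of_nat (d k)) * (\<Sum>j<d k. \<Sum>i<d k. c i i * tr (x \<circ> E k j j))"
      by (simp add: average_def cinner_scaleC_left cinner_sum_left summand)
    also have "(\<Sum>j<d k. \<Sum>i<d k. c i i * tr (x \<circ> E k j j)) = (\<Sum>j<d k. (\<Sum>i<d k. c i i) * tr (x \<circ> E k j j))"
      by (simp add: sum_distrib_right)
    also have "\<dots> = (\<Sum>i<d k. c i i) * tr x" by (simp add: trx sum_distrib_left)
    finally show "cinner (average k x (a \<Omega>)) (b \<Omega>) = tr x * cinner (a \<Omega>) (b \<Omega>)"
      by (simp add: ab')
  qed
qed

lemma average_weakly:
  assumes x: "x \<in> vN"
  shows "(\<lambda>k. cinner (average k x \<xi>) \<eta>) \<longlonglongrightarrow> tr x * cinner \<xi> \<eta>"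
proof -
  obtain K where K: "K > 0" "\<And>\<xi>. norm (x \<xi>) \<le> norm \<xi> * K" using bounded_ops_bound[OF R.M_bo[OF x]] by blast
  define C where "C = K + norm (tr x) + 1"
  have C: "C > 0" using K(1) by (simp add: C_def add_pos_nonneg)
  \<comment> \<open>The deviation from the claimed limit. It is at most C |u| |v| for all k at once
    and vanishes eventually on pairs from M\<Omega>, so density gives convergence.\<close>
  define D where "D k u v = cinner (average k x u) v - tr x * cinner u v" for k u v
  have ab: "average k x \<in> bounded_ops" for k using average_vN[OF x] R.M_bo by blast
  have Dadd: "D k (u + u') v = D k u v + D k u' v" "D k u (v + v') = D k u v + D k u v'" for k u u' v v'
    by (simp_all add: D_def bounded_ops_add[OF ab] cinner_add_left cinner_add_right algebra_simps)
  have Dle: "norm (D k u v) \<le> C * norm u * norm v" for k u v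
  proof -
    have "norm (D k u v) \<le> norm (cinner (average k x u) v) + norm (tr x) * norm (cinner u v)"
      unfolding D_def by (metis norm_mult norm_triangle_ineq4)
    also have "\<dots> \<le> (K * norm u) * norm v + norm (tr x) * (norm u * norm v)"
      using average_bound[of x K k u] K(2)
      by (intro add_mono mult_left_mono cinner_Cauchy_Schwarz order_trans[OF cinner_Cauchy_Schwarz mult_right_mono])
        (auto simp: mult.commute)
    also have "\<dots> \<le> C * norm u * norm v"
      by (simp add: C_def algebra_simps)
    finally show ?thesis .
  qed
  have "(\<lambda>k. D k \<xi> \<eta>) \<longlonglongrightarrow> 0"
  proof (rule tendstoI)
    fix e :: real assume e: "e > 0"
    have "\<exists>a\<in>M. norm (\<xi> - a \<Omega>) < e / (2 * C * (norm \<eta> + 1))"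
    proof -
      have "e / (2 * C * (norm \<eta> + 1)) > 0"
        using e C by (intro divide_pos_pos mult_pos_pos) (auto simp: add_nonneg_pos)
      then obtain y where "y \<in> {x \<Omega> |x. x \<in> M}" "dist y \<xi> < e / (2 * C * (norm \<eta> + 1))"
        using closure_approachable[of \<xi> "{x \<Omega> |x. x \<in> M}"] cyclic by blast
      thus ?thesis by (auto simp: dist_norm norm_minus_commute)
    qed
    then obtain a where a: "a \<in> M" "norm (\<xi> - a \<Omega>) < e / (2 * C * (norm \<eta> + 1))" by blast
    \<comment> \<open>This approximation is made after that of \<xi>, since its error gets
      multiplied by |a\<Omega>|.\<close>
    have "\<exists>b\<in>M. norm (\<eta> - b \<Omega>) < e / (2 * C * (norm (a \<Omega>) + 1))"
    proof -
      have "e / (2 * C * (norm (a \<Omega>) + 1)) > 0"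
        using e C by (intro divide_pos_pos mult_pos_pos) (auto simp: add_nonneg_pos)
      then obtain y where "y \<in> {x \<Omega> |x. x \<in> M}" "dist y \<eta> < e / (2 * C * (norm (a \<Omega>) + 1))"
        using closure_approachable[of \<eta> "{x \<Omega> |x. x \<in> M}"] cyclic by blast
      thus ?thesis by (auto simp: dist_norm norm_minus_commute)
    qed
    then obtain b where b: "b \<in> M" "norm (\<eta> - b \<Omega>) < e / (2 * C * (norm (a \<Omega>) + 1))" by blast
    have small: "C * s * t < e / 2" if "s < e / (2 * C * (t + 1))" "t \<ge> 0" "s \<ge> 0" for s t :: real
    proof -
      have "s * (2 * C * (t + 1)) < e" using that C by (simp add: pos_less_divide_eq)
      moreover have "C * s \<ge> 0" using C that by simp
      ultimately show ?thesis by (simp add: algebra_simps)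
    qed
    have "\<forall>\<^sub>F k in sequentially. D k (a \<Omega>) (b \<Omega>) = 0"
      using average_weakly_eventually[OF x a(1) b(1)] by (simp add: D_def)
    thus "\<forall>\<^sub>F k in sequentially. dist (D k \<xi> \<eta>) 0 < e"
    proof (rule eventually_mono)
      fix k assume z: "D k (a \<Omega>) (b \<Omega>) = 0"
      have "D k \<xi> \<eta> = D k (\<xi> - a \<Omega>) \<eta> + D k (a \<Omega>) (\<eta> - b \<Omega>) + D k (a \<Omega>) (b \<Omega>)"
        using Dadd(1)[of k "\<xi> - a \<Omega>" "a \<Omega>" \<eta>] Dadd(2)[of k "a \<Omega>" "\<eta> - b \<Omega>" "b \<Omega>"] by simp
      hence "norm (D k \<xi> \<eta>) \<le> norm (D k (\<xi> - a \<Omega>) \<eta>) + norm (D k (a \<Omega>) (\<eta> - b \<Omega>))"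
        using z by (simp add: norm_triangle_ineq)
      also have "\<dots> < e / 2 + e / 2"
      proof (rule add_strict_mono)
        show "norm (D k (\<xi> - a \<Omega>) \<eta>) < e / 2"
          using le_less_trans[OF Dle small[OF a(2)]] by simp
        have "norm (D k (a \<Omega>) (\<eta> - b \<Omega>)) \<le> C * norm (\<eta> - b \<Omega>) * norm (a \<Omega>)"
          using Dle[of k "a \<Omega>" "\<eta> - b \<Omega>"] by (simp add: mult_ac)
        thus "norm (D k (a \<Omega>) (\<eta> - b \<Omega>)) < e / 2" using small[OF b(2)] by simp
      qed
      finally show "dist (D k \<xi> \<eta>) 0 < e" by simp
    qed
  qed
  hence "(\<lambda>k. D k \<xi> \<eta> + tr x * cinner \<xi> \<eta>) \<longlonglongrightarrow> 0 + tr x * cinner \<xi> \<eta>"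
    by (intro tendsto_add tendsto_const)
  thus ?thesis by (simp add: D_def)
qed

lemma average_ultraweakly:
  assumes x: "x \<in> vN"
  shows "limitin ultraweak_topology (\<lambda>k. average k x) (\<lambda>\<xi>. tr x *\<^sub>C \<xi>) sequentially"
proof -
  obtain K where K: "K > 0" "\<And>\<xi>. norm (x \<xi>) \<le> norm \<xi> * K" using bounded_ops_bound[OF R.M_bo[OF x]] by blast
  show ?thesis
  proof (rule ultraweak_limitI)
    show "average k x \<in> bounded_ops" for k using average_vN[OF x] R.M_bo by blast
    show "norm (average k x \<xi>) \<le> K * norm \<xi>" for k \<xi>
      by (rule average_bound) (use K(2) in \<open>simp add: mult.commute\<close>)
    show "(\<lambda>\<xi>. tr x *\<^sub>C \<xi>) \<in> bounded_ops" by (rule bounded_ops_scale[OF bounded_ops_id(2)])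
  qed (simp add: cinner_scaleC_left average_weakly[OF x])
qed

text \<open>A central element commutes with the matrix units and is therefore its own average; a
  constant sequence must equal its scalar limit.\<close>

lemma vN_center:
  assumes z: "z \<in> vN" "z \<in> commutant vN"
  shows "z = (\<lambda>\<xi>. tr z *\<^sub>C \<xi>)"
proof -
  have "average k z = z" for k
  proof (rule ext)
    fix \<xi>
    have zE: "z (E k j i \<xi>) = E k j i (z \<xi>)" if "i < d k" "j < d k" for i j
      using commutantD[OF z(2) E_vN] that by blast
    have "(\<Sum>j<d k. \<Sum>i<d k. E k i j (z (E k j i \<xi>))) = (\<Sum>j<d k. \<Sum>i<d k. E k i i (z \<xi>))"
      by (intro sum.cong refl) (simp add: zE E_mult)
    thus "average k z \<xi> = z \<xi>"
      using d_pos[of k] by (simp add: average_def E_sum sum_constant_scaleR scaleC_of_real[symmetric] scaleC_scaleC)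
  qed
  hence "cinner (z \<xi>) \<eta> = cinner (tr z *\<^sub>C \<xi>) \<eta>" for \<xi> \<eta>
    using average_weakly[OF z(1), of \<xi> \<eta>] by (simp add: cinner_scaleC_left LIMSEQ_const_iff)
  thus ?thesis by (intro ext cinner_ext_left)
qed

text \<open>The projection \<open>v \<circ> hadj v\<close> has trace 1, so its complement
  annihilates \<Omega>, and \<Omega> is separating.\<close>

lemma vN_finite:
  assumes v: "v \<in> vN" "hadj v \<circ> v = id"
  shows "v \<circ> hadj v = id"
proof (rule vN_separating)
  let ?w = "v \<circ> hadj v"
  have vb: "v \<in> bounded_ops" using v R.M_bo by blast
  have vv: "hadj v (v \<xi>) = \<xi>" for \<xi> using v(2) by (metis comp_apply id_apply)
  show w: "?w \<in> vN" by (intro R.M_comp R.M_hadj v)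
  show "id \<in> vN" by (rule R.M_id)
  have "cinner (?w \<Omega>) \<Omega> = 1"
    using tr_comm[OF v(1) R.M_hadj[OF v(1)]] vv by (simp add: tr_def unit_vector)
  hence c: "cinner (v (hadj v \<Omega>)) \<Omega> = 1" "cinner \<Omega> (v (hadj v \<Omega>)) = 1"
    by (simp_all, metis cinner_commute complex_cnj_one)
  have "cinner (v (hadj v \<Omega>)) (v (hadj v \<Omega>)) = 1"
    using c(1) by (simp add: cinner_hadj_left[OF vb, symmetric] cinner_hadj_right[OF vb] vv)
  hence "cinner (?w \<Omega> - \<Omega>) (?w \<Omega> - \<Omega>) = 0"
    using c by (simp add: cinner_diff_left cinner_diff_right unit_vector)
  thus "?w \<Omega> = id \<Omega>" by (simp add: cinner_self)
qed

text \<open>For a minimal projection \<open>p\<close> and a diagonal matrix unit \<open>f\<close>, \<open>pfp\<close> is a multiple of \<open>p\<close>, and so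
  \<open>\<tau>(p) \<le> \<tau>(f)\<close> unless \<open>pf = 0\<close>.\<close>

lemma no_minimal_projection: "\<not> minimal_projection vN p"
proof
  assume p: "minimal_projection vN p"
  have pv: "p \<in> vN" and pr: "projection p" and pn: "p \<noteq> (\<lambda>\<xi>. 0)" using p by (auto simp: minimal_projection_def)
  have pb: "p \<in> bounded_ops" and pp: "\<And>\<xi>. p (p \<xi>) = p \<xi>" and ph: "hadj p = p"
    using pr by (auto simp: projection_def fun_eq_iff)
  have pc: "cinner (p u) v = cinner u (p v)" for u v using cinner_hadj_left[OF pb, of u v] ph by simp
  define \<beta> where "\<beta> = (norm (p \<Omega>))\<^sup>2"
  have "p \<Omega> \<noteq> 0"
    using vN_separating[OF pv R.M_scale[OF R.M_id, of 0]] pn by auto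
  hence \<beta>: "\<beta> > 0" by (simp add: \<beta>_def)
  have trp: "cinner (p \<Omega>) \<Omega> = of_real \<beta>"
    unfolding \<beta>_def cinner_self[symmetric] using pc[of "p \<Omega>" \<Omega>] by (simp add: pp)
  have main: "\<beta> \<le> 1 / real (d k)" for k
  proof -
    define \<alpha> where "\<alpha> i = (norm (E k i i (p \<Omega>)))\<^sup>2" for i
    have fc: "cinner (E k i i u) v = cinner u (E k i i v)" if "i < d k" for i u v
      using cinner_hadj_left[OF E_bo[OF that that], of u v] that by (simp add: E_hadj)
    have ff: "E k i i (E k i i u) = E k i i u" if "i < d k" for i u using that by (simp add: E_mult)
    have \<alpha>: "complex_of_real (\<alpha> i) = cinner (E k i i (p \<Omega>)) (p \<Omega>)" if i: "i < d k" for i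
      unfolding \<alpha>_def cinner_self[symmetric] using fc[OF i, of "E k i i (p \<Omega>)" "p \<Omega>"] by (simp add: ff i)
    have "complex_of_real (\<Sum>i<d k. \<alpha> i) = cinner (\<Sum>i<d k. E k i i (p \<Omega>)) (p \<Omega>)"
      by (simp add: \<alpha> cinner_sum_left)
    also have "\<dots> = of_real \<beta>" by (simp add: E_sum cinner_self \<beta>_def)
    finally have "(\<Sum>i<d k. \<alpha> i) = \<beta>" using of_real_eq_iff by blast
    then obtain i where i: "i < d k" "\<alpha> i \<noteq> 0" using \<beta> by (metis lessThan_iff less_irrefl sum.neutral)
    let ?f = "E k i i"
    \<comment> \<open>The ratio for which y = p f p - l p has trace 0. Minimality makes y
      semidefinite, so y\<Omega> = 0 and hence y = 0.\<close>
    define l where "l = \<alpha> i / \<beta>"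
    have ap: "\<alpha> i > 0" using i by (simp add: \<alpha>_def)
    have fb: "?f \<in> bounded_ops" and fv: "?f \<in> vN" using E_bo E_vN i by auto
    define y where "y \<xi> = p (?f (p \<xi>)) - of_real l *\<^sub>C p \<xi>" for \<xi>
    have pfp: "p \<circ> (?f \<circ> p) \<in> vN" by (intro R.M_comp pv fv)
    have yv: "y \<in> vN" unfolding y_def[abs_def] using R.M_diff[OF pfp R.M_scale[OF pv]] by simp
    have yh: "hadj y = y"
      by (rule hadj_eqI) (simp add: y_def cinner_diff_left cinner_diff_right cinner_scaleC_left cinner_scaleC_right pc fc i)
    have py: "p \<circ> y = y" "y \<circ> p = y"
      by (auto simp: fun_eq_iff y_def bounded_ops_diff[OF pb] bounded_ops_scaleC[OF pb] pp)
    have "(\<forall>\<xi>. Re (cinner (y \<xi>) \<xi>) \<ge> 0) \<or> (\<forall>\<xi>. Re (cinner (y \<xi>) \<xi>) \<le> 0)"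
      by (rule minimal_projection_sign[OF commutant_subset commutant_hadj[OF M_bounded M_hadj] p yv yh py])
    moreover have "cinner (y \<Omega>) \<Omega> = 0"
      using \<beta> by (simp add: y_def cinner_diff_left cinner_scaleC_left trp pc[of "?f (p \<Omega>)"] \<alpha>[OF i(1), symmetric] l_def)
    ultimately have "y \<Omega> = 0" by (rule semidefinite_kernel[OF R.M_bo[OF yv] yh])
    hence "y = (\<lambda>\<xi>. 0 *\<^sub>C id \<xi>)" by (intro vN_separating yv R.M_scale R.M_id) simp
    hence y0: "p (?f (p \<xi>)) = of_real l *\<^sub>C p \<xi>" for \<xi> by (simp add: y_def fun_eq_iff)
    let ?u = "?f (p (?f \<Omega>))"
    \<comment> \<open>p f is the adjoint of f p, so the trace gives both the same norm at
      \<Omega>.\<close>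
    have pf: "(norm (p (?f \<Omega>)))\<^sup>2 = \<alpha> i"
    proof -
      have "hadj (?f \<circ> p) = p \<circ> ?f" using i by (simp add: hadj_comp fb pb E_hadj ph)
      thus ?thesis using R.norm_hadj_\<Omega>[OF R.M_comp[OF fv pv]] by (simp add: \<alpha>_def)
    qed
    have pf': "cinner (p (?f \<Omega>)) (?f \<Omega>) = of_real (\<alpha> i)"
      using pc[of "p (?f \<Omega>)" "?f \<Omega>"] unfolding pf[symmetric] cinner_self[symmetric] by (simp add: pp)
    have "complex_of_real ((norm ?u)\<^sup>2) = cinner (p (?f (p (?f \<Omega>)))) (?f \<Omega>)"
      unfolding cinner_self[symmetric] using fc[OF i(1), of ?u "p (?f \<Omega>)"] pc[of ?u "?f \<Omega>"] by (simp add: ff i)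
    also have "\<dots> = of_real (l * \<alpha> i)" by (simp add: y0 cinner_scaleC_left pf')
    finally have u: "(norm ?u)\<^sup>2 = l * \<alpha> i" using of_real_eq_iff by blast
    have "complex_of_real ((norm (?f \<Omega>))\<^sup>2) = of_real (1 / real (d k))"
      using tr_E[OF i(1) i(1)] fc[OF i(1), of "?f \<Omega>" \<Omega>]
      unfolding cinner_self[symmetric] by (simp add: tr_def ff i)
    hence f: "(norm (?f \<Omega>))\<^sup>2 = 1 / real (d k)" using of_real_eq_iff by blast
    \<comment> \<open>Cauchy-Schwarz against f\<Omega>: \<alpha>_i is at most |f p f \<Omega>|
      |f\<Omega>|, whose square is (\<alpha>_i^2 / \<beta>) (1 / d k). This leaves \<beta> \<le> 1 /
      d k.\<close>
    have "cinner ?u (?f \<Omega>) = of_real (\<alpha> i)" using pf' by (simp add: fc[OF i(1)] ff i)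
    hence "\<alpha> i \<le> norm ?u * norm (?f \<Omega>)"
      using cinner_Cauchy_Schwarz[of ?u "?f \<Omega>"] by simp
    hence "(\<alpha> i)\<^sup>2 \<le> (norm ?u * norm (?f \<Omega>))\<^sup>2" using ap by (intro power_mono) auto
    also have "\<dots> = (\<alpha> i)\<^sup>2 * (1 / (\<beta> * real (d k)))"
      by (simp only: power_mult_distrib u f l_def) (simp add: power2_eq_square)
    finally have "(\<alpha> i)\<^sup>2 * 1 \<le> (\<alpha> i)\<^sup>2 * (1 / (\<beta> * real (d k)))" by simp
    hence "1 \<le> 1 / (\<beta> * real (d k))" by (rule mult_left_le_imp_le) (use ap in simp)
    hence "\<beta> * real (d k) \<le> 1" using \<beta> d_pos[of k] by (simp add: pos_le_divide_eq)
    thus ?thesis using d_pos[of k] by (simp add: pos_le_divide_eq)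
  qed
  obtain N :: nat where N: "1 / \<beta> < real N" using reals_Archimedean2 by blast
  obtain k where "N < d k" using d_unbounded by blast
  hence "1 / \<beta> < real (d k)" using N by linarith
  hence "1 < \<beta> * real (d k)" using \<beta> by (simp add: pos_divide_less_eq mult.commute)
  moreover have "\<beta> * real (d k) \<le> 1" using main[of k] d_pos[of k] by (simp add: pos_le_divide_eq)
  ultimately show False by linarith
qed

end

section \<open>Trace preserving endomorphisms\<close>

locale normal_endomorphism = matrix_exhausted M \<Omega> d E
  for M :: "('h::complex_hilbert \<Rightarrow> 'h) set" and \<Omega> :: 'h and d E +
  fixes \<Phi> :: "('h \<Rightarrow> 'h) \<Rightarrow> 'h \<Rightarrow> 'h"
  assumes endo: "unital_star_endomorphism vN \<Phi>"
begin

lemma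
  shows \<Phi>_vN: "x \<in> vN \<Longrightarrow> \<Phi> x \<in> vN"
    and \<Phi>_add: "x \<in> vN \<Longrightarrow> y \<in> vN \<Longrightarrow> \<Phi> (\<lambda>\<xi>. x \<xi> + y \<xi>) = (\<lambda>\<xi>. \<Phi> x \<xi> + \<Phi> y \<xi>)"
    and \<Phi>_scale: "x \<in> vN \<Longrightarrow> \<Phi> (\<lambda>\<xi>. c *\<^sub>C x \<xi>) = (\<lambda>\<xi>. c *\<^sub>C \<Phi> x \<xi>)"
    and \<Phi>_comp: "x \<in> vN \<Longrightarrow> y \<in> vN \<Longrightarrow> \<Phi> (x \<circ> y) = \<Phi> x \<circ> \<Phi> y"
    and \<Phi>_hadj: "x \<in> vN \<Longrightarrow> \<Phi> (hadj x) = hadj (\<Phi> x)"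
    and \<Phi>_id: "\<Phi> id = id"
    and \<Phi>_continuous: "continuous_map (subtopology ultraweak_topology vN) (subtopology ultraweak_topology vN) \<Phi>"
  using endo unfolding unital_star_endomorphism_def by blast+

lemma \<Phi>_bo: "x \<in> vN \<Longrightarrow> \<Phi> x \<in> bounded_ops"
  using \<Phi>_vN R.M_bo by blast

lemma \<Phi>_scalar: "\<Phi> (\<lambda>\<xi>. c *\<^sub>C \<xi>) = (\<lambda>\<xi>. c *\<^sub>C \<xi>)"
  using \<Phi>_scale[OF R.M_id, of c] by (simp add: \<Phi>_id)

lemma \<Phi>_diff: 
  assumes "x \<in> vN" "y \<in> vN"
  shows "\<Phi> (\<lambda>\<xi>. x \<xi> - y \<xi>) = (\<lambda>\<xi>. \<Phi> x \<xi> - \<Phi> y \<xi>)"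
  using \<Phi>_add[OF assms(1) R.M_scale[OF assms(2), of "-1"]] \<Phi>_scale[OF assms(2), of "-1"]
  by (simp add: scaleC_minus_one)

text \<open>The trace composed with \<Phi> is constant along the averages of x. These converge
  ultraweakly to a scalar, which \<Phi> fixes, so continuity of \<Phi> gives the value.\<close>

lemma tr_\<Phi>:
  assumes x: "x \<in> vN"
  shows "tr (\<Phi> x) = tr x"
proof -
  have const: "tr (\<Phi> (average k x)) = tr (\<Phi> x)" for k
  proof (rule average_trace_functional[where f = "\<lambda>x. tr (\<Phi> x)", OF _ _ _ x])
    show "tr (\<Phi> (\<lambda>\<xi>. u \<xi> + v \<xi>)) = tr (\<Phi> u) + tr (\<Phi> v)" if "u \<in> vN" "v \<in> vN" for u v
      by (simp add: \<Phi>_add that tr_def cinner_add_left)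
    show "tr (\<Phi> (\<lambda>\<xi>. c *\<^sub>C u \<xi>)) = c * tr (\<Phi> u)" if "u \<in> vN" for c u
      by (simp add: \<Phi>_scale that tr_def cinner_scaleC_left)
    show "tr (\<Phi> (u \<circ> v)) = tr (\<Phi> (v \<circ> u))" if "u \<in> vN" "v \<in> vN" for u v
      using tr_comm[OF \<Phi>_vN \<Phi>_vN, of u v] that by (simp add: \<Phi>_comp)
  qed
  have sc: "(\<lambda>\<xi>. tr x *\<^sub>C \<xi>) \<in> vN" using R.M_scale[OF R.M_id] by simp
  have "limitin (subtopology ultraweak_topology vN) (\<lambda>k. average k x) (\<lambda>\<xi>. tr x *\<^sub>C \<xi>) sequentially"
    unfolding limitin_subtopology using average_ultraweakly[OF x] average_vN[OF x] sc by simp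
  from continuous_map_limit[OF \<Phi>_continuous this]
  have "limitin ultraweak_topology (\<Phi> \<circ> (\<lambda>k. average k x)) (\<lambda>\<xi>. tr x *\<^sub>C \<xi>) sequentially"
    unfolding limitin_subtopology by (simp add: \<Phi>_scalar)
  from ultraweak_limitD[OF this, of \<Omega> \<Omega>]
  have "(\<lambda>k. tr (\<Phi> (average k x))) \<longlonglongrightarrow> tr x" by (simp add: tr_def cinner_scaleC_left unit_vector)
  thus ?thesis by (simp add: const LIMSEQ_const_iff)
qed

lemma cinner_\<Phi>:
  assumes "x \<in> vN" "y \<in> vN"
  shows "cinner (\<Phi> x \<Omega>) (\<Phi> y \<Omega>) = cinner (x \<Omega>) (y \<Omega>)"
  using tr_\<Phi>[OF R.M_comp[OF R.M_hadj[OF assms(2)] assms(1)]]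
  by (simp add: \<Phi>_comp \<Phi>_hadj R.M_hadj assms tr_def cinner_hadj_left \<Phi>_bo R.M_bo)

lemma norm_\<Phi>:
  assumes "x \<in> vN"
  shows "norm (\<Phi> x \<Omega>) = norm (x \<Omega>)"
proof -
  have "(norm (\<Phi> x \<Omega>))\<^sup>2 = (norm (x \<Omega>))\<^sup>2"
    using cinner_\<Phi>[OF assms assms] unfolding cinner_self using of_real_eq_iff by blast
  thus ?thesis by simp
qed

lemma \<Phi>_inj:
  assumes "x \<in> vN" "y \<in> vN" "\<Phi> x = \<Phi> y"
  shows "x = y"
proof (rule vN_separating[OF assms(1,2)])
  have "norm (x \<Omega> - y \<Omega>) = norm (\<Phi> x \<Omega> - \<Phi> y \<Omega>)"
    using norm_\<Phi>[OF R.M_diff[OF assms(1,2)]] by (simp add: \<Phi>_diff assms(1,2))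
  thus "x \<Omega> = y \<Omega>" using assms(3) by simp
qed

section \<open>The implementing isometry\<close>

definition V :: "'h \<Rightarrow> 'h" where
  "V = (SOME T. T \<in> bounded_ops \<and> (\<forall>x\<in>vN. T (x \<Omega>) = \<Phi> x \<Omega>))"

lemma V_bo: "V \<in> bounded_ops" and V_\<Omega>: "x \<in> vN \<Longrightarrow> V (x \<Omega>) = \<Phi> x \<Omega>"
proof -
  have "\<exists>T\<in>bounded_ops. \<forall>x\<in>vN. T (x \<Omega>) = \<Phi> x \<Omega>"
    by (rule R.bounded_extension[of "\<lambda>x. \<Phi> x \<Omega>" 1]) (simp_all add: \<Phi>_add \<Phi>_scale norm_\<Phi>)
  hence "V \<in> bounded_ops \<and> (\<forall>x\<in>vN. V (x \<Omega>) = \<Phi> x \<Omega>)"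
    unfolding V_def by (intro someI_ex[of "\<lambda>T. T \<in> bounded_ops \<and> (\<forall>x\<in>vN. T (x \<Omega>) = \<Phi> x \<Omega>)"]) blast
  thus "V \<in> bounded_ops" "x \<in> vN \<Longrightarrow> V (x \<Omega>) = \<Phi> x \<Omega>" by auto
qed

lemma hadj_V_bo: "hadj V \<in> bounded_ops"
  by (rule hadj_bounded_ops[OF V_bo])

lemma hadj_V_V: "hadj V (V \<xi>) = \<xi>"
proof -
  have "hadj V \<circ> V = id"
  proof (rule R.eq_on_cyclic)
    fix x assume x: "x \<in> vN"
    show "(hadj V \<circ> V) (x \<Omega>) = id (x \<Omega>)"
      by (rule R.cinner_ext_cyclic) (simp add: cinner_hadj_left V_bo V_\<Omega> x cinner_\<Phi>)
  qed (intro bounded_ops_comp hadj_V_bo V_bo bounded_ops_id)+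
  thus ?thesis by (metis comp_apply id_apply)
qed

lemma V_intertwines:
  assumes x: "x \<in> vN"
  shows "V (x \<xi>) = \<Phi> x (V \<xi>)"
proof -
  have "V \<circ> x = \<Phi> x \<circ> V"
  proof (rule R.eq_on_cyclic)
    fix y assume y: "y \<in> vN"
    show "(V \<circ> x) (y \<Omega>) = (\<Phi> x \<circ> V) (y \<Omega>)"
      using V_\<Omega>[OF R.M_comp[OF x y]] by (simp add: \<Phi>_comp x y V_\<Omega>)
  qed (intro bounded_ops_comp V_bo R.M_bo \<Phi>_vN x)+
  thus ?thesis by (metis comp_apply)
qed

lemma hadj_V_intertwines:
  assumes x: "x \<in> vN"
  shows "hadj V (\<Phi> x \<xi>) = x (hadj V \<xi>)"
proof (rule cinner_ext_left)
  fix z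
  have "cinner (hadj V (\<Phi> x \<xi>)) z = cinner \<xi> (hadj (\<Phi> x) (V z))"
    by (simp add: cinner_hadj_left V_bo cinner_hadj_right \<Phi>_bo x)
  also have "\<dots> = cinner \<xi> (V (hadj x z))" by (simp add: V_intertwines R.M_hadj x \<Phi>_hadj)
  also have "\<dots> = cinner (x (hadj V \<xi>)) z"
    by (simp add: cinner_hadj_left[OF V_bo, symmetric] cinner_hadj_right R.M_bo x)
  finally show "cinner (hadj V (\<Phi> x \<xi>)) z = cinner (x (hadj V \<xi>)) z" .
qed

text \<open>V carries right multiplications along as well. Hence
  \<open>hadj V \<circ> (z \<circ> V)\<close> commutes with every \<open>rmul m\<close> as soon as z
  commutes with every \<open>rmul (\<Phi> m)\<close>.\<close>

lemma V_rmul: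
  assumes m: "m \<in> vN"
  shows "V (R.rmul m \<xi>) = R.rmul (\<Phi> m) (V \<xi>)"
proof -
  have "V \<circ> R.rmul m = R.rmul (\<Phi> m) \<circ> V"
  proof (rule R.eq_on_cyclic)
    fix y assume y: "y \<in> vN"
    show "(V \<circ> R.rmul m) (y \<Omega>) = (R.rmul (\<Phi> m) \<circ> V) (y \<Omega>)"
      using V_\<Omega>[OF R.M_comp[OF y m]] by (simp add: \<Phi>_comp m y V_\<Omega> R.rmul_apply \<Phi>_vN)
  qed (intro bounded_ops_comp V_bo R.rmul_bounded_ops \<Phi>_vN m)+
  thus ?thesis by (metis comp_apply)
qed

lemma hadj_V_rmul:
  assumes m: "m \<in> vN"
  shows "hadj V (R.rmul (\<Phi> m) \<xi>) = R.rmul m (hadj V \<xi>)"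
proof (rule cinner_ext_left)
  fix z
  have b: "R.rmul m \<in> bounded_ops" "R.rmul (\<Phi> m) \<in> bounded_ops" by (intro R.rmul_bounded_ops \<Phi>_vN m)+
  have "cinner (hadj V (R.rmul (\<Phi> m) \<xi>)) z = cinner \<xi> (hadj (R.rmul (\<Phi> m)) (V z))"
    by (simp add: cinner_hadj_left[OF V_bo] cinner_hadj_right[OF b(2)])
  also have "hadj (R.rmul (\<Phi> m)) = R.rmul (\<Phi> (hadj m))" by (simp add: R.hadj_rmul \<Phi>_vN \<Phi>_hadj m)
  also have "R.rmul (\<Phi> (hadj m)) (V z) = V (hadj (R.rmul m) z)"
    by (simp add: V_rmul R.M_hadj R.hadj_rmul m)
  also have "cinner \<xi> (V (hadj (R.rmul m) z)) = cinner (R.rmul m (hadj V \<xi>)) z"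
    by (simp add: cinner_hadj_left[OF V_bo, symmetric] cinner_hadj_right[OF b(1)])
  finally show "cinner (hadj V (R.rmul (\<Phi> m) \<xi>)) z = cinner (R.rmul m (hadj V \<xi>)) z" .
qed

section \<open>The range of the endomorphism as a factor\<close>

abbreviation P :: "('h \<Rightarrow> 'h) set" where "P \<equiv> \<Phi> ` vN"

lemma P_vN: "P \<subseteq> vN"
  using \<Phi>_vN by blast

lemma P_bounded: "P \<subseteq> bounded_ops"
  using P_vN R.M_bounded by (rule subset_trans)

sublocale P: tracial P \<Omega>
proof
  show "P \<subseteq> bounded_ops" by (rule P_bounded)
  show "id \<in> P" using R.M_id \<Phi>_id by (metis imageI)
  show "(\<lambda>\<xi>. x \<xi> + y \<xi>) \<in> P" if "x \<in> P" "y \<in> P" for x y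
    using that R.M_add \<Phi>_add by (auto simp: image_iff) metis
  show "(\<lambda>\<xi>. c *\<^sub>C x \<xi>) \<in> P" if "x \<in> P" for c x
    using that R.M_scale \<Phi>_scale by (auto simp: image_iff) metis
  show "x \<circ> y \<in> P" if "x \<in> P" "y \<in> P" for x y
    using that R.M_comp \<Phi>_comp by (auto simp: image_iff) metis
  show "hadj x \<in> P" if "x \<in> P" for x
    using that R.M_hadj \<Phi>_hadj by (auto simp: image_iff) metis
  show "cinner (x (y \<Omega>)) \<Omega> = cinner (y (x \<Omega>)) \<Omega>" if "x \<in> P" "y \<in> P" for x y
    using that P_vN R.trace_commute by blast
qed

text \<open>The Jones projection: as V is isometric, this is the orthogonal projection onto the
  closure of the vectors y\<Omega> with y in P.\<close>

definition e :: "'h \<Rightarrow> 'h" where "e = V \<circ> hadj V"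

lemma e_bo: "e \<in> bounded_ops"
  unfolding e_def by (intro bounded_ops_comp V_bo hadj_V_bo)

lemma hadj_e: "hadj e = e"
  unfolding e_def by (simp add: hadj_comp V_bo hadj_V_bo hadj_hadj)

lemma e_selfadjoint: "cinner (e u) v = cinner u (e v)"
  using cinner_hadj_left[OF e_bo] hadj_e by metis

lemma e_commutant: "e \<in> commutant P"
  by (rule commutantI[OF e_bo]) (auto simp: e_def hadj_V_intertwines V_intertwines)

lemma e_P: "y \<in> P \<Longrightarrow> e (y \<Omega>) = y \<Omega>"
  using hadj_V_V by (auto simp: e_def V_\<Omega>[symmetric])

lemma e_\<Omega>: "e \<Omega> = \<Omega>"
  using e_P[OF P.M_id] by simp

lemma L2_P: "L2 P \<Omega> = closure {x \<Omega> |x. x \<in> P}"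
  by (simp add: L2_def)

lemma e_range: "e \<xi> \<in> L2 P \<Omega>"
proof -
  obtain b where b: "\<And>k::nat. b k \<in> vN" "(\<lambda>k. b k \<Omega>) \<longlonglongrightarrow> hadj V \<xi>"
    using R.approximating_sequence by blast
  have "(\<lambda>k. \<Phi> (b k) \<Omega>) \<longlonglongrightarrow> e \<xi>"
    using bounded_ops_tendsto[OF V_bo b(2)] by (simp add: V_\<Omega> b(1) e_def)
  thus ?thesis unfolding L2_P closure_sequential using b(1) by (intro exI[of _ "\<lambda>k. \<Phi> (b k) \<Omega>"]) blast
qed

lemma rmul_commutant_P:
  assumes "m \<in> vN"
  shows "R.rmul m \<in> commutant P"
  using R.rmul_commutant[OF assms] commutant_antimono[OF P_vN] by blast

text \<open>The projection e lies in the commutant of P, so an element z of the bicommutant commutes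
  with it and z\<Omega> = e z \<Omega> is in the range of V. This is why \<open>\<Phi> x\<close> and
  z agree at \<Omega>, which separates.\<close>

lemma P_bicommutant: "commutant (commutant P) = P"
proof
  show "P \<subseteq> commutant (commutant P)" by (rule bicommutant_increasing[OF P_bounded])
  show "commutant (commutant P) \<subseteq> P"
  proof
    fix z assume z: "z \<in> commutant (commutant P)"
    have zb: "z \<in> bounded_ops" using z commutant_subset by blast
    have zv: "z \<in> vN"
      using z commutant_antimono[OF commutant_antimono[OF P_vN]] R_vN by blast
    define x where "x = hadj V \<circ> (z \<circ> V)"
    have xb: "x \<in> bounded_ops" unfolding x_def by (intro bounded_ops_comp hadj_V_bo V_bo zb)
    have "x \<in> commutant (R.rmul ` vN)"
    proof (rule commutantI[OF xb])
      fix T \<xi> assume "T \<in> R.rmul ` vN"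
      then obtain m where m: "m \<in> vN" "T = R.rmul m" by blast
      have "z (R.rmul (\<Phi> m) (V \<xi>)) = R.rmul (\<Phi> m) (z (V \<xi>))"
        by (rule commutantD[OF z rmul_commutant_P[OF \<Phi>_vN[OF m(1)]]])
      thus "x (T \<xi>) = T (x \<xi>)" by (simp add: x_def m V_rmul hadj_V_rmul)
    qed
    hence xv: "x \<in> vN" using R.commutant_rmul R_vN by blast
    have "\<Phi> x \<Omega> = V (x \<Omega>)" by (simp add: V_\<Omega> xv)
    also have "\<dots> = e (z (V \<Omega>))" by (simp add: x_def e_def)
    also have "V \<Omega> = \<Omega>" using V_\<Omega>[OF R.M_id] by (simp add: \<Phi>_id)
    also have "e (z \<Omega>) = z (e \<Omega>)" using commutantD[OF z e_commutant] by simp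
    finally have "\<Phi> x \<Omega> = z \<Omega>" by (simp add: e_\<Omega>)
    hence "\<Phi> x = z" by (intro vN_separating \<Phi>_vN xv zv)
    thus "z \<in> P" using xv by blast
  qed
qed

text \<open>Injectivity of \<Phi> pulls central elements and minimal projections back to R; the
  finiteness condition passes to every subset of R.\<close>

theorem II1_factor_P: "II1_factor P"
proof -
  have "P \<inter> commutant P = range (\<lambda>c \<xi>. c *\<^sub>C \<xi>)"
  proof
    show "P \<inter> commutant P \<subseteq> range (\<lambda>c \<xi>. c *\<^sub>C \<xi>)"
    proof
      fix z assume "z \<in> P \<inter> commutant P"
      then obtain x where x: "x \<in> vN" "z = \<Phi> x" and zc: "\<Phi> x \<in> commutant P" by blast
      have "x \<in> commutant vN"
      proof (rule commutantI[OF R.M_bo[OF x(1)]])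
        fix y \<xi> assume y: "y \<in> vN"
        have "\<Phi> (x \<circ> y) = \<Phi> (y \<circ> x)"
          using commutantD[OF zc imageI[OF y]] y by (simp add: \<Phi>_comp x fun_eq_iff)
        hence "x \<circ> y = y \<circ> x" by (rule \<Phi>_inj[OF R.M_comp[OF x(1) y] R.M_comp[OF y x(1)]])
        thus "x (y \<xi>) = y (x \<xi>)" by (metis comp_apply)
      qed
      hence "x = (\<lambda>\<xi>. tr x *\<^sub>C \<xi>)" by (rule vN_center[OF x(1)])
      hence "z = (\<lambda>\<xi>. tr x *\<^sub>C \<xi>)" using \<Phi>_scalar[of "tr x"] x(2) by simp
      thus "z \<in> range (\<lambda>c \<xi>. c *\<^sub>C \<xi>)" by blast
    qed
    have "(\<lambda>\<xi>. c *\<^sub>C \<xi>) \<in> P \<inter> commutant P" for c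
    proof
      show "(\<lambda>\<xi>. c *\<^sub>C \<xi>) \<in> P" using P.M_scale[OF P.M_id, of c] by simp
      hence cb: "(\<lambda>\<xi>::'h. c *\<^sub>C \<xi>) \<in> bounded_ops" by (rule P.M_bo)
      show "(\<lambda>\<xi>. c *\<^sub>C \<xi>) \<in> commutant P"
        by (rule commutantI[OF cb]) (use bounded_ops_scaleC[OF P.M_bo] in metis)
    qed
    thus "range (\<lambda>c \<xi>. c *\<^sub>C \<xi>) \<subseteq> P \<inter> commutant P" by blast
  qed
  moreover have "\<Omega> \<noteq> 0" using unit_vector by auto
  ultimately have "factor P"
    unfolding factor_def von_neumann_algebra_def using P_bounded P.M_hadj P_bicommutant by blast
  moreover have "\<nexists>p. minimal_projection P p"
  proof
    assume "\<exists>p. minimal_projection P p"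
    then obtain x where x: "x \<in> vN" and p: "minimal_projection P (\<Phi> x)"
      unfolding minimal_projection_def by blast
    have projD: "projection y" if y: "y \<in> vN" "projection (\<Phi> y)" for y
      using that \<Phi>_inj[OF R.M_comp[OF y(1) y(1)] y(1)] \<Phi>_inj[OF R.M_hadj[OF y(1)] y(1)]
      by (simp add: projection_def \<Phi>_comp \<Phi>_hadj R.M_bo)
    have projI: "projection (\<Phi> y)" if y: "y \<in> vN" "projection y" for y
      using that \<Phi>_comp[OF y(1) y(1)] \<Phi>_hadj[OF y(1)] by (simp add: projection_def \<Phi>_bo)
    have zero: "(\<lambda>\<xi>. 0) \<in> vN" "\<Phi> (\<lambda>\<xi>. 0) = (\<lambda>\<xi>. 0)"
      using R.M_scale[OF R.M_id, of 0] \<Phi>_scale[OF R.M_id, of 0] by simp_all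
    have "minimal_projection vN x"
      unfolding minimal_projection_def
    proof (intro conjI ballI impI)
      show "x \<in> vN" by fact
      show "projection x" using p projD[OF x] by (simp add: minimal_projection_def)
      show "x \<noteq> (\<lambda>\<xi>. 0)" using p zero by (auto simp: minimal_projection_def)
      fix q assume q: "q \<in> vN" "projection q \<and> x \<circ> q = q"
      have "\<Phi> x \<circ> \<Phi> q = \<Phi> q" using \<Phi>_comp[OF x q(1)] q(2) by simp
      hence "\<Phi> q = (\<lambda>\<xi>. 0) \<or> \<Phi> q = \<Phi> x"
        using p projI q unfolding minimal_projection_def by blast
      thus "q = (\<lambda>\<xi>. 0) \<or> q = x" using \<Phi>_inj q(1) x zero by metis
    qed
    thus False using no_minimal_projection by blast
  qed
  ultimately show ?thesis
    unfolding II1_factor_def using vN_finite P_vN by blast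
qed

end


section \<open>The index from a Pimsner--Popa basis\<close>

text \<open>P acts on the left, so basis elements multiply from the right and orthonormality
  concerns \<open>b s \<circ> hadj (b t)\<close>. Both conditions refer to M only, where the
  endomorphism can be computed with matrices.\<close>

locale orthonormal_basis_over_range = normal_endomorphism M \<Omega> d E \<Phi>
  for M :: "('h::complex_hilbert \<Rightarrow> 'h) set" and \<Omega> :: 'h and d E \<Phi> +
  fixes N :: nat and b :: "nat \<Rightarrow> 'h \<Rightarrow> 'h"
  assumes b_vN: "s < N \<Longrightarrow> b s \<in> vN"
    and b_orthonormal: "s < N \<Longrightarrow> t < N \<Longrightarrow> x \<in> M \<Longrightarrow>
      tr (\<Phi> x \<circ> (b s \<circ> hadj (b t))) = (if s = t then tr (\<Phi> x) else 0)"
    and b_span: "x \<in> M \<Longrightarrow> \<exists>y. (\<forall>s<N. y s \<in> \<Phi> ` vN) \<and> x \<Omega> = (\<Sum>s<N. y s (b s \<Omega>))"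
begin

text \<open>The trace of z c is the state of c z, which is continuous in the vector z\<Omega>; hence
  the identity passes from the images of M to all of P.\<close>

lemma b_orthonormal_P:
  assumes st: "s < N" "t < N" and y: "y \<in> P"
  shows "tr (y \<circ> (b s \<circ> hadj (b t))) = (if s = t then tr y else 0)"
proof -
  let ?c = "b s \<circ> hadj (b t)"
  have c: "?c \<in> vN" by (intro R.M_comp R.M_hadj b_vN st)
  obtain x where x: "x \<in> vN" "y = \<Phi> x" using y by blast
  obtain a where a: "\<And>k::nat. a k \<in> M" "(\<lambda>k. a k \<Omega>) \<longlonglongrightarrow> x \<Omega>" using approximating_sequence by blast
  have av: "a k \<in> vN" for k using a(1) M_subset_vN by blast
  have lim: "(\<lambda>k. \<Phi> (a k) \<Omega>) \<longlonglongrightarrow> y \<Omega>"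
    using bounded_ops_tendsto[OF V_bo a(2)] by (simp add: V_\<Omega> av x)
  have tc: "tr (z \<circ> ?c) = cinner (?c (z \<Omega>)) \<Omega>" if "z \<in> vN" for z
    using tr_comm[OF that c] by (simp add: tr_def)
  have "(\<lambda>k. cinner (?c (\<Phi> (a k) \<Omega>)) \<Omega>) \<longlonglongrightarrow> cinner (?c (y \<Omega>)) \<Omega>"
    by (intro tendsto_cinner tendsto_const bounded_ops_tendsto[OF R.M_bo[OF c]] lim)
  hence "(\<lambda>k. tr (\<Phi> (a k) \<circ> ?c)) \<longlonglongrightarrow> tr (y \<circ> ?c)"
    using tc[OF \<Phi>_vN[OF av]] tc[OF \<Phi>_vN[OF x(1)]] x(2) by simp
  moreover have "(\<lambda>k. tr (\<Phi> (a k))) \<longlonglongrightarrow> tr y"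
    unfolding tr_def by (intro tendsto_cinner tendsto_const lim)
  ultimately show ?thesis
    using b_orthonormal[OF st a(1)] by (cases "s = t") (simp_all add: LIMSEQ_unique LIMSEQ_const_iff)
qed

text \<open>On vectors c\<Omega> the projection e acts as the conditional expectation onto P;
  orthonormality says that c minus its claimed expectation is orthogonal to P\<Omega>.\<close>

lemma e_b:
  assumes st: "s < N" "t < N"
  shows "e (b s (hadj (b t) \<Omega>)) = (if s = t then \<Omega> else 0)"
proof -
  let ?c = "b s \<circ> hadj (b t)" and ?w = "if s = t then \<Omega> else 0"
  have "cinner (?c \<Omega> - ?w) u = 0" if u: "u \<in> {y \<Omega> |y. y \<in> P}" for u
  proof -
    obtain y where y: "y \<in> P" "u = y \<Omega>" using u by blast
    have "cinner (?c \<Omega>) (y \<Omega>) = tr (hadj y \<circ> ?c)"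
      by (simp add: tr_def cinner_hadj_left P.M_bo y)
    also have "\<dots> = (if s = t then tr (hadj y) else 0)" by (rule b_orthonormal_P[OF st P.M_hadj[OF y(1)]])
    also have "tr (hadj y) = cinner \<Omega> (y \<Omega>)" by (simp add: tr_def cinner_hadj_left P.M_bo y)
    finally show ?thesis by (simp add: y(2) cinner_diff_left)
  qed
  hence orth: "cinner (?c \<Omega> - ?w) u = 0" if "u \<in> L2 P \<Omega>" for u
    using that unfolding L2_P by (rule cinner_orth_dense)
  have "e (?c \<Omega> - ?w) = 0"
    by (rule cinner_ext_left) (simp only: e_selfadjoint orth[OF e_range] cinner_zero_left)
  thus ?thesis by (auto simp: bounded_ops_diff[OF e_bo] e_\<Omega> bounded_ops_zero[OF e_bo])
qed

text \<open>The coordinate along b_s: on x\<Omega> this is the conditional expectation of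
  \<open>x \<circ> hadj (b s)\<close> onto P, taken at \<Omega>.\<close>

definition W :: "nat \<Rightarrow> 'h \<Rightarrow> 'h" where "W s = e \<circ> R.rmul (hadj (b s))"

lemma W_bo: "s < N \<Longrightarrow> W s \<in> bounded_ops"
  unfolding W_def by (intro bounded_ops_comp e_bo R.rmul_bounded_ops R.M_hadj b_vN)

lemma W_b:
  assumes "s < N" "t < N" "y \<in> P"
  shows "W s (y (b t \<Omega>)) = (if s = t then y \<Omega> else 0)"
proof -
  have yv: "y \<in> vN" using assms P_vN by blast
  have "W s (y (b t \<Omega>)) = e (R.rmul (hadj (b s)) ((y \<circ> b t) \<Omega>))" by (simp add: W_def)
  also have "\<dots> = e (y (b t (hadj (b s) \<Omega>)))"
    using R.rmul_apply[OF R.M_hadj[OF b_vN[OF assms(1)]] R.M_comp[OF yv b_vN[OF assms(2)]]] by simp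
  also have "\<dots> = y (e (b t (hadj (b s) \<Omega>)))" by (rule commutantD[OF e_commutant assms(3)])
  also have "\<dots> = (if s = t then y \<Omega> else 0)"
    using e_b[OF assms(2,1)] bounded_ops_zero[OF P.M_bo[OF assms(3)]] by auto
  finally show ?thesis .
qed

lemma Parseval: "(\<Sum>s<N. (norm (W s \<xi>))\<^sup>2) = (norm \<xi>)\<^sup>2"
proof -
  have dense: "(\<Sum>s<N. (norm (W s (x \<Omega>)))\<^sup>2) = (norm (x \<Omega>))\<^sup>2" if x: "x \<in> M" for x
  proof -
    obtain y where y: "\<And>s. s < N \<Longrightarrow> y s \<in> P" "x \<Omega> = (\<Sum>s<N. y s (b s \<Omega>))" using b_span[OF x] by blast
    have W: "W s (x \<Omega>) = y s \<Omega>" if s: "s < N" for s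
    proof -
      have "W s (x \<Omega>) = (\<Sum>t<N. if t = s then y s \<Omega> else 0)"
        unfolding y(2) bounded_ops_sum[OF W_bo[OF s]]
        by (intro sum.cong refl) (use W_b[OF s] y(1) s in auto)
      thus ?thesis using s by simp
    qed
    \<comment> \<open>The trace moves \<open>hadj (b t)\<close> to the far right, next to b_s, where
      orthonormality over P applies.\<close>
    have orth: "cinner (y s (b s \<Omega>)) (y t (b t \<Omega>)) = (if t = s then of_real ((norm (y s \<Omega>))\<^sup>2) else 0)"
      if st: "s < N" "t < N" for s t
    proof -
      have yv: "y s \<in> vN" "y t \<in> vN" using y(1) st P_vN by blast+
      note bv = b_vN[OF st(1)] b_vN[OF st(2)]
      have "cinner (y s (b s \<Omega>)) (y t (b t \<Omega>)) = tr (hadj (b t) \<circ> ((hadj (y t) \<circ> y s) \<circ> b s))"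
        by (simp add: tr_def cinner_hadj_left R.M_bo yv bv)
      also have "\<dots> = tr (((hadj (y t) \<circ> y s) \<circ> b s) \<circ> hadj (b t))"
        by (intro tr_comm R.M_comp R.M_hadj yv bv)
      also have "\<dots> = tr ((hadj (y t) \<circ> y s) \<circ> (b s \<circ> hadj (b t)))" by (simp add: comp_assoc)
      also have "\<dots> = (if s = t then tr (hadj (y t) \<circ> y s) else 0)"
        by (intro b_orthonormal_P st P.M_comp P.M_hadj y(1))
      also have "\<dots> = (if t = s then of_real ((norm (y s \<Omega>))\<^sup>2) else 0)"
        using yv by (auto simp: tr_def cinner_hadj_left R.M_bo cinner_self)
      finally show ?thesis .
    qed
    have "complex_of_real ((norm (x \<Omega>))\<^sup>2) = (\<Sum>s<N. \<Sum>t<N. cinner (y s (b s \<Omega>)) (y t (b t \<Omega>)))"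
      unfolding y(2) cinner_self[symmetric] cinner_sum_left unfolding cinner_sum_right ..
    also have "\<dots> = (\<Sum>s<N. \<Sum>t<N. if t = s then of_real ((norm (y s \<Omega>))\<^sup>2) else 0)"
      by (intro sum.cong refl orth) auto
    also have "\<dots> = of_real (\<Sum>s<N. (norm (W s (x \<Omega>)))\<^sup>2)" using W by simp
    finally show ?thesis using of_real_eq_iff by metis
  qed
  obtain a where a: "\<And>k::nat. a k \<in> M" "(\<lambda>k. a k \<Omega>) \<longlonglongrightarrow> \<xi>" using approximating_sequence by blast
  have "(\<lambda>k. \<Sum>s<N. (norm (W s (a k \<Omega>)))\<^sup>2) \<longlonglongrightarrow> (\<Sum>s<N. (norm (W s \<xi>))\<^sup>2)"
    by (intro tendsto_sum tendsto_power tendsto_norm bounded_ops_tendsto[OF W_bo a(2)]) simp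
  moreover have "(\<lambda>k. (norm (a k \<Omega>))\<^sup>2) \<longlonglongrightarrow> (norm \<xi>)\<^sup>2" by (intro tendsto_power tendsto_norm a(2))
  ultimately show ?thesis unfolding dense[OF a(1)] by (metis LIMSEQ_unique)
qed

lemma norm_b:
  assumes "s < N"
  shows "norm (b s \<Omega>) = 1"
proof -
  have "complex_of_real ((norm (b s \<Omega>))\<^sup>2) = tr (hadj (b s) \<circ> b s)"
    unfolding cinner_self[symmetric] by (simp add: tr_def cinner_hadj_left R.M_bo b_vN assms)
  also have "\<dots> = tr (id \<circ> (b s \<circ> hadj (b s)))"
    using tr_comm[OF R.M_hadj[OF b_vN[OF assms]] b_vN[OF assms]] by simp
  also have "\<dots> = 1" using b_orthonormal_P[OF assms assms P.M_id] by (simp add: tr_def unit_vector)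
  also have "1 = complex_of_real (1\<^sup>2)" by simp
  finally have "(norm (b s \<Omega>))\<^sup>2 = 1\<^sup>2" using of_real_eq_iff by blast
  thus ?thesis by (rule power2_eq_imp_eq) auto
qed

text \<open>The existence half of the definite description. The finite family is padded by zero
  operators because the components of an isometry are indexed by all natural numbers.\<close>

lemma module_isometry_W: "module_isometry P \<Omega> UNIV (\<lambda>s. if s < N then W s else (\<lambda>\<xi>. 0))"
  unfolding module_isometry_def
proof (intro conjI allI ballI impI)
  fix s
  show "(if s < N then W s else (\<lambda>\<xi>. 0)) \<in> bounded_ops" by (simp add: W_bo bounded_ops_const_0)
  have "0 \<in> L2 P \<Omega>" using e_range[of 0] by (simp add: bounded_ops_zero[OF e_bo])
  thus "range (if s < N then W s else (\<lambda>\<xi>. 0)) \<subseteq> L2 P \<Omega>" using e_range by (auto simp: W_def)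
  show "(if s < N then W s else (\<lambda>\<xi>. 0)) \<circ> x = x \<circ> (if s < N then W s else (\<lambda>\<xi>. 0))" if x: "x \<in> P" for x
  proof (cases "s < N")
    case True
    have "W s \<in> commutant P"
      unfolding W_def by (intro commutant_comp e_commutant rmul_commutant_P R.M_hadj b_vN True)
    hence "W s (x \<xi>) = x (W s \<xi>)" for \<xi> using x by (rule commutantD)
    thus ?thesis using True by auto
  qed (auto simp: fun_eq_iff bounded_ops_zero[OF P.M_bo[OF x]])
next
  fix s and \<xi> :: 'h assume "\<forall>\<eta>\<in>UNIV. cinner \<xi> \<eta> = 0"
  hence "\<xi> = 0" by (intro cinner_ext_left) simp
  thus "(if s < N then W s else (\<lambda>\<xi>. 0)) \<xi> = 0" by (simp add: bounded_ops_zero W_bo)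
next
  fix \<xi> :: 'h
  have "(\<lambda>s. if s \<in> {..<N} then (norm (W s \<xi>))\<^sup>2 else 0) sums (\<Sum>s<N. (norm (W s \<xi>))\<^sup>2)"
    by (rule sums_If_finite_set) simp
  moreover have "(\<lambda>s. if s \<in> {..<N} then (norm (W s \<xi>))\<^sup>2 else 0) =
      (\<lambda>s. (norm ((if s < N then W s else (\<lambda>\<xi>. 0)) \<xi>))\<^sup>2)" by auto
  ultimately show "(\<lambda>s. (norm ((if s < N then W s else (\<lambda>\<xi>. 0)) \<xi>))\<^sup>2) sums (norm \<xi>)\<^sup>2"
    by (simp add: Parseval)
qed

text \<open>\<open>U\<^sub>i \<rho>(b\<^sub>s) e\<close> lies in the commutant of \<open>P\<close> and maps \<open>L\<^sup>2(P)\<close> to itself, so on \<open>\<Omega>\<close> it has the same norm as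
  its adjoint. This turns \<open>\<Sum>\<^sub>i \<parallel>U\<^sub>i\<^sup>*\<Omega>\<parallel>\<^sup>2\<close> into \<open>\<Sum>\<^sub>s \<Sum>\<^sub>i \<parallel>U\<^sub>i b\<^sub>s\<Omega>\<parallel>\<^sup>2\<close>, independently of \<open>U\<close>.\<close>

lemma module_isometry_trace:
  assumes U: "module_isometry P \<Omega> UNIV U"
  shows "(\<Sum>i. ennreal (Re (cinner (U i (hadj (U i) \<Omega>)) \<Omega>))) = of_nat N"
proof -
  have Ub: "U i \<in> bounded_ops" and Ur: "U i \<xi> \<in> L2 P \<Omega>" and Uc: "U i \<in> commutant P" for i \<xi>
    using U unfolding module_isometry_def commutant_def by blast+
  have Us: "(\<lambda>i. (norm (U i \<xi>))\<^sup>2) sums (norm \<xi>)\<^sup>2" for \<xi> using U by (simp add: module_isometry_def)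
  have flip: "norm (W s (hadj (U i) \<Omega>)) = norm (U i (b s \<Omega>))" if s: "s < N" for i s
  proof -
    \<comment> \<open>With e as last factor the adjoint starts by projecting from the left onto
      L2(P): at \<Omega> it is \<open>W s (hadj (U i) \<Omega>)\<close>. Thus both vectors lie where
      \<open>commutant_norm_hadj\<close> applies.\<close>
    let ?T = "U i \<circ> (R.rmul (b s) \<circ> e)"
    have rb: "R.rmul (b s) \<in> bounded_ops" by (intro R.rmul_bounded_ops b_vN s)
    have h: "hadj ?T \<Omega> = W s (hadj (U i) \<Omega>)"
      by (simp add: hadj_comp Ub bounded_ops_comp rb e_bo hadj_e W_def R.hadj_rmul b_vN s)
    have T: "?T \<Omega> = U i (b s \<Omega>)" by (simp add: e_\<Omega> R.rmul_\<Omega> b_vN s)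
    have "norm (hadj ?T \<Omega>) = norm (?T \<Omega>)"
    proof (rule P.commutant_norm_hadj)
      show "?T \<in> commutant P" by (intro commutant_comp Uc rmul_commutant_P b_vN s e_commutant)
      show "?T \<Omega> \<in> closure {x \<Omega> |x. x \<in> P}" using Ur by (simp add: L2_P)
      show "hadj ?T \<Omega> \<in> closure {x \<Omega> |x. x \<in> P}" unfolding h using e_range by (simp add: W_def L2_P)
    qed
    thus ?thesis unfolding h T .
  qed
  have "Re (cinner (U i (hadj (U i) \<Omega>)) \<Omega>) = (\<Sum>s<N. (norm (U i (b s \<Omega>)))\<^sup>2)" for i
  proof -
    have "cinner (U i (hadj (U i) \<Omega>)) \<Omega> = of_real ((norm (hadj (U i) \<Omega>))\<^sup>2)"
      unfolding cinner_self[symmetric] by (rule cinner_hadj_right[OF Ub, symmetric])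
    hence "Re (cinner (U i (hadj (U i) \<Omega>)) \<Omega>) = (norm (hadj (U i) \<Omega>))\<^sup>2" by simp
    also have "\<dots> = (\<Sum>s<N. (norm (W s (hadj (U i) \<Omega>)))\<^sup>2)" by (rule Parseval[symmetric])
    also have "\<dots> = (\<Sum>s<N. (norm (U i (b s \<Omega>)))\<^sup>2)" by (rule sum.cong) (simp_all add: flip)
    finally show ?thesis .
  qed
  hence "(\<Sum>i. ennreal (Re (cinner (U i (hadj (U i) \<Omega>)) \<Omega>))) = (\<Sum>i. \<Sum>s<N. ennreal ((norm (U i (b s \<Omega>)))\<^sup>2))"
    by (simp add: sum_ennreal)
  also have "\<dots> = (\<Sum>s<N. \<Sum>i. ennreal ((norm (U i (b s \<Omega>)))\<^sup>2))"
    by (rule suminf_sum) simp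
  \<comment> \<open>U is isometric, so the inner sum is |b_s \<Omega>|^2, whatever U is.\<close>
  also have "\<dots> = (\<Sum>s<N. 1)"
  proof (rule sum.cong[OF refl])
    fix s assume s: "s \<in> {..<N}"
    have "(\<Sum>i. ennreal ((norm (U i (b s \<Omega>)))\<^sup>2)) = ennreal (\<Sum>i. (norm (U i (b s \<Omega>)))\<^sup>2)"
      by (rule suminf_ennreal2[OF zero_le_power2 sums_summable[OF Us]])
    also have "(\<Sum>i. (norm (U i (b s \<Omega>)))\<^sup>2) = (norm (b s \<Omega>))\<^sup>2" by (rule sums_unique[OF Us, symmetric])
    finally show "(\<Sum>i. ennreal ((norm (U i (b s \<Omega>)))\<^sup>2)) = 1" using s by (simp add: norm_b)
  qed
  finally show ?thesis by simp
qed

theorem jones_index_P: "jones_index vN P \<Omega> = of_nat N"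
proof -
  have "L2 vN \<Omega> = UNIV" using R.cyclic by (simp add: L2_def)
  show ?thesis
    unfolding jones_index_def vN_dim_def \<open>L2 vN \<Omega> = UNIV\<close>
  proof (rule the_equality)
    show "\<exists>U. module_isometry P \<Omega> UNIV U \<and> of_nat N = (\<Sum>i. ennreal (Re (cinner (U i (hadj (U i) \<Omega>)) \<Omega>)))"
      by (intro exI conjI, rule module_isometry_W, rule module_isometry_trace[OF module_isometry_W, symmetric])
  qed (use module_isometry_trace in blast)
qed

end

section \<open>Kronecker products and matrix units\<close>

lemma mat_adjoint_dim [simp]: "dim_row (mat_adjoint A) = dim_col A" "dim_col (mat_adjoint A) = dim_row A"
  by (simp_all add: mat_adjoint_def)

lemma mat_adjoint_carrier [intro]: "A \<in> carrier_mat n m \<Longrightarrow> mat_adjoint A \<in> carrier_mat m n"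
  by (metis carrier_matD carrier_matI mat_adjoint_dim)

lemma mat_adjoint_index:
  fixes A :: "complex mat"
  shows "i < dim_col A \<Longrightarrow> j < dim_row A \<Longrightarrow> mat_adjoint A $$ (i, j) = cnj (A $$ (j, i))"
  by (simp add: mat_adjoint_def mat_of_rows_index)

lemma kron_dim [simp]: "dim_row (kron A B) = dim_row A * dim_row B" "dim_col (kron A B) = dim_col A * dim_col B"
  by (simp_all add: kron_def)

lemma kron_carrier [intro]:
  "A \<in> carrier_mat n m \<Longrightarrow> B \<in> carrier_mat k l \<Longrightarrow> kron A B \<in> carrier_mat (n * k) (m * l)"
  by auto

lemma kron_index:
  "i < dim_row A * dim_row B \<Longrightarrow> j < dim_col A * dim_col B \<Longrightarrow>
    kron A B $$ (i, j) = A $$ (i div dim_row B, j div dim_col B) * B $$ (i mod dim_row B, j mod dim_col B)"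
  by (simp add: kron_def)

lemma div_less_of_less_mult: "i < a * b \<Longrightarrow> i div b < (a::nat)"
  by (metis less_mult_imp_div_less)

lemma mod_less_of_less_mult: "i < a * b \<Longrightarrow> i mod b < (b::nat)"
  by (metis mod_less_divisor mult_0_right not_gr_zero not_less_zero)

text \<open>An index of a Kronecker product is a pair of quotient and remainder; all products and
  traces of Kronecker matrices are split through this identity.\<close>

lemma sum_lessThan_mult:
  fixes f :: "nat \<Rightarrow> nat \<Rightarrow> 'c::comm_monoid_add"
  shows "(\<Sum>i<a * b. f (i div b) (i mod b)) = (\<Sum>p<a. \<Sum>s<b. f p s)"
proof -
  have "(\<Sum>i<a * b. f (i div b) (i mod b)) = (\<Sum>p<a. \<Sum>i\<in>{p * b..<p * b + b}. f (i div b) (i mod b))"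
    by (rule sum.nat_group[symmetric])
  also have "\<dots> = (\<Sum>p<a. \<Sum>s<b. f p s)"
  proof (rule sum.cong[OF refl])
    fix p
    have "(\<Sum>i\<in>{p * b..<p * b + b}. f (i div b) (i mod b)) = (\<Sum>s\<in>{0..<b}. f ((s + p * b) div b) ((s + p * b) mod b))"
      using sum.shift_bounds_nat_ivl[of "\<lambda>i. f (i div b) (i mod b)" 0 "p * b" b] by (simp add: add.commute)
    also have "\<dots> = (\<Sum>s<b. f p s)" unfolding lessThan_atLeast0 by (rule sum.cong) auto
    finally show "(\<Sum>i\<in>{p * b..<p * b + b}. f (i div b) (i mod b)) = (\<Sum>s<b. f p s)" .
  qed
  finally show ?thesis .
qed

lemma mult_mat_index:
  assumes "A \<in> carrier_mat n m" "B \<in> carrier_mat m l" "i < n" "j < l"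
  shows "(A * B) $$ (i, j) = (\<Sum>k<m. A $$ (i, k) * B $$ (k, j))"
  using assms by (simp add: scalar_prod_def lessThan_atLeast0)

lemma kron_mult:
  assumes "A \<in> carrier_mat n n" "C \<in> carrier_mat n n" "B \<in> carrier_mat m m" "D \<in> carrier_mat m m"
  shows "kron A B * kron C D = kron (A * C) (B * D)"
proof (rule eq_matI)
  fix i j assume "i < dim_row (kron (A * C) (B * D))" "j < dim_col (kron (A * C) (B * D))"
  hence ij: "i < n * m" "j < n * m" using assms by auto
  note l = div_less_of_less_mult[OF ij(1)] div_less_of_less_mult[OF ij(2)]
    mod_less_of_less_mult[OF ij(1)] mod_less_of_less_mult[OF ij(2)]
  have "(kron A B * kron C D) $$ (i, j) = (\<Sum>k<n * m. kron A B $$ (i, k) * kron C D $$ (k, j))"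
    by (rule mult_mat_index[OF kron_carrier[OF assms(1,3)] kron_carrier[OF assms(2,4)] ij])
  also have "\<dots> = (\<Sum>k<n * m. (\<lambda>p s. (A $$ (i div m, p) * C $$ (p, j div m)) *
      (B $$ (i mod m, s) * D $$ (s, j mod m))) (k div m) (k mod m))"
    by (rule sum.cong[OF refl]) (use assms ij in \<open>simp add: kron_index\<close>)
  also have "\<dots> = (\<Sum>p<n. \<Sum>s<m. (A $$ (i div m, p) * C $$ (p, j div m)) * (B $$ (i mod m, s) * D $$ (s, j mod m)))"
    by (rule sum_lessThan_mult)
  also have "\<dots> = (A * C) $$ (i div m, j div m) * (B * D) $$ (i mod m, j mod m)"
    using mult_mat_index[OF assms(1,2) l(1,2)] mult_mat_index[OF assms(3,4) l(3,4)] by (simp add: sum_product)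
  also have "\<dots> = kron (A * C) (B * D) $$ (i, j)" using assms ij by (subst kron_index) auto
  finally show "(kron A B * kron C D) $$ (i, j) = kron (A * C) (B * D) $$ (i, j)" .
qed (use assms in auto)

lemma kron_one: "kron (1\<^sub>m n) (1\<^sub>m m) = 1\<^sub>m (n * m)"
proof (rule eq_matI)
  fix i j assume "i < dim_row (1\<^sub>m (n * m) :: complex mat)" "j < dim_col (1\<^sub>m (n * m) :: complex mat)"
  hence ij: "i < n * m" "j < n * m" by auto
  have "i = j \<longleftrightarrow> i div m = j div m \<and> i mod m = j mod m" by (metis div_mult_mod_eq)
  thus "kron (1\<^sub>m n) (1\<^sub>m m) $$ (i, j) = 1\<^sub>m (n * m) $$ (i, j)"
    using ij div_less_of_less_mult[OF ij(1)] div_less_of_less_mult[OF ij(2)]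
      mod_less_of_less_mult[OF ij(1)] mod_less_of_less_mult[OF ij(2)] by (subst kron_index) auto
qed auto

lemma kron_assoc: "kron (kron A B) C = kron A (kron B C)"
proof (rule eq_matI)
  fix i j assume "i < dim_row (kron A (kron B C))" "j < dim_col (kron A (kron B C))"
  hence ij: "i < dim_row A * (dim_row B * dim_row C)" "j < dim_col A * (dim_col B * dim_col C)" by auto
  have ij': "i < dim_row A * dim_row B * dim_row C" "j < dim_col A * dim_col B * dim_col C" using ij by (auto simp: mult.assoc)
  \<comment> \<open>Digits in mixed radix: both bracketings read the same three digits of k with
    respect to the sizes b and c.\<close>
  have m: "(k div c) mod b = (k mod (b * c)) div c" "k mod c = k mod (b * c) mod c" "k div c div b = k div (b * c)" for k b c :: nat
  proof -
    show "(k div c) mod b = (k mod (b * c)) div c"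
      using mod_mult2_eq[of k c b] by (cases "c = 0") (simp_all add: mult.commute)
    show "k mod c = k mod (b * c) mod c" by (simp add: mod_mod_cancel)
    show "k div c div b = k div (b * c)" using div_mult2_eq[of k c b] by (simp add: mult.commute)
  qed
  show "kron (kron A B) C $$ (i, j) = kron A (kron B C) $$ (i, j)"
    using ij ij' div_less_of_less_mult[OF ij'(1)] div_less_of_less_mult[OF ij'(2)]
      mod_less_of_less_mult[OF ij(1)] mod_less_of_less_mult[OF ij(2)]
    by (simp add: kron_index m[symmetric])
qed (auto simp: mult.assoc)

lemma kron_one_1: "kron (1\<^sub>m 1) A = A" "kron A (1\<^sub>m 1) = A"
  by (rule eq_matI; simp add: kron_def)+

lemmas kron_one_unit = kron_one_1[unfolded One_nat_def]

lemma kron_add_right: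
  assumes "B \<in> carrier_mat k l" "C \<in> carrier_mat k l"
  shows "kron A (B + C) = kron A B + kron A C"
  by (rule eq_matI)
    (use assms mod_less_of_less_mult in \<open>auto simp: kron_index distrib_left\<close>)

lemma kron_add_left:
  assumes "A \<in> carrier_mat k l" "C \<in> carrier_mat k l"
  shows "kron (A + C) B = kron A B + kron C B"
  by (rule eq_matI)
    (use assms div_less_of_less_mult in \<open>auto simp: kron_index distrib_right\<close>)

lemma kron_smult_right: "kron A (c \<cdot>\<^sub>m B) = c \<cdot>\<^sub>m kron A B"
  by (rule eq_matI) (auto simp: kron_index mod_less_of_less_mult)

lemma kron_smult_left: "kron (c \<cdot>\<^sub>m A) B = c \<cdot>\<^sub>m kron A B"
  by (rule eq_matI) (auto simp: kron_index div_less_of_less_mult)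

lemma kron_adjoint: "mat_adjoint (kron A B) = kron (mat_adjoint A) (mat_adjoint B)"
  by (rule eq_matI)
    (auto simp: kron_index mat_adjoint_index div_less_of_less_mult mod_less_of_less_mult)

section \<open>Matrix units and expansion into them\<close>

definition mat_unit :: "nat \<Rightarrow> nat \<Rightarrow> nat \<Rightarrow> complex mat" where
  "mat_unit n p q = Matrix.mat n n (\<lambda>(i, j). if i = p \<and> j = q then 1 else 0)"

lemma mat_unit_carrier [simp, intro]: "mat_unit n p q \<in> carrier_mat n n"
  by (simp add: mat_unit_def)

lemma mat_unit_dim [simp]: "dim_row (mat_unit n p q) = n" "dim_col (mat_unit n p q) = n"
  by (simp_all add: mat_unit_def)

lemma mat_unit_index [simp]:
  "i < n \<Longrightarrow> j < n \<Longrightarrow> mat_unit n p q $$ (i, j) = (if i = p \<and> j = q then 1 else 0)"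
  by (simp add: mat_unit_def)

lemma mat_unit_mult_left:
  assumes "X \<in> carrier_mat n n" "q < n" "i < n" "j < n"
  shows "(mat_unit n p q * X) $$ (i, j) = (if i = p then X $$ (q, j) else 0)"
proof -
  have "(mat_unit n p q * X) $$ (i, j) = (\<Sum>k<n. mat_unit n p q $$ (i, k) * X $$ (k, j))"
    by (rule mult_mat_index[OF mat_unit_carrier assms(1,3,4)])
  also have "\<dots> = (\<Sum>k<n. if k = q then (if i = p then X $$ (q, j) else 0) else 0)"
    by (rule sum.cong) (use assms in auto)
  finally show ?thesis using assms by simp
qed

lemma mat_unit_mult_right:
  assumes "X \<in> carrier_mat n n" "p < n" "i < n" "j < n"
  shows "(X * mat_unit n p q) $$ (i, j) = (if j = q then X $$ (i, p) else 0)"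
proof -
  have "(X * mat_unit n p q) $$ (i, j) = (\<Sum>k<n. X $$ (i, k) * mat_unit n p q $$ (k, j))"
    by (rule mult_mat_index[OF assms(1) mat_unit_carrier assms(3,4)])
  also have "\<dots> = (\<Sum>k<n. if k = p then (if j = q then X $$ (i, p) else 0) else 0)"
    by (rule sum.cong) (use assms in auto)
  finally show ?thesis using assms by simp
qed

lemma mat_unit_mult:
  assumes "q < n" "r < n"
  shows "mat_unit n p q * mat_unit n r s = (if q = r then mat_unit n p s else 0\<^sub>m n n)"
  by (rule eq_matI) (use assms in \<open>auto simp del: index_mult_mat(1) simp: mat_unit_mult_left\<close>)

lemma mat_unit_adjoint: "mat_adjoint (mat_unit n p q) = mat_unit n q p"
  by (rule eq_matI) (auto simp: mat_adjoint_index)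

lemma kron_mat_unit:
  assumes "i < n * m" "j < n * m"
  shows "kron (mat_unit n (i div m) (j div m)) (mat_unit m (i mod m) (j mod m)) = mat_unit (n * m) i j"
proof (rule eq_matI)
  fix k l assume "k < dim_row (mat_unit (n * m) i j)" "l < dim_col (mat_unit (n * m) i j)"
  hence kl: "k < n * m" "l < n * m" by auto
  have "k = i \<longleftrightarrow> k div m = i div m \<and> k mod m = i mod m" "l = j \<longleftrightarrow> l div m = j div m \<and> l mod m = j mod m"
    by (metis div_mult_mod_eq)+
  thus "kron (mat_unit n (i div m) (j div m)) (mat_unit m (i mod m) (j mod m)) $$ (k, l) = mat_unit (n * m) i j $$ (k, l)"
    using kl div_less_of_less_mult[OF kl(1)] div_less_of_less_mult[OF kl(2)]
      mod_less_of_less_mult[OF kl(1)] mod_less_of_less_mult[OF kl(2)]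
    by (simp add: kron_index)
qed auto

text \<open>Letting the set of positions grow one by one reduces expansions into matrix units to
  induction over a finite set; the same operation also isolates one block of a matrix.\<close>

definition restrict_mat :: "(nat \<times> nat) set \<Rightarrow> complex mat \<Rightarrow> complex mat" where
  "restrict_mat S X = Matrix.mat (dim_row X) (dim_col X) (\<lambda>ij. if ij \<in> S then X $$ ij else 0)"

lemma restrict_mat_carrier [intro]: "X \<in> carrier_mat n m \<Longrightarrow> restrict_mat S X \<in> carrier_mat n m"
  by (auto simp: restrict_mat_def)

lemma restrict_mat_empty: "X \<in> carrier_mat n n \<Longrightarrow> restrict_mat {} X = 0 \<cdot>\<^sub>m X"
  by (rule eq_matI) (auto simp: restrict_mat_def)

lemma restrict_mat_insert:
  assumes "X \<in> carrier_mat n n" "(p, q) \<notin> S"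
  shows "restrict_mat (insert (p, q) S) X = restrict_mat S X + X $$ (p, q) \<cdot>\<^sub>m mat_unit n p q"
  by (rule eq_matI) (use assms in \<open>auto simp: restrict_mat_def\<close>)

lemma restrict_mat_all: "X \<in> carrier_mat n n \<Longrightarrow> restrict_mat ({..<n} \<times> {..<n}) X = X"
  by (rule eq_matI) (auto simp: restrict_mat_def)

lemma carrier_mat_subset_of_mat_units:
  assumes "n > 0" and T: "\<And>X Y. X \<in> T \<Longrightarrow> Y \<in> T \<Longrightarrow> X + Y \<in> T" "\<And>c X. X \<in> T \<Longrightarrow> c \<cdot>\<^sub>m X \<in> T"
    and units: "\<And>p q. p < n \<Longrightarrow> q < n \<Longrightarrow> mat_unit n p q \<in> T"
  shows "carrier_mat n n \<subseteq> T"
proof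
  fix X :: "complex mat" assume X: "X \<in> carrier_mat n n"
  have "restrict_mat S X \<in> T" if "finite S" "S \<subseteq> {..<n} \<times> {..<n}" for S
    using that
  proof (induction S rule: finite_induct)
    case empty
    \<comment> \<open>T is only known to be closed under sums and multiples, so the zero matrix is
      produced from a matrix unit, which exists because n > 0.\<close>
    have "0 \<cdot>\<^sub>m X = 0 \<cdot>\<^sub>m mat_unit n 0 0" using X by (intro eq_matI) auto
    thus ?case using X units[OF assms(1,1)] T(2) by (simp add: restrict_mat_empty)
  next
    case (insert pq S)
    obtain p q where pq: "pq = (p, q)" by (cases pq)
    show ?case using insert unfolding pq by (auto simp: restrict_mat_insert[OF X] intro!: T units)
  qed
  from this[of "{..<n} \<times> {..<n}"] show "X \<in> T" using X by (simp add: restrict_mat_all)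
qed


section \<open>The blocks of \<open>A\<close> and the matrix \<open>r\<close>\<close>

fun block_of :: "nat list \<Rightarrow> nat \<Rightarrow> nat" where
  "block_of [] p = 0"
| "block_of (x # xs) p = (if p < x then 0 else Suc (block_of xs (p - x)))"

lemma block_of_less: "p < sum_list a \<Longrightarrow> block_of a p < length a"
  by (induction a arbitrary: p) auto

lemma diag_block_mat_carrier:
  "length Bs = length a \<Longrightarrow> (\<forall>i<length a. Bs ! i \<in> carrier_mat (a ! i) (a ! i)) \<Longrightarrow>
    diag_block_mat Bs \<in> carrier_mat (sum_list a) (sum_list a)"
proof (induction a arbitrary: Bs)
  case (Cons x a)
  then obtain B Cs where Bs: "Bs = B # Cs" by (cases Bs) auto
  have "B \<in> carrier_mat x x" using Cons.prems(2)[rule_format, of 0] Bs by simp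
  moreover have "diag_block_mat Cs \<in> carrier_mat (sum_list a) (sum_list a)"
    using Cons.prems Bs by (intro Cons.IH) auto
  ultimately show ?case by (auto simp: Bs Let_def)
qed auto

lemma diag_block_mat_off_diagonal:
  "length Bs = length a \<Longrightarrow> (\<forall>i<length a. Bs ! i \<in> carrier_mat (a ! i) (a ! i)) \<Longrightarrow>
    p < sum_list a \<Longrightarrow> q < sum_list a \<Longrightarrow> block_of a p \<noteq> block_of a q \<Longrightarrow> diag_block_mat Bs $$ (p, q) = 0"
proof (induction a arbitrary: Bs p q)
  case (Cons x a)
  then obtain B Cs where Bs: "Bs = B # Cs" by (cases Bs) auto
  have B: "B \<in> carrier_mat x x" using Cons.prems(2)[rule_format, of 0] Bs by simp
  have Cs: "length Cs = length a" "\<forall>i<length a. Cs ! i \<in> carrier_mat (a ! i) (a ! i)"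
    using Cons.prems Bs by auto
  have C: "diag_block_mat Cs \<in> carrier_mat (sum_list a) (sum_list a)" by (rule diag_block_mat_carrier[OF Cs])
  show ?case
    using Cons.prems(3-5) B C Cons.IH[OF Cs, of "p - x" "q - x"]
    by (auto simp: Bs Let_def split: if_splits)
qed simp

lemma algA_carrier: "X \<in> algA a \<Longrightarrow> X \<in> carrier_mat (sum_list a) (sum_list a)"
  unfolding algA_def using diag_block_mat_carrier by blast

lemma algA_off_diagonal:
  "X \<in> algA a \<Longrightarrow> p < sum_list a \<Longrightarrow> q < sum_list a \<Longrightarrow> X $$ (p, q) \<noteq> 0 \<Longrightarrow> block_of a p = block_of a q"
  unfolding algA_def using diag_block_mat_off_diagonal by blast

text \<open>Together with \<open>algA_off_diagonal\<close> this describes A entrywise, so that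
  matrix units inside one block are seen to lie in A. The induction cuts off the first
  block.\<close>

lemma algA_I:
  "X \<in> carrier_mat (sum_list a) (sum_list a) \<Longrightarrow>
    (\<forall>p<sum_list a. \<forall>q<sum_list a. block_of a p \<noteq> block_of a q \<longrightarrow> X $$ (p, q) = 0) \<Longrightarrow> X \<in> algA a"
proof (induction a arbitrary: X)
  case Nil
  hence "X = 0\<^sub>m 0 0" by (intro eq_matI) auto
  thus ?case by (simp add: algA_def)
next
  case (Cons x a)
  let ?n = "sum_list a"
  define B where "B = Matrix.mat x x (\<lambda>(i, j). X $$ (i, j))"
  define C where "C = Matrix.mat ?n ?n (\<lambda>(i, j). X $$ (i + x, j + x))"
  have "C \<in> algA a"
  proof (rule Cons.IH)
    show "\<forall>p<?n. \<forall>q<?n. block_of a p \<noteq> block_of a q \<longrightarrow> C $$ (p, q) = 0"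
    proof (intro allI impI)
      fix p q assume pq: "p < ?n" "q < ?n" "block_of a p \<noteq> block_of a q"
      thus "C $$ (p, q) = 0" using Cons.prems(2)[rule_format, of "p + x" "q + x"] by (simp add: C_def)
    qed
  qed (simp add: C_def)
  then obtain Bs where Bs: "C = diag_block_mat Bs" "length Bs = length a"
    "\<forall>i<length a. Bs ! i \<in> carrier_mat (a ! i) (a ! i)" unfolding algA_def by blast
  have "X = diag_block_mat (B # Bs)"
  proof (rule eq_matI)
    have Cd: "C \<in> carrier_mat ?n ?n" by (simp add: C_def)
    show d: "dim_row X = dim_row (diag_block_mat (B # Bs))" "dim_col X = dim_col (diag_block_mat (B # Bs))"
      using Cons.prems(1) Cd Bs(1) by (auto simp: Let_def B_def)
    fix i j assume "i < dim_row (diag_block_mat (B # Bs))" "j < dim_col (diag_block_mat (B # Bs))"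
    hence ij: "i < x + ?n" "j < x + ?n" using d Cons.prems(1) by auto
    show "X $$ (i, j) = diag_block_mat (B # Bs) $$ (i, j)"
      using ij Cd Cons.prems(2)[rule_format, of i j] unfolding diag_block_mat.simps Let_def Bs(1)[symmetric]
      by (cases "i < x"; cases "j < x") (simp_all add: B_def C_def)
  qed
  moreover have "\<forall>i<length (x # a). (B # Bs) ! i \<in> carrier_mat ((x # a) ! i) ((x # a) ! i)"
    using Bs(3) by (auto simp: nth_Cons B_def split: nat.split)
  ultimately show ?case unfolding algA_def using Bs(2) by (intro CollectI exI[of _ "B # Bs"]) auto
qed

lemma diag_block_mat_scalars:
  "diag_block_mat (map (\<lambda>i. f i \<cdot>\<^sub>m 1\<^sub>m (a ! i)) [0..<length a]) =
    mat_diag (sum_list a) (\<lambda>p. f (block_of a p) :: complex)"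
proof (induction a arbitrary: f)
  case Nil
  show ?case by (intro eq_matI) (auto simp: mat_diag_def)
next
  case (Cons x a)
  have "map (\<lambda>i. f i \<cdot>\<^sub>m 1\<^sub>m ((x # a) ! i)) [0..<length (x # a)] =
      (f 0 \<cdot>\<^sub>m 1\<^sub>m x) # map (\<lambda>i. f (Suc i) \<cdot>\<^sub>m 1\<^sub>m (a ! i)) [0..<length a]"
    by (simp only: length_Cons upt_conv_Cons[OF zero_less_Suc] map_Suc_upt[symmetric] list.map map_map) (simp add: comp_def)
  moreover have "four_block_mat (f 0 \<cdot>\<^sub>m 1\<^sub>m x) (0\<^sub>m x (sum_list a)) (0\<^sub>m (sum_list a) x)
      (mat_diag (sum_list a) (\<lambda>p. f (Suc (block_of a p)))) = mat_diag (sum_list (x # a)) (\<lambda>p. f (block_of (x # a) p))"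
    by (rule eq_matI) (auto simp: mat_diag_def)
  ultimately show ?case using Cons.IH[of "\<lambda>i. f (Suc i)"] by (simp add: Let_def mat_diag_def)
qed

text \<open>The scalar \<gamma> of the construction.\<close>

definition phase :: "nat list \<Rightarrow> complex" where
  "phase a = exp (2 * of_real pi * \<i> / of_nat (length a))"

lemma matw_eq: "matw a = mat_diag (sum_list a) (\<lambda>p. phase a ^ block_of a p)"
  unfolding matw_def phase_def[symmetric] by (rule diag_block_mat_scalars)

lemma norm_phase: "norm (phase a) = 1"
proof -
  have "phase a = cis (2 * pi / length a)" by (simp add: phase_def cis_conv_exp mult_ac)
  thus ?thesis by (simp only: norm_cis)
qed

lemma phase_power_length: "length a > 0 \<Longrightarrow> phase a ^ length a = 1"
  unfolding phase_def exp_of_nat_mult[symmetric] using exp_two_pi_i by (simp add: mult_ac)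

text \<open>Blocks are nonempty, so the truncated subtraction in \<open>corner\<close> is
  exact.\<close>

lemma corner_Cons_Suc:
  assumes "\<forall>m\<in>set a. m \<ge> 1" "i < length a"
  shows "corner (x # a) (Suc i) = x + corner a i"
proof -
  have "sum_list (take (Suc i) a) \<ge> 1"
  proof (cases a)
    case (Cons y ys) thus ?thesis using assms(1) by simp
  qed (use assms in simp)
  thus ?thesis by (simp add: corner_def)
qed

lemma corner_block:
  "\<forall>m\<in>set a. m \<ge> 1 \<Longrightarrow> i < length a \<Longrightarrow> corner a i < sum_list a \<and> block_of a (corner a i) = i"
proof (induction a arbitrary: i)
  case (Cons x a)
  show ?case
  proof (cases i)
    case 0 thus ?thesis using Cons.prems by (auto simp: corner_def)
  next
    case (Suc l)
    thus ?thesis using Cons.IH[of l] Cons.prems corner_Cons_Suc[of a l x] by simp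
  qed
qed simp

lemma matr_carrier: "matr a \<in> carrier_mat (sum_list a) (sum_list a)"
  unfolding matr_def by (intro mult_carrier_mat[of _ _ "sum_list a"]) (simp_all add: mats_def matv_def)

text \<open>Compression by s removes the diagonal ones of v outside the corners, so only the cycle
  is left.\<close>

lemma matr_index:
  assumes pq: "p < sum_list a" "q < sum_list a"
  shows "matr a $$ (p, q) = (if \<exists>i<length a. q = corner a i \<and> p = corner a (Suc i mod length a) then 1 else 0)"
proof -
  let ?n = "sum_list a" and ?f = "\<lambda>p. if \<exists>i<length a. p = corner a i then 1 else 0 :: complex"
  have v: "matv a \<in> carrier_mat ?n ?n" by (simp add: matv_def)
  have "matr a = Matrix.mat ?n ?n (\<lambda>(i, j). ?f i * matv a $$ (i, j)) * mat_diag ?n ?f"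
    unfolding matr_def mats_def mat_diag_mult_left[OF v] ..
  hence r: "matr a $$ (p, q) = ?f p * matv a $$ (p, q) * ?f q"
    using pq by (simp add: mat_diag_mult_right[of _ ?n])
  show ?thesis
  proof (cases "\<exists>i<length a. q = corner a i \<and> p = corner a (Suc i mod length a)")
    case True
    then obtain i where i: "i < length a" "q = corner a i" "p = corner a (Suc i mod length a)" by blast
    have "Suc i mod length a < length a" using i(1) by (intro mod_less_divisor) auto
    hence "?f p = 1" "?f q = 1" using i by auto
    moreover have "matv a $$ (p, q) = 1" using pq True by (simp add: matv_def)
    ultimately show ?thesis using r True by simp
  next
    case False
    hence "matv a $$ (p, q) = 0 \<or> ?f q = 0" using pq by (auto simp: matv_def)
    thus ?thesis using r False by auto
  qed
qed

text \<open>This is w r = \<gamma> r w read entrywise: a nonzero entry of r leads from one block to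
  the next, and the step from the last block to the first is covered by \<gamma>^j = 1.\<close>

lemma matr_phase:
  assumes "p < sum_list a" "q < sum_list a" "\<forall>m\<in>set a. m \<ge> 1" "matr a $$ (p, q) \<noteq> 0"
  shows "phase a ^ block_of a p = phase a * phase a ^ block_of a q"
proof -
  obtain i where i: "i < length a" "q = corner a i" "p = corner a (Suc i mod length a)"
    using assms(4) matr_index[OF assms(1,2)] by (auto split: if_splits)
  have l: "Suc i mod length a < length a" using i(1) by (intro mod_less_divisor) auto
  have "phase a ^ (Suc i mod length a) = phase a ^ Suc i"
  proof (cases "Suc i = length a")
    case True
    thus ?thesis using phase_power_length[of a] i(1) by (metis mod_self power_0 gr_implies_not0 not_gr_zero)
  qed (use i(1) in simp)
  thus ?thesis using corner_block[OF assms(3) i(1)] corner_block[OF assms(3) l] i by simp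
qed

text \<open>Units inside blocks come from A. Cutting r down by two of them gives the unit between
  neighbouring corners, and composing along the chain of corners reaches every pair. T is arbitrary
  because the lemma is used for the matrices that M_k contains at one site.\<close>

lemma full_matrix_algebra:
  fixes T :: "complex mat set"
  assumes a: "\<forall>m\<in>set a. m \<ge> 1" "sum_list a > 0"
    and T: "\<And>X Y. X \<in> T \<Longrightarrow> Y \<in> T \<Longrightarrow> X + Y \<in> T" "\<And>c X. X \<in> T \<Longrightarrow> c \<cdot>\<^sub>m X \<in> T"
      "\<And>X Y. X \<in> T \<Longrightarrow> Y \<in> T \<Longrightarrow> X * Y \<in> T" "\<And>X. X \<in> T \<Longrightarrow> mat_adjoint X \<in> T"
    and gens: "algA a \<subseteq> T" "matr a \<in> T"
  shows "carrier_mat (sum_list a) (sum_list a) \<subseteq> T"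
proof (rule carrier_mat_subset_of_mat_units[OF a(2) T(1,2)])
  let ?n = "sum_list a" and ?E = "mat_unit (sum_list a)"
  have sym: "?E q p \<in> T" if "?E p q \<in> T" for p q using T(4)[OF that] by (simp add: mat_unit_adjoint)
  have trans: "?E p r \<in> T" if "?E p q \<in> T" "?E q r \<in> T" "q < ?n" for p q r
    using T(3)[OF that(1,2)] that(3) by (simp add: mat_unit_mult)
  have block: "?E p q \<in> T" if "p < ?n" "q < ?n" "block_of a p = block_of a q" for p q
    using gens(1) algA_I[of "?E p q" a] that by auto
  note c = corner_block[OF a(1)]
  have step: "?E (corner a (Suc i)) (corner a i) \<in> T" if i: "Suc i < length a" for i
  proof -
    let ?p = "corner a (Suc i)" and ?q = "corner a i"
    have pq: "?p < ?n" "?q < ?n" using c i by auto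
    have "?E ?p ?p * (matr a * ?E ?q ?q) = ?E ?p ?q"
    proof (rule eq_matI)
      fix k l assume "k < dim_row (?E ?p ?q)" "l < dim_col (?E ?p ?q)"
      hence kl: "k < ?n" "l < ?n" by auto
      have "matr a $$ (?p, ?q) = 1" using matr_index[OF pq] i by (auto intro!: exI[of _ i])
      thus "(?E ?p ?p * (matr a * ?E ?q ?q)) $$ (k, l) = ?E ?p ?q $$ (k, l)"
        using mat_unit_mult_left[of "matr a * ?E ?q ?q" ?n ?p k l ?p] mat_unit_mult_right[OF matr_carrier pq(2,1) kl(2)]
          kl pq mult_carrier_mat[OF matr_carrier mat_unit_carrier] by (cases "l = ?q") (simp_all del: index_mult_mat(1))
    qed (use matr_carrier[of a] in auto)
    moreover have "?E ?p ?p * (matr a * ?E ?q ?q) \<in> T" by (intro T(3) gens block pq refl)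
    ultimately show ?thesis by simp
  qed
  have first: "?E (corner a i) (corner a 0) \<in> T" if "i < length a" for i
    using that
  proof (induction i)
    case 0 thus ?case using c by (intro block) auto
  next
    case (Suc i)
    thus ?case using trans[OF step] c[of i] by simp
  qed
  fix p q assume pq: "p < ?n" "q < ?n"
  have conn: "?E x (corner a 0) \<in> T" if "x < ?n" for x
    using trans[OF block first] that c block_of_less[OF that] by simp
  have "length a > 0" using a(2) by (cases a) auto
  thus "?E p q \<in> T" using trans[OF conn[OF pq(1)] sym[OF conn[OF pq(2)]]] c by simp
qed

section \<open>The tower \<open>M\<^sub>k\<close> and the shift\<close>

text \<open>The fold grows at its right end, whereas the shift inserts a factor in front;
  associativity reconciles the two.\<close>

lemma tensor_list_Cons: "tensor_list (X # Xs) = kron X (tensor_list Xs)"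
proof -
  have "foldl kron A Xs = kron A (foldl kron (1\<^sub>m 1) Xs)" for A
  proof (induction Xs arbitrary: A)
    case (Cons Y Ys)
    have "foldl kron A (Y # Ys) = kron (kron A Y) (foldl kron (1\<^sub>m 1) Ys)" using Cons[of "kron A Y"] by simp
    also have "\<dots> = kron A (kron (kron (1\<^sub>m 1) Y) (foldl kron (1\<^sub>m 1) Ys))" by (simp add: kron_assoc kron_one_unit)
    also have "\<dots> = kron A (foldl kron (1\<^sub>m 1) (Y # Ys))" using Cons[of "kron (1\<^sub>m 1) Y"] by simp
    finally show ?case .
  qed (simp add: kron_one_unit)
  from this[of X] show ?thesis by (simp add: tensor_list_def kron_one_unit)
qed

lemma tensor_list_snoc: "tensor_list (Xs @ [X]) = kron (tensor_list Xs) X"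
  by (simp add: tensor_list_def)

lemma tensor_list_Nil: "tensor_list [] = 1\<^sub>m 1"
  by (simp add: tensor_list_def)

lemma tensor_list_carrier: "set Xs \<subseteq> carrier_mat n n \<Longrightarrow> tensor_list Xs \<in> carrier_mat (n ^ length Xs) (n ^ length Xs)"
  by (induction Xs) (auto simp: tensor_list_Nil tensor_list_Cons)

lemma adjoint_one: "mat_adjoint (1\<^sub>m n :: complex mat) = 1\<^sub>m n"
  by (rule eq_matI) (auto simp: mat_adjoint_index)

lemma tensor_list_unitary:
  assumes "\<And>X. X \<in> set Xs \<Longrightarrow> X \<in> carrier_mat n n \<and> mat_adjoint X * X = 1\<^sub>m n"
  shows "mat_adjoint (tensor_list Xs) * tensor_list Xs = 1\<^sub>m (n ^ length Xs)"
  using assms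
proof (induction Xs)
  case (Cons X Xs)
  have X: "X \<in> carrier_mat n n" "mat_adjoint X * X = 1\<^sub>m n" using Cons.prems by auto
  have T: "tensor_list Xs \<in> carrier_mat (n ^ length Xs) (n ^ length Xs)" using Cons.prems by (intro tensor_list_carrier) auto
  have "mat_adjoint (tensor_list Xs) * tensor_list Xs = 1\<^sub>m (n ^ length Xs)" using Cons by auto
  thus ?case
    unfolding tensor_list_Cons kron_adjoint
    by (subst kron_mult[OF mat_adjoint_carrier[OF X(1)] X(1) mat_adjoint_carrier[OF T] T]) (simp add: X kron_one)
qed (simp add: tensor_list_Nil adjoint_one)

lemma ntrace_one: "N > 0 \<Longrightarrow> ntrace (1\<^sub>m N) = 1"
  by (simp add: ntrace_def)

lemma ntrace_mult_commute:
  assumes "X \<in> carrier_mat n n" "Y \<in> carrier_mat n n"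
  shows "ntrace (X * Y) = ntrace (Y * X)"
proof -
  have "(\<Sum>i<n. (X * Y) $$ (i, i)) = (\<Sum>i<n. \<Sum>k<n. X $$ (i, k) * Y $$ (k, i))"
    by (rule sum.cong[OF refl], rule mult_mat_index[OF assms]) auto
  also have "\<dots> = (\<Sum>k<n. \<Sum>i<n. Y $$ (k, i) * X $$ (i, k))" by (subst sum.swap) (simp add: mult.commute)
  also have "\<dots> = (\<Sum>k<n. (Y * X) $$ (k, k))"
    by (rule sum.cong[OF refl], rule mult_mat_index[OF assms(2,1), symmetric]) auto
  finally show ?thesis using assms by (simp add: ntrace_def)
qed

locale block_sizes =
  fixes a :: "nat list"
  assumes a_pos: "\<forall>m\<in>set a. m \<ge> 1" and a_sum: "sum_list a \<ge> 2"
begin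

abbreviation n :: nat where "n \<equiv> sum_list a"

abbreviation level :: "nat \<Rightarrow> complex mat set" where "level k \<equiv> carrier_mat (n ^ k) (n ^ k)"

lemma n_pos: "n > 0" using a_sum by simp

lemma matw_carrier: "matw a \<in> carrier_mat n n"
  by (simp add: matw_eq)

lemma phase_cnj: "phase a ^ k * cnj (phase a ^ k) = 1"
  by (simp only: complex_norm_square[symmetric] norm_power norm_phase) simp

lemma matw_unitary: "mat_adjoint (matw a) * matw a = 1\<^sub>m n"
proof -
  have "mat_adjoint (matw a) = mat_diag n (\<lambda>p. cnj (phase a ^ block_of a p))"
    by (rule eq_matI) (auto simp: matw_eq mat_adjoint_index mat_diag_def)
  thus ?thesis
    by (simp add: matw_eq mat_diag_mult_left[of _ n n])
      (rule eq_matI, use phase_cnj in \<open>auto simp: mat_diag_def mult.commute\<close>)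
qed

text \<open>The diagonal of \<open>\<Prod>\<^bsub>l \<le> k, l \<in> S\<^sub>1\<^esub> w\<^sub>l\<close>. Conjugation by this unitary multiplies \<open>r\<^sub>m\<close>
  by \<open>\<gamma>\<close> if \<open>m \<in> S\<^sub>1\<close> and fixes it otherwise.\<close>

fun weight :: "nat \<Rightarrow> nat \<Rightarrow> complex" where
  "weight 0 s = 1"
| "weight (Suc k) s = weight k (s div n) * (if Suc k \<in> S1 then phase a ^ block_of a (s mod n) else 1)"

lemma norm_weight: "norm (weight k s) = 1"
  by (induction k arbitrary: s) (auto simp: norm_mult norm_power norm_phase)

lemma weight_cnj: "weight k s * cnj (weight k s) = 1"
  by (simp add: complex_norm_square[symmetric] norm_weight)

text \<open>For the diagonal unitary W with entries \<open>weight k\<close> this says W X W* = c X,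
  read on the nonzero entries of X.\<close>

definition homogeneous :: "nat \<Rightarrow> complex \<Rightarrow> complex mat \<Rightarrow> bool" where
  "homogeneous k c X \<longleftrightarrow> X \<in> level k \<and>
     (\<forall>s<n ^ k. \<forall>t<n ^ k. X $$ (s, t) \<noteq> 0 \<longrightarrow> weight k s = c * weight k t)"

text \<open>The weight of a product index is that of its first part, times a phase from the last
  site only if \<open>Suc k \<in> S1\<close>; hence the degrees multiply.\<close>

lemma homogeneous_kron:
  assumes X: "homogeneous k c X" and Y: "Y \<in> carrier_mat n n"
    and c': "\<And>p q. p < n \<Longrightarrow> q < n \<Longrightarrow> Y $$ (p, q) \<noteq> 0 \<Longrightarrow> Suc k \<in> S1 \<Longrightarrow>
      phase a ^ block_of a p = c' * phase a ^ block_of a q"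
    and c'1: "Suc k \<notin> S1 \<Longrightarrow> c' = 1"
  shows "homogeneous (Suc k) (c * c') (kron X Y)"
  unfolding homogeneous_def
proof (intro conjI allI impI)
  have Xc: "X \<in> level k" using X by (simp add: homogeneous_def)
  show "kron X Y \<in> level (Suc k)" using kron_carrier[OF Xc Y] by (simp add: mult.commute)
  fix s t assume st: "s < n ^ Suc k" "t < n ^ Suc k" and nz: "kron X Y $$ (s, t) \<noteq> 0"
  have st': "s < n ^ k * n" "t < n ^ k * n" using st by (simp_all add: mult.commute)
  have "X $$ (s div n, t div n) \<noteq> 0" "Y $$ (s mod n, t mod n) \<noteq> 0"
    using nz st' Xc Y by (auto simp: kron_index)
  hence "weight k (s div n) = c * weight k (t div n)"
    "Suc k \<in> S1 \<Longrightarrow> phase a ^ block_of a (s mod n) = c' * phase a ^ block_of a (t mod n)"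
    using X c' div_less_of_less_mult[OF st'(1)] div_less_of_less_mult[OF st'(2)]
      mod_less_of_less_mult[OF st'(1)] mod_less_of_less_mult[OF st'(2)]
    by (auto simp: homogeneous_def)
  thus "weight (Suc k) s = c * c' * weight (Suc k) t" using c'1 by (auto simp: mult_ac)
qed

lemma homogeneous_one: "homogeneous k 1 (1\<^sub>m (n ^ k))"
  by (auto simp: homogeneous_def)

lemma homogeneous_tensor_list:
  assumes "\<And>X. X \<in> set Xs \<Longrightarrow> X \<in> carrier_mat n n \<and> (\<forall>p<n. \<forall>q<n. X $$ (p, q) \<noteq> 0 \<longrightarrow> p = q)"
  shows "homogeneous (length Xs) 1 (tensor_list Xs)"
  using assms
proof (induction Xs rule: rev_induct)
  case Nil thus ?case using homogeneous_one[of 0] by (simp add: tensor_list_Nil)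
next
  case (snoc X Xs)
  have "homogeneous (Suc (length Xs)) (1 * 1) (kron (tensor_list Xs) X)"
    by (rule homogeneous_kron) (use snoc in auto)
  thus ?case by (simp add: tensor_list_snoc)
qed

lemma embed_Suc: "m \<le> k \<Longrightarrow> kron (embed a m k X) (1\<^sub>m n) = embed a m (Suc k) X"
  by (simp add: embed_def kron_assoc kron_one Suc_diff_le mult.commute)

lemma embed_self: "embed a k k X = X"
  by (simp add: embed_def kron_one_unit)

lemma homogeneous_embed:
  assumes "homogeneous m c X" "m \<le> k"
  shows "homogeneous k c (embed a m k X)"
  using assms(2)
proof (induction k rule: dec_induct)
  case base thus ?case using assms(1) by (simp add: embed_self)
next
  case (step k)
  have "homogeneous (Suc k) (c * 1) (kron (embed a m k X) (1\<^sub>m n))"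
    by (rule homogeneous_kron[OF step.IH]) (auto split: if_splits)
  thus ?case using step.hyps by (simp add: embed_Suc)
qed

text \<open>The endomorphism on \<open>M\<^sub>k\<close>: conjugation of \<open>1 \<otimes> X\<close> by \<open>\<Sum>\<^sub>i q\<^sub>i \<otimes> W\<^sup>i\<close>, where \<open>q\<^sub>i\<close> is the unit of the
  \<open>i\<close>-th block of \<open>A\<close> and \<open>W\<close> is the diagonal unitary with entries \<open>weight k\<close>.\<close>

definition shift_mat :: "nat \<Rightarrow> complex mat \<Rightarrow> complex mat" where
  "shift_mat k X = Matrix.mat (n * n ^ k) (n * n ^ k) (\<lambda>(i, j).
     if i div n ^ k = j div n ^ k
     then (weight k (i mod n ^ k) * cnj (weight k (j mod n ^ k))) ^ block_of a (i div n ^ k) *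
       X $$ (i mod n ^ k, j mod n ^ k)
     else 0)"

lemma shift_mat_carrier [simp]: "shift_mat k X \<in> level (Suc k)"
  by (simp add: shift_mat_def)

lemma shift_mat_dim [simp]: "dim_row (shift_mat k X) = n * n ^ k" "dim_col (shift_mat k X) = n * n ^ k"
  by (simp_all add: shift_mat_def)

lemma shift_mat_index:
  "i < n * n ^ k \<Longrightarrow> j < n * n ^ k \<Longrightarrow> shift_mat k X $$ (i, j) =
     (if i div n ^ k = j div n ^ k
     then (weight k (i mod n ^ k) * cnj (weight k (j mod n ^ k))) ^ block_of a (i div n ^ k) *
       X $$ (i mod n ^ k, j mod n ^ k)
     else 0)"
  by (simp add: shift_mat_def)

text \<open>If W X W* = c X, then conjugation by W^i multiplies X by c^i on the i-th block, so the
  result is an elementary tensor. This makes the map computable on the generators.\<close>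

lemma shift_mat_homogeneous:
  assumes "homogeneous k c X"
  shows "shift_mat k X = kron (mat_diag n (\<lambda>p. c ^ block_of a p)) X"
proof (rule eq_matI)
  have X: "X \<in> level k" using assms by (simp add: homogeneous_def)
  thus "dim_row (shift_mat k X) = dim_row (kron (mat_diag n (\<lambda>p. c ^ block_of a p)) X)"
    "dim_col (shift_mat k X) = dim_col (kron (mat_diag n (\<lambda>p. c ^ block_of a p)) X)" by (auto simp: mat_diag_def)
  fix i j assume "i < dim_row (kron (mat_diag n (\<lambda>p. c ^ block_of a p)) X)" "j < dim_col (kron (mat_diag n (\<lambda>p. c ^ block_of a p)) X)"
  hence ij: "i < n * n ^ k" "j < n * n ^ k" using X by (auto simp: mat_diag_def)
  note l = div_less_of_less_mult[OF ij(1)] div_less_of_less_mult[OF ij(2)]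
    mod_less_of_less_mult[OF ij(1)] mod_less_of_less_mult[OF ij(2)]
  have "weight k (i mod n ^ k) * cnj (weight k (j mod n ^ k)) = c" if "X $$ (i mod n ^ k, j mod n ^ k) \<noteq> 0"
  proof -
    have "weight k (i mod n ^ k) = c * weight k (j mod n ^ k)" using assms that l by (simp add: homogeneous_def)
    thus ?thesis using weight_cnj by (simp add: mult.assoc)
  qed
  thus "shift_mat k X $$ (i, j) = kron (mat_diag n (\<lambda>p. c ^ block_of a p)) X $$ (i, j)"
    using ij X l by (auto simp: shift_mat_index kron_index mat_diag_def)
qed

lemma shift_mat_add:
  assumes "X \<in> level k" "Y \<in> level k"
  shows "shift_mat k (X + Y) = shift_mat k X + shift_mat k Y"
  by (rule eq_matI) (use assms mod_less_of_less_mult in \<open>auto simp: shift_mat_index distrib_left\<close>)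

lemma shift_mat_smult:
  assumes "X \<in> level k"
  shows "shift_mat k (c \<cdot>\<^sub>m X) = c \<cdot>\<^sub>m shift_mat k X"
  by (rule eq_matI) (use assms mod_less_of_less_mult in \<open>auto simp: shift_mat_index\<close>)

lemma shift_mat_adjoint:
  assumes "X \<in> level k"
  shows "shift_mat k (mat_adjoint X) = mat_adjoint (shift_mat k X)"
  by (rule eq_matI)
    (use assms mod_less_of_less_mult in \<open>auto simp: shift_mat_index mat_adjoint_index mult.commute\<close>)

lemma shift_mat_mult:
  assumes X: "X \<in> level k" and Y: "Y \<in> level k"
  shows "shift_mat k (X * Y) = shift_mat k X * shift_mat k Y"
proof (rule eq_matI)
  fix i j assume "i < dim_row (shift_mat k X * shift_mat k Y)" "j < dim_col (shift_mat k X * shift_mat k Y)"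
  hence ij: "i < n * n ^ k" "j < n * n ^ k" by auto
  let ?K = "n ^ k"
  let ?w = "\<lambda>s t p. (weight k s * cnj (weight k t)) ^ block_of a p"
  note l = div_less_of_less_mult[OF ij(1)] div_less_of_less_mult[OF ij(2)]
    mod_less_of_less_mult[OF ij(1)] mod_less_of_less_mult[OF ij(2)]
  \<comment> \<open>The phases form a cocycle: those at the intermediate index u cancel, while the
    block of the first site stays the same.\<close>
  have w: "?w s u p * ?w u t p = ?w s t p" for s t u p
  proof -
    have "(weight k s * cnj (weight k u)) * (weight k u * cnj (weight k t)) = weight k s * cnj (weight k t)"
      using weight_cnj[of k u] by (simp add: mult_ac)
    thus ?thesis by (metis power_mult_distrib)
  qed
  have "(shift_mat k X * shift_mat k Y) $$ (i, j) =
      (\<Sum>m<n * ?K. shift_mat k X $$ (i, m) * shift_mat k Y $$ (m, j))"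
    by (rule mult_mat_index) (use ij in \<open>auto simp: shift_mat_def\<close>)
  also have "\<dots> = (\<Sum>m<n * ?K. (\<lambda>p u. if p = i div ?K \<and> i div ?K = j div ?K then
      ?w (i mod ?K) (j mod ?K) (i div ?K) * (X $$ (i mod ?K, u) * Y $$ (u, j mod ?K)) else 0) (m div ?K) (m mod ?K))"
  proof (rule sum.cong[OF refl])
    fix m assume "m \<in> {..<n * ?K}"
    hence m: "m < n * ?K" by simp
    have "(?w s u p * x) * (?w u t p * z) = ?w s t p * (x * z)" for s u p t x z
      using w[of s u p t] by (metis mult.assoc mult.left_commute)
    thus "shift_mat k X $$ (i, m) * shift_mat k Y $$ (m, j) = (\<lambda>p u. if p = i div ?K \<and> i div ?K = j div ?K then
      ?w (i mod ?K) (j mod ?K) (i div ?K) * (X $$ (i mod ?K, u) * Y $$ (u, j mod ?K)) else 0) (m div ?K) (m mod ?K)"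
      unfolding shift_mat_index[OF ij(1) m] shift_mat_index[OF m ij(2)] by simp
  qed
  also have "\<dots> = (\<Sum>p<n. \<Sum>u<?K. if p = i div ?K \<and> i div ?K = j div ?K then
      ?w (i mod ?K) (j mod ?K) (i div ?K) * (X $$ (i mod ?K, u) * Y $$ (u, j mod ?K)) else 0)"
    by (rule sum_lessThan_mult)
  also have "\<dots> = (\<Sum>p<n. if p = i div ?K then (if i div ?K = j div ?K then
      ?w (i mod ?K) (j mod ?K) (i div ?K) * (\<Sum>u<?K. X $$ (i mod ?K, u) * Y $$ (u, j mod ?K)) else 0) else 0)"
    by (rule sum.cong[OF refl]) (simp add: sum_distrib_left)
  also have "\<dots> = shift_mat k (X * Y) $$ (i, j)"
    using ij l mult_mat_index[OF X Y l(3,4)] by (simp add: shift_mat_index del: index_mult_mat(1))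
  finally show "shift_mat k (X * Y) $$ (i, j) = (shift_mat k X * shift_mat k Y) $$ (i, j)" by simp
qed auto

lemma shift_mat_kron_index:
  assumes X: "X \<in> level k" and Y: "Y \<in> carrier_mat n n" and ij: "i < n * n ^ k" "j < n * n ^ k"
  shows "(shift_mat k X * kron Y (1\<^sub>m (n ^ k))) $$ (i, j) =
    (weight k (i mod n ^ k) * cnj (weight k (j mod n ^ k))) ^ block_of a (i div n ^ k) *
      X $$ (i mod n ^ k, j mod n ^ k) * Y $$ (i div n ^ k, j div n ^ k)"
proof -
  let ?K = "n ^ k"
  let ?w = "(weight k (i mod ?K) * cnj (weight k (j mod ?K))) ^ block_of a (i div ?K)"
  note l = div_less_of_less_mult[OF ij(1)] div_less_of_less_mult[OF ij(2)]
    mod_less_of_less_mult[OF ij(1)] mod_less_of_less_mult[OF ij(2)]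
  have "(shift_mat k X * kron Y (1\<^sub>m ?K)) $$ (i, j) =
      (\<Sum>m<n * ?K. shift_mat k X $$ (i, m) * kron Y (1\<^sub>m ?K) $$ (m, j))"
    by (rule mult_mat_index[OF _ kron_carrier[OF Y one_carrier_mat] ij]) (simp add: shift_mat_def)
  also have "\<dots> = (\<Sum>m<n * ?K. (\<lambda>p u. if u = j mod ?K then (if p = i div ?K then
      ?w * X $$ (i mod ?K, j mod ?K) * Y $$ (i div ?K, j div ?K) else 0) else 0) (m div ?K) (m mod ?K))"
  proof (rule sum.cong[OF refl])
    fix m assume m: "m \<in> {..<n * ?K}"
    thus "shift_mat k X $$ (i, m) * kron Y (1\<^sub>m ?K) $$ (m, j) = (\<lambda>p u. if u = j mod ?K then (if p = i div ?K then
      ?w * X $$ (i mod ?K, j mod ?K) * Y $$ (i div ?K, j div ?K) else 0) else 0) (m div ?K) (m mod ?K)"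
      using ij Y l mod_less_of_less_mult[of m n ?K] by (auto simp: shift_mat_index kron_index)
  qed
  also have "\<dots> = (\<Sum>p<n. \<Sum>u<?K. if u = j mod ?K then (if p = i div ?K then
      ?w * X $$ (i mod ?K, j mod ?K) * Y $$ (i div ?K, j div ?K) else 0) else 0)"
    by (rule sum_lessThan_mult)
  also have "\<dots> = ?w * X $$ (i mod ?K, j mod ?K) * Y $$ (i div ?K, j div ?K)"
    using l by simp
  finally show ?thesis .
qed

text \<open>The weights cancel on the diagonal, so the trace is that of Y (x) X. Orthogonality of
  the matrix units of M_1 over the range rests on this.\<close>

lemma ntrace_shift_mat_kron:
  assumes X: "X \<in> level k" and Y: "Y \<in> carrier_mat n n"
  shows "ntrace (shift_mat k X * kron Y (1\<^sub>m (n ^ k))) = ntrace X * ntrace Y"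
proof -
  let ?K = "n ^ k"
  have "(\<Sum>i<n * ?K. (shift_mat k X * kron Y (1\<^sub>m ?K)) $$ (i, i)) =
      (\<Sum>i<n * ?K. (\<lambda>p s. X $$ (s, s) * Y $$ (p, p)) (i div ?K) (i mod ?K))"
    by (rule sum.cong[OF refl]) (use shift_mat_kron_index[OF X Y] weight_cnj in \<open>simp del: index_mult_mat(1)\<close>)
  also have "\<dots> = (\<Sum>p<n. \<Sum>s<?K. X $$ (s, s) * Y $$ (p, p))" by (rule sum_lessThan_mult)
  also have "\<dots> = (\<Sum>s<?K. X $$ (s, s)) * (\<Sum>p<n. Y $$ (p, p))"
    by (subst sum.swap) (simp add: sum_product)
  finally show ?thesis using X Y by (simp add: ntrace_def del: index_mult_mat(1))
qed

lemma ntrace_shift_mat: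
  assumes X: "X \<in> level k"
  shows "ntrace (shift_mat k X) = ntrace X"
proof -
  have "ntrace (1\<^sub>m n) = 1" by (rule ntrace_one[OF n_pos])
  moreover have "shift_mat k X * kron (1\<^sub>m n) (1\<^sub>m (n ^ k)) = shift_mat k X"
    unfolding kron_one by (rule right_mult_one_mat[where nr = "n * n ^ k"]) (simp add: shift_mat_def)
  ultimately show ?thesis using ntrace_shift_mat_kron[OF X one_carrier_mat] by simp
qed

subsection \<open>The generated algebras are full matrix algebras\<close>

definition wlist :: "nat \<Rightarrow> complex mat list" where
  "wlist m = map (\<lambda>l. if m - l \<in> S1 then matw a else 1\<^sub>m n) [1..<m]"

lemma rgen_eq: "rgen a m = kron (tensor_list (wlist m)) (matr a)"
  by (simp add: rgen_def wlist_def tensor_list_snoc)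

lemma wlist_length: "length (wlist m) = m - 1"
  by (simp add: wlist_def)

lemma wlist_unitary: "X \<in> set (wlist m) \<Longrightarrow> X \<in> carrier_mat n n \<and> mat_adjoint X * X = 1\<^sub>m n"
  using matw_carrier matw_unitary by (auto simp: wlist_def adjoint_one)

lemma tensor_wlist_carrier: "tensor_list (wlist m) \<in> level (m - 1)"
  using tensor_list_carrier[of "wlist m" n] wlist_unitary by (auto simp: wlist_length)

lemma rgen_carrier: "m \<ge> 1 \<Longrightarrow> rgen a m \<in> level m"
  using kron_carrier[OF tensor_wlist_carrier matr_carrier, of m] power_Suc2[of n "m - 1"] by (simp add: rgen_eq)

lemma at_site_carrier: "m \<ge> 1 \<Longrightarrow> X \<in> algA a \<Longrightarrow> at_site a m X \<in> level m"
  using kron_carrier[OF one_carrier_mat algA_carrier, of X a "n ^ (m - 1)"] power_Suc2[of n "m - 1"]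
  by (simp add: at_site_def)

lemma embed_carrier: "m \<le> k \<Longrightarrow> X \<in> level m \<Longrightarrow> embed a m k X \<in> level k"
  using kron_carrier[of X "n ^ m" "n ^ m" "1\<^sub>m (n ^ (k - m))", OF _ one_carrier_mat]
  by (simp add: embed_def power_add[symmetric])

lemma algM_carrier: "X \<in> algM a k \<Longrightarrow> X \<in> level k"
  unfolding algM_def
proof (induction rule: star_algebra.induct)
  case (gen X)
  then obtain m where "m \<in> {1..k}"
    "X \<in> insert (embed a m k (rgen a m)) ((\<lambda>X. embed a m k (at_site a m X)) ` algA a)" by blast
  hence m: "m \<in> {1..k}"
    "X = embed a m k (rgen a m) \<or> (\<exists>Y\<in>algA a. X = embed a m k (at_site a m Y))" by auto
  thus ?case using embed_carrier rgen_carrier at_site_carrier by auto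
qed auto

lemma algM_closed:
  shows algM_add: "X \<in> algM a k \<Longrightarrow> Y \<in> algM a k \<Longrightarrow> X + Y \<in> algM a k"
    and algM_smult: "X \<in> algM a k \<Longrightarrow> c \<cdot>\<^sub>m X \<in> algM a k"
    and algM_mult: "X \<in> algM a k \<Longrightarrow> Y \<in> algM a k \<Longrightarrow> X * Y \<in> algM a k"
    and algM_adjoint: "X \<in> algM a k \<Longrightarrow> mat_adjoint X \<in> algM a k"
  unfolding algM_def by (rule star_algebra.intros; assumption)+

lemma algM_rgen: "1 \<le> m \<Longrightarrow> m \<le> k \<Longrightarrow> embed a m k (rgen a m) \<in> algM a k"
  unfolding algM_def by (intro star_algebra.gen) auto

lemma algM_at_site: "1 \<le> m \<Longrightarrow> m \<le> k \<Longrightarrow> X \<in> algA a \<Longrightarrow> embed a m k (at_site a m X) \<in> algM a k"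
  unfolding algM_def by (intro star_algebra.gen) auto

lemma algM_kron_one:
  assumes "X \<in> algM a k"
  shows "kron X (1\<^sub>m n) \<in> algM a (Suc k)"
  using assms[unfolded algM_def]
proof (induction rule: star_algebra.induct)
  case (gen X)
  then obtain m where "m \<in> {1..k}"
    "X \<in> insert (embed a m k (rgen a m)) ((\<lambda>X. embed a m k (at_site a m X)) ` algA a)" by blast
  hence m: "m \<in> {1..k}"
    "X = embed a m k (rgen a m) \<or> (\<exists>Y\<in>algA a. X = embed a m k (at_site a m Y))" by auto
  thus ?case using algM_rgen[of m "Suc k"] algM_at_site[of m "Suc k"] by (auto simp: embed_Suc)
next
  case (add X Y)
  have "X \<in> level k" "Y \<in> level k" using add.hyps algM_carrier by (auto simp: algM_def)
  thus ?case using algM_add[OF add.IH] by (simp add: kron_add_left)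
next
  case (smult X c) thus ?case by (simp add: kron_smult_left algM_smult)
next
  case (mult X Y)
  have "X \<in> level k" "Y \<in> level k" using mult.hyps algM_carrier by (auto simp: algM_def)
  thus ?case using algM_mult[OF mult.IH] by (simp add: kron_mult[of _ "n ^ k" _ _ n])
next
  case (adjoint X)
  thus ?case using algM_adjoint[OF adjoint.IH] by (simp add: kron_adjoint adjoint_one)
qed

text \<open>Fullness of the first k - 1 sites puts the inverse of the w-part of r_k into M_k.
  Multiplying r_k by it isolates 1 (x) r, and A and r generate everything at the last site.\<close>

lemma algM_last_site:
  assumes k: "k \<ge> 1" and full: "level (k - 1) \<subseteq> {X. kron X (1\<^sub>m n) \<in> algM a k}"
  shows "carrier_mat n n \<subseteq> {Y. kron (1\<^sub>m (n ^ (k - 1))) Y \<in> algM a k}"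
proof -
  let ?one = "1\<^sub>m (n ^ (k - 1)) :: complex mat"
  let ?T = "{Y \<in> carrier_mat n n. kron ?one Y \<in> algM a k}"
  have "carrier_mat n n \<subseteq> ?T"
  proof (rule full_matrix_algebra[OF a_pos n_pos])
    fix X Y assume "X \<in> ?T" "Y \<in> ?T"
    thus "X + Y \<in> ?T" "X * Y \<in> ?T"
      using algM_add[of "kron ?one X" k "kron ?one Y"] algM_mult[of "kron ?one X" k "kron ?one Y"]
      by (auto simp: kron_add_right[of _ n n] kron_mult[of _ "n ^ (k - 1)" _ _ n])
  next
    fix X c assume "X \<in> ?T"
    thus "c \<cdot>\<^sub>m X \<in> ?T" by (auto simp: kron_smult_right algM_smult)
  next
    fix X assume "X \<in> ?T"
    thus "mat_adjoint X \<in> ?T" using algM_adjoint[of "kron ?one X" k] by (auto simp: kron_adjoint adjoint_one)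
  next
    show "algA a \<subseteq> ?T"
      using algM_at_site[OF k order_refl] algA_carrier by (auto simp: embed_self at_site_def)
    let ?W = "tensor_list (wlist k)"
    have W: "?W \<in> level (k - 1)" by (rule tensor_wlist_carrier)
    have "kron (mat_adjoint ?W) (1\<^sub>m n) * rgen a k \<in> algM a k"
      using full mat_adjoint_carrier[OF W] algM_rgen[OF k order_refl] by (intro algM_mult) (auto simp: embed_self)
    moreover have "kron (mat_adjoint ?W) (1\<^sub>m n) * rgen a k = kron ?one (matr a)"
      using tensor_list_unitary[OF wlist_unitary] matr_carrier[of a]
      by (simp add: rgen_eq kron_mult[OF mat_adjoint_carrier[OF W] W one_carrier_mat matr_carrier] wlist_length)
    ultimately show "matr a \<in> ?T" using matr_carrier by simp
  qed
  thus ?thesis by blast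
qed

lemma algM_full:
  assumes "k \<ge> 1"
  shows "algM a k = level k"
proof
  show "algM a k \<subseteq> level k" using algM_carrier by blast
  have step: "level k \<subseteq> algM a k" if k: "k \<ge> 1" and full: "level (k - 1) \<subseteq> {X. kron X (1\<^sub>m n) \<in> algM a k}" for k
  proof -
    have nk: "n ^ k = n ^ (k - 1) * n" using power_Suc2[of n "k - 1"] k by simp
    show ?thesis
    proof (rule carrier_mat_subset_of_mat_units[OF _ algM_add algM_smult])
      fix p q assume "p < n ^ k" "q < n ^ k"
      hence pq: "p < n ^ (k - 1) * n" "q < n ^ (k - 1) * n" by (simp_all add: nk)
      \<comment> \<open>A matrix unit of level k is the product of one on the first k - 1 sites and
        one on the last site.\<close>
      let ?X = "mat_unit (n ^ (k - 1)) (p div n) (q div n)" and ?Y = "mat_unit n (p mod n) (q mod n)"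
      have "kron ?X (1\<^sub>m n) * kron (1\<^sub>m (n ^ (k - 1))) ?Y = mat_unit (n ^ k) p q"
        unfolding nk kron_mat_unit[OF pq, symmetric]
        by (subst kron_mult[of _ "n ^ (k - 1)" _ _ n]) (auto simp: right_mult_one_mat[OF mat_unit_carrier] left_mult_one_mat[OF mat_unit_carrier])
      moreover have "kron ?X (1\<^sub>m n) \<in> algM a k" using full mat_unit_carrier by blast
      moreover have "kron (1\<^sub>m (n ^ (k - 1))) ?Y \<in> algM a k" using algM_last_site[OF k full] mat_unit_carrier by blast
      ultimately show "mat_unit (n ^ k) p q \<in> algM a k" using algM_mult by metis
    qed (use n_pos in simp)
  qed
  show "level k \<subseteq> algM a k"
    using assms
  proof (induction k rule: dec_induct)
    case base
    show ?case
    proof (rule step)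
      \<comment> \<open>For k = 1 there is no earlier site: these matrices are 1 by 1, that is,
        scalars.\<close>
      show "level (1 - 1) \<subseteq> {X. kron X (1\<^sub>m n) \<in> algM a 1}"
      proof
        fix X :: "complex mat" assume X: "X \<in> level (1 - 1)"
        have "X = X $$ (0, 0) \<cdot>\<^sub>m 1\<^sub>m 1" by (rule eq_matI) (use X in auto)
        hence "kron X (1\<^sub>m n) = X $$ (0, 0) \<cdot>\<^sub>m 1\<^sub>m n" by (metis kron_smult_left kron_one_1(1))
        moreover have "1\<^sub>m n \<in> algA a" by (rule algA_I) auto
        hence "1\<^sub>m n \<in> algM a 1" using algM_at_site[of 1 1 "1\<^sub>m n"] by (simp add: embed_self at_site_def kron_one_unit)
        ultimately show "X \<in> {X. kron X (1\<^sub>m n) \<in> algM a 1}" by (simp add: algM_smult)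
      qed
    qed simp
  next
    case (step k)
    show ?case by (rule \<open>\<And>k. 1 \<le> k \<Longrightarrow> _ \<Longrightarrow> _\<close>) (use step.IH algM_kron_one in auto)
  qed
qed

text \<open>Block diagonal matrices commute with w, so their degree is 1 and the new first factor is
  the identity.\<close>

lemma shift_mat_at_site:
  assumes m: "1 \<le> m" "m \<le> k" and X: "X \<in> algA a"
  shows "shift_mat k (embed a m k (at_site a m X)) = embed a (Suc m) (Suc k) (at_site a (Suc m) X)"
proof -
  have "homogeneous (Suc (m - 1)) (1 * 1) (kron (1\<^sub>m (n ^ (m - 1))) X)"
    by (rule homogeneous_kron[OF homogeneous_one algA_carrier[OF X]]) (use algA_off_diagonal[OF X] in auto)
  hence "homogeneous m 1 (at_site a m X)" using m by (simp add: at_site_def)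
  from shift_mat_homogeneous[OF homogeneous_embed[OF this m(2)]]
  have "shift_mat k (embed a m k (at_site a m X)) = kron (mat_diag n (\<lambda>p. 1)) (embed a m k (at_site a m X))"
    by simp
  also have "mat_diag n (\<lambda>p. 1) = (1\<^sub>m n :: complex mat)" by (rule eq_matI) (auto simp: mat_diag_def)
  also have "kron (1\<^sub>m n) (embed a m k (at_site a m X)) = embed a (Suc m) (Suc k) (at_site a (Suc m) X)"
  proof -
    have "1\<^sub>m (n ^ m) = kron (1\<^sub>m n) (1\<^sub>m (n ^ (m - 1)))" using m power_Suc[of n "m - 1"] by (simp add: kron_one)
    thus ?thesis by (simp add: embed_def at_site_def kron_assoc)
  qed
  finally show ?thesis .
qed

text \<open>The w-part of r_m is diagonal, so W sees only its factor r, and the degree is \<gamma>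
  or 1 according to whether m is in S1. The new first factor is then w or 1, just as r_{m+1}
  prescribes at site 1, because (m + 1) - 1 = m.\<close>

lemma shift_mat_rgen:
  assumes m: "1 \<le> m" "m \<le> k"
  shows "shift_mat k (embed a m k (rgen a m)) = embed a (Suc m) (Suc k) (rgen a (Suc m))"
proof -
  define c where "c = (if m \<in> S1 then phase a else 1)"
  have "homogeneous (length (wlist m)) 1 (tensor_list (wlist m))"
    by (rule homogeneous_tensor_list) (auto simp: wlist_def matw_eq mat_diag_def split: if_splits)
  hence "homogeneous (Suc (m - 1)) (1 * c) (kron (tensor_list (wlist m)) (matr a))"
    using matr_phase[OF _ _ a_pos] m by (intro homogeneous_kron matr_carrier) (auto simp: c_def wlist_length)
  hence "homogeneous m c (rgen a m)" using m by (simp add: rgen_eq)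
  from shift_mat_homogeneous[OF homogeneous_embed[OF this m(2)]]
  have "shift_mat k (embed a m k (rgen a m)) = kron (mat_diag n (\<lambda>p. c ^ block_of a p)) (embed a m k (rgen a m))" .
  also have "mat_diag n (\<lambda>p. c ^ block_of a p) = (if m \<in> S1 then matw a else 1\<^sub>m n)"
    by (rule eq_matI) (auto simp: c_def matw_eq mat_diag_def)
  also have "kron (if m \<in> S1 then matw a else 1\<^sub>m n) (embed a m k (rgen a m)) = embed a (Suc m) (Suc k) (rgen a (Suc m))"
  proof -
    have "[1..<Suc m] = 1 # map Suc [1..<m]" using m by (simp add: map_Suc_upt upt_conv_Cons)
    hence "wlist (Suc m) = (if m \<in> S1 then matw a else 1\<^sub>m n) # wlist m"
      by (simp add: wlist_def comp_def)
    thus ?thesis by (simp add: embed_def rgen_eq tensor_list_Cons kron_assoc)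
  qed
  finally show ?thesis .
qed

text \<open>\<open>M\<^sub>k\<^sub>+\<^sub>1 = \<Phi>(M\<^sub>k) M\<^sub>1\<close>: the component of \<open>X\<close> along \<open>e\<^sub>p\<^sub>q \<otimes> 1\<close>.\<close>

definition coefficient :: "nat \<Rightarrow> complex mat \<Rightarrow> nat \<Rightarrow> nat \<Rightarrow> complex mat" where
  "coefficient k X p q = Matrix.mat (n ^ k) (n ^ k) (\<lambda>(s, t).
     cnj ((weight k s * cnj (weight k t)) ^ block_of a p) * X $$ (p * n ^ k + s, q * n ^ k + t))"

text \<open>The conjugate phase in \<open>coefficient\<close> undoes the unimodular phase that
  \<open>shift_mat\<close> introduces, so the original entries of the block reappear.\<close>

lemma shift_mat_coefficient:
  assumes X: "X \<in> level (Suc k)" and pq: "p < n" "q < n"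
  shows "shift_mat k (coefficient k X p q) * kron (mat_unit n p q) (1\<^sub>m (n ^ k)) =
    restrict_mat {(i, j). i div n ^ k = p \<and> j div n ^ k = q} X"
proof (rule eq_matI)
  let ?K = "n ^ k"
  fix i j assume "i < dim_row (restrict_mat {(i, j). i div ?K = p \<and> j div ?K = q} X)"
    "j < dim_col (restrict_mat {(i, j). i div ?K = p \<and> j div ?K = q} X)"
  hence ij: "i < n * ?K" "j < n * ?K" using X by (auto simp: restrict_mat_def)
  note l = div_less_of_less_mult[OF ij(1)] div_less_of_less_mult[OF ij(2)]
    mod_less_of_less_mult[OF ij(1)] mod_less_of_less_mult[OF ij(2)]
  have w: "(weight k s * cnj (weight k t)) ^ b * cnj ((weight k s * cnj (weight k t)) ^ b) = 1" for s t b
    by (simp only: complex_norm_square[symmetric] norm_mult norm_power norm_weight complex_mod_cnj) simp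
  have C: "coefficient k X p q \<in> level k" by (simp add: coefficient_def)
  show "(shift_mat k (coefficient k X p q) * kron (mat_unit n p q) (1\<^sub>m ?K)) $$ (i, j) =
      restrict_mat {(i, j). i div ?K = p \<and> j div ?K = q} X $$ (i, j)"
    unfolding shift_mat_kron_index[OF C mat_unit_carrier ij]
    using l ij X w[of "i mod ?K" "j mod ?K" "block_of a (i div ?K)"]
    by (auto simp: coefficient_def restrict_mat_def mult.assoc[symmetric] div_mult_mod_eq)
qed (use X in \<open>auto simp: restrict_mat_def\<close>)

end

section \<open>The GNS representation\<close>

lemma div_mult_add: "v < N \<Longrightarrow> (u * N + v) div N = u" for u v N :: nat
  by simp

lemma restrict_mat_Int: "X \<in> carrier_mat N N \<Longrightarrow> restrict_mat S X = restrict_mat (S \<inter> {..<N} \<times> {..<N}) X"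
  by (rule eq_matI) (auto simp: restrict_mat_def)

lemma ntrace_mat_unit: "p < N \<Longrightarrow> ntrace (mat_unit N p q) = (if p = q then 1 / of_nat N else 0)"
proof -
  assume p: "p < N"
  have "(\<Sum>i<N. mat_unit N p q $$ (i, i)) = (\<Sum>i<N. if i = p then (if p = q then 1 else 0) else 0)"
    by (rule sum.cong) auto
  thus ?thesis using p by (simp add: ntrace_def)
qed

locale gns_shift = block_sizes a for a +
  fixes \<pi> :: "complex mat \<Rightarrow> 'h::complex_hilbert \<Rightarrow> 'h" and \<Omega> :: 'h
    and \<Phi> :: "('h \<Rightarrow> 'h) \<Rightarrow> 'h \<Rightarrow> 'h"
  assumes gns: "GNS_representation a \<pi> \<Omega>" and shift: "one_shift a \<pi> \<Phi>"
begin

lemma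
  assumes k: "k \<ge> 1" and X: "X \<in> level k"
  shows \<pi>_bo: "\<pi> X \<in> bounded_ops"
    and \<pi>_add: "Y \<in> level k \<Longrightarrow> \<pi> (X + Y) \<xi> = \<pi> X \<xi> + \<pi> Y \<xi>"
    and \<pi>_mult: "Y \<in> level k \<Longrightarrow> \<pi> (X * Y) \<xi> = \<pi> X (\<pi> Y \<xi>)"
    and \<pi>_smult: "\<pi> (c \<cdot>\<^sub>m X) \<xi> = c *\<^sub>C \<pi> X \<xi>"
    and \<pi>_adjoint: "\<pi> (mat_adjoint X) = hadj (\<pi> X)"
    and \<pi>_Suc: "\<pi> (kron X (1\<^sub>m n)) = \<pi> X"
    and \<pi>_trace: "cinner (\<pi> X \<Omega>) \<Omega> = ntrace X"
proof -
  have "X \<in> algM a k" using algM_full[OF k] X by simp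
  from gns[unfolded GNS_representation_def, THEN conjunct1, THEN spec, THEN mp, OF k, THEN bspec, OF this]
  have *: "\<pi> X \<in> bounded_ops \<and>
        (\<forall>Y\<in>algM a k. \<pi> (X + Y) = (\<lambda>\<xi>. \<pi> X \<xi> + \<pi> Y \<xi>) \<and> \<pi> (X * Y) = \<pi> X \<circ> \<pi> Y) \<and>
        (\<forall>c. \<pi> (c \<cdot>\<^sub>m X) = (\<lambda>\<xi>. c *\<^sub>C \<pi> X \<xi>)) \<and>
        \<pi> (mat_adjoint X) = hadj (\<pi> X) \<and>
        \<pi> (embed a k (Suc k) X) = \<pi> X \<and>
        cinner (\<pi> X \<Omega>) \<Omega> = ntrace X" .
  show "\<pi> X \<in> bounded_ops" "\<pi> (c \<cdot>\<^sub>m X) \<xi> = c *\<^sub>C \<pi> X \<xi>" "\<pi> (mat_adjoint X) = hadj (\<pi> X)"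
    "cinner (\<pi> X \<Omega>) \<Omega> = ntrace X" using * by auto
  show "\<pi> (kron X (1\<^sub>m n)) = \<pi> X" using * by (simp add: embed_def)
  show "\<pi> (X + Y) \<xi> = \<pi> X \<xi> + \<pi> Y \<xi>" "\<pi> (X * Y) \<xi> = \<pi> X (\<pi> Y \<xi>)" if "Y \<in> level k"
    using * that algM_full[OF k] by auto
qed

lemma \<pi>_one: "k \<ge> 1 \<Longrightarrow> \<pi> (1\<^sub>m (n ^ k)) = id"
  using gns unfolding GNS_representation_def by blast

lemma \<pi>_zero: "k \<ge> 1 \<Longrightarrow> \<pi> (0\<^sub>m (n ^ k) (n ^ k)) \<xi> = 0"
proof -
  assume k: "k \<ge> 1"
  have "0\<^sub>m (n ^ k) (n ^ k) = (0::complex) \<cdot>\<^sub>m 1\<^sub>m (n ^ k)" by (rule eq_matI) auto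
  thus ?thesis using \<pi>_smult[OF k one_carrier_mat, of 0] by simp
qed

lemma \<pi>_embed:
  assumes "k \<ge> 1" "k \<le> l" "X \<in> level k"
  shows "\<pi> (embed a k l X) = \<pi> X"
  using assms(2)
proof (induction l rule: dec_induct)
  case base show ?case by (simp add: embed_self)
next
  case (step l)
  thus ?case using \<pi>_Suc[of l "embed a k l X"] embed_carrier[of k l X] assms by (simp add: embed_Suc)
qed

section \<open>The union of the matrix algebras on the GNS space\<close>

abbreviation M :: "('h \<Rightarrow> 'h) set" where "M \<equiv> \<pi> ` (\<Union>k\<in>{1..}. algM a k)"

lemma M_iff: "x \<in> M \<longleftrightarrow> (\<exists>k\<ge>1. \<exists>X\<in>level k. x = \<pi> X)"
  using algM_full by auto

lemma M_I: "k \<ge> 1 \<Longrightarrow> X \<in> level k \<Longrightarrow> \<pi> X \<in> M"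
  unfolding M_iff by blast

lemma M_level:
  assumes "x \<in> M"
  obtains k where "k \<ge> 1" "\<And>l. l \<ge> k \<Longrightarrow> \<exists>X\<in>level l. x = \<pi> X"
proof -
  obtain k X where k: "k \<ge> 1" "X \<in> level k" "x = \<pi> X" using assms unfolding M_iff by blast
  have "\<exists>X\<in>level l. x = \<pi> X" if "l \<ge> k" for l
    using \<pi>_embed[OF k(1) that k(2)] embed_carrier[OF that k(2)] k(3) by metis
  thus ?thesis using that k(1) by blast
qed

lemma M_common_level:
  assumes "x \<in> M" "y \<in> M"
  obtains k X Y where "k \<ge> 1" "X \<in> level k" "Y \<in> level k" "x = \<pi> X" "y = \<pi> Y"
proof -
  obtain k where k: "k \<ge> 1" "\<And>l. l \<ge> k \<Longrightarrow> \<exists>X\<in>level l. x = \<pi> X" using M_level[OF assms(1)] by blast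
  obtain l where l: "l \<ge> 1" "\<And>m. m \<ge> l \<Longrightarrow> \<exists>X\<in>level m. y = \<pi> X" using M_level[OF assms(2)] by blast
  have "max k l \<ge> 1" using k(1) by simp
  thus ?thesis using that k(2)[of "max k l"] l(2)[of "max k l"] by auto
qed

lemma tracial_cyclic_M: "tracial_cyclic M \<Omega>"
proof
  show "M \<subseteq> bounded_ops"
  proof
    fix x assume "x \<in> M"
    then obtain k X where "k \<ge> 1" "X \<in> level k" "x = \<pi> X" unfolding M_iff by blast
    thus "x \<in> bounded_ops" using \<pi>_bo by simp
  qed
  show "id \<in> M" using M_I[of 1 "1\<^sub>m (n ^ 1)"] \<pi>_one[of 1] by simp
  show "(\<lambda>\<xi>. x \<xi> + y \<xi>) \<in> M" if xy: "x \<in> M" "y \<in> M" for x y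
  proof -
    obtain k X Y where k: "k \<ge> 1" "X \<in> level k" "Y \<in> level k" "x = \<pi> X" "y = \<pi> Y"
      using M_common_level[OF xy] .
    have "\<pi> (X + Y) = (\<lambda>\<xi>. x \<xi> + y \<xi>)" using \<pi>_add[OF k(1,2,3)] k(4,5) by auto
    thus ?thesis using M_I[OF k(1) add_carrier_mat[OF k(3)], of X] by simp
  qed
  show "(\<lambda>\<xi>. c *\<^sub>C x \<xi>) \<in> M" if x: "x \<in> M" for c x
  proof -
    obtain k X where k: "k \<ge> 1" "X \<in> level k" "x = \<pi> X" using x unfolding M_iff by blast
    have "\<pi> (c \<cdot>\<^sub>m X) = (\<lambda>\<xi>. c *\<^sub>C x \<xi>)" using \<pi>_smult[OF k(1,2)] k(3) by auto
    thus ?thesis using M_I[OF k(1) smult_carrier_mat[OF k(2)], of c] by simp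
  qed
  show "x \<circ> y \<in> M" if xy: "x \<in> M" "y \<in> M" for x y
  proof -
    obtain k X Y where k: "k \<ge> 1" "X \<in> level k" "Y \<in> level k" "x = \<pi> X" "y = \<pi> Y"
      using M_common_level[OF xy] .
    have "\<pi> (X * Y) = x \<circ> y" using \<pi>_mult[OF k(1,2,3)] k(4,5) by auto
    thus ?thesis using M_I[OF k(1) mult_carrier_mat[OF k(2,3)]] by simp
  qed
  show "hadj x \<in> M" if x: "x \<in> M" for x
  proof -
    obtain k X where k: "k \<ge> 1" "X \<in> level k" "x = \<pi> X" using x unfolding M_iff by blast
    thus ?thesis using M_I[OF k(1) mat_adjoint_carrier[OF k(2)]] \<pi>_adjoint[OF k(1,2)] by simp
  qed
  show "cinner (x (y \<Omega>)) \<Omega> = cinner (y (x \<Omega>)) \<Omega>" if xy: "x \<in> M" "y \<in> M" for x y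
  proof -
    obtain k X Y where k: "k \<ge> 1" "X \<in> level k" "Y \<in> level k" "x = \<pi> X" "y = \<pi> Y"
      using M_common_level[OF xy] .
    show ?thesis
      using \<pi>_trace[OF k(1) mult_carrier_mat[OF k(2,3)]] \<pi>_trace[OF k(1) mult_carrier_mat[OF k(3,2)]]
        ntrace_mult_commute[OF k(2,3)] \<pi>_mult[OF k(1,2,3)] \<pi>_mult[OF k(1,3,2)] k(4,5) by simp
  qed
  have "{x \<Omega> |x. x \<in> M} = {\<pi> X \<Omega> |X k. k \<ge> 1 \<and> X \<in> algM a k}" by auto
  thus "closure {x \<Omega> |x. x \<in> M} = UNIV"
    using gns unfolding GNS_representation_def by simp
qed

lemma \<pi>_restrict_mat:
  assumes k: "k \<ge> 1" and X: "X \<in> level k" and S: "S \<subseteq> {..<n ^ k} \<times> {..<n ^ k}"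
  shows "\<pi> (restrict_mat S X) \<xi> = (\<Sum>(p, q)\<in>S. X $$ (p, q) *\<^sub>C \<pi> (mat_unit (n ^ k) p q) \<xi>)"
proof -
  have "finite S" using S by (rule finite_subset) simp
  thus ?thesis
  proof (induction S rule: finite_induct)
    case empty
    show ?case using X \<pi>_smult[OF k X, of 0] by (simp add: restrict_mat_empty)
  next
    case (insert pq S)
    obtain p q where pq: "pq = (p, q)" by (cases pq)
    have "(p, q) \<notin> S" using insert.hyps pq by simp
    thus ?case
      using insert.IH insert.hyps(1) \<pi>_add[OF k restrict_mat_carrier[OF X] smult_carrier_mat[OF mat_unit_carrier]]
        \<pi>_smult[OF k mat_unit_carrier]
      unfolding pq by (simp add: restrict_mat_insert[OF X] add.commute)
  qed
qed

lemma \<pi>_expand: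
  assumes k: "k \<ge> 1" and X: "X \<in> level k"
  shows "\<pi> X \<xi> = (\<Sum>p<n ^ k. \<Sum>q<n ^ k. X $$ (p, q) *\<^sub>C \<pi> (mat_unit (n ^ k) p q) \<xi>)"
  using \<pi>_restrict_mat[OF k X order_refl, of \<xi>]
  unfolding restrict_mat_all[OF X] sum.cartesian_product .

text \<open>The levels are numbered by \<open>Suc k\<close> since the representation is specified
  from level 1 on; n \<ge> 2 makes their sizes unbounded.\<close>

lemma matrix_exhausted_M:
  "matrix_exhausted M \<Omega> (\<lambda>k. n ^ Suc k) (\<lambda>k i j. \<pi> (mat_unit (n ^ Suc k) i j))"
proof (rule matrix_exhausted.intro[OF tracial_cyclic_M], unfold_locales)
  have S: "Suc k \<ge> 1" for k by simp
  show "cinner \<Omega> \<Omega> = 1"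
    using \<pi>_trace[OF order_refl one_carrier_mat] \<pi>_one[of 1] ntrace_one[of "n ^ 1"] n_pos by simp
  fix k
  show "\<pi> (mat_unit (n ^ Suc k) i j) \<in> M" for i j by (rule M_I[OF S mat_unit_carrier])
  show "\<pi> (mat_unit (n ^ Suc k) i j) (\<pi> (mat_unit (n ^ Suc k) l p) \<xi>) =
      (if j = l then \<pi> (mat_unit (n ^ Suc k) i p) \<xi> else 0)" if "j < n ^ Suc k" "l < n ^ Suc k" for i j l p \<xi>
    using \<pi>_mult[OF S mat_unit_carrier mat_unit_carrier, of k i j l p \<xi>] mat_unit_mult[OF that] \<pi>_zero[OF S, of k \<xi>]
    by (auto simp del: power_Suc)
  show "hadj (\<pi> (mat_unit (n ^ Suc k) i j)) = \<pi> (mat_unit (n ^ Suc k) j i)" for i j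
    using \<pi>_adjoint[OF S mat_unit_carrier, of k i j] by (simp add: mat_unit_adjoint)
  show "(\<Sum>i<n ^ Suc k. \<pi> (mat_unit (n ^ Suc k) i i) \<xi>) = \<xi>" for \<xi>
  proof -
    have "\<xi> = (\<Sum>p<n ^ Suc k. \<Sum>q<n ^ Suc k. 1\<^sub>m (n ^ Suc k) $$ (p, q) *\<^sub>C \<pi> (mat_unit (n ^ Suc k) p q) \<xi>)"
      using \<pi>_expand[OF S one_carrier_mat, of k \<xi>] \<pi>_one[OF S, of k] by simp
    also have "\<dots> = (\<Sum>p<n ^ Suc k. \<Sum>q<n ^ Suc k. if q = p then \<pi> (mat_unit (n ^ Suc k) p p) \<xi> else 0)"
      by (intro sum.cong refl) auto
    finally show ?thesis by simp
  qed
  show "0 < n ^ Suc k" using n_pos by simp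
next
  fix m assume "m \<in> M"
  then obtain l where l: "\<And>k. k \<ge> l \<Longrightarrow> \<exists>X\<in>level k. m = \<pi> X" using M_level by blast
  have "\<exists>c. \<forall>\<xi>. m \<xi> = (\<Sum>p<n ^ Suc k. \<Sum>q<n ^ Suc k. c p q *\<^sub>C \<pi> (mat_unit (n ^ Suc k) p q) \<xi>)"
    if k: "k \<ge> l" for k
  proof -
    obtain X where X: "X \<in> level (Suc k)" "m = \<pi> X" using l[of "Suc k"] k by auto
    have "m \<xi> = (\<Sum>p<n ^ Suc k. \<Sum>q<n ^ Suc k. X $$ (p, q) *\<^sub>C \<pi> (mat_unit (n ^ Suc k) p q) \<xi>)" for \<xi>
      unfolding X(2) by (rule \<pi>_expand[OF _ X(1)]) simp
    thus ?thesis by (intro exI[of _ "\<lambda>p q. X $$ (p, q)"]) blast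
  qed
  thus "\<forall>\<^sub>F k in sequentially. \<exists>c. \<forall>\<xi>. m \<xi> = (\<Sum>p<n ^ Suc k. \<Sum>q<n ^ Suc k. c p q *\<^sub>C \<pi> (mat_unit (n ^ Suc k) p q) \<xi>)"
    by (rule eventually_sequentiallyI)
next
  fix N :: nat
  have "N < 2 ^ Suc N" using less_exp[of "Suc N"] by linarith
  also have "2 ^ Suc N \<le> n ^ Suc N" using a_sum by (rule power_mono) simp
  finally show "\<exists>k. N < n ^ Suc k" by blast
qed

lemma algR_eq: "algR a \<pi> = commutant (commutant M)"
  by (rule algR_def)

sublocale normal_endomorphism M \<Omega> "\<lambda>k. n ^ Suc k" "\<lambda>k i j. \<pi> (mat_unit (n ^ Suc k) i j)" \<Phi>
proof (rule normal_endomorphism.intro[OF matrix_exhausted_M], unfold_locales)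
  show "unital_star_endomorphism (commutant (commutant M)) \<Phi>"
    using shift unfolding one_shift_def algR_eq by blast
qed

lemma \<pi>_vN: "k \<ge> 1 \<Longrightarrow> X \<in> level k \<Longrightarrow> \<pi> X \<in> vN"
  by (rule subsetD[OF M_subset_vN M_I])

text \<open>Both sides respect all operations that generate M_k, so agreement on the generators,
  where \<open>one_shift\<close> prescribes \<Phi>, suffices; fullness of M_k then brings in every
  matrix.\<close>

lemma \<Phi>_\<pi>:
  assumes k: "k \<ge> 1" and X: "X \<in> level k"
  shows "\<Phi> (\<pi> X) = \<pi> (shift_mat k X)"
proof -
  have S: "Suc k \<ge> 1" by simp
  have lev: "Y \<in> level k" if "Y \<in> star_algebra (\<Union>m\<in>{1..k}.
     insert (embed a m k (rgen a m)) ((\<lambda>X. embed a m k (at_site a m X)) ` algA a))" for Y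
    using that algM_carrier unfolding algM_def by blast
  have "X \<in> algM a k" using algM_full[OF k] X by simp
  thus ?thesis
    unfolding algM_def
  proof (induction rule: star_algebra.induct)
    case (gen X)
    then obtain m where m: "m \<in> {1..k}"
      "X \<in> insert (embed a m k (rgen a m)) ((\<lambda>X. embed a m k (at_site a m X)) ` algA a)" by blast
    hence m1: "m \<ge> 1" "m \<le> k" by auto
    from m(2) consider "X = embed a m k (rgen a m)" | Y where "Y \<in> algA a" "X = embed a m k (at_site a m Y)" by blast
    thus ?case
    proof cases
      case 1
      have "\<Phi> (\<pi> (rgen a m)) = \<pi> (rgen a (Suc m))" using shift m1 unfolding one_shift_def by blast
      thus ?thesis
        using \<pi>_embed[OF m1 rgen_carrier[OF m1(1)]] \<pi>_embed[of "Suc m" "Suc k", OF _ _ rgen_carrier] m1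
        by (simp add: 1 shift_mat_rgen)
    next
      case 2
      have "\<Phi> (\<pi> (at_site a m Y)) = \<pi> (at_site a (Suc m) Y)" using shift m1 2(1) unfolding one_shift_def by blast
      thus ?thesis
        using \<pi>_embed[OF m1 at_site_carrier[OF m1(1) 2(1)]] \<pi>_embed[of "Suc m" "Suc k", OF _ _ at_site_carrier[OF _ 2(1)]] m1
        by (simp add: 2 shift_mat_at_site)
    qed
  next
    case (add X Y)
    note l = lev[OF add.hyps(1)] lev[OF add.hyps(2)]
    have "\<pi> (X + Y) = (\<lambda>\<xi>. \<pi> X \<xi> + \<pi> Y \<xi>)" using \<pi>_add[OF k l] by blast
    hence "\<Phi> (\<pi> (X + Y)) \<xi> = \<pi> (shift_mat k X) \<xi> + \<pi> (shift_mat k Y) \<xi>" for \<xi>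
      using \<Phi>_add[OF \<pi>_vN[OF k l(1)] \<pi>_vN[OF k l(2)]] add.IH by simp
    thus ?case using \<pi>_add[OF S shift_mat_carrier shift_mat_carrier] by (auto simp: shift_mat_add[OF l])
  next
    case (smult X c)
    note l = lev[OF smult.hyps]
    have "\<pi> (c \<cdot>\<^sub>m X) = (\<lambda>\<xi>. c *\<^sub>C \<pi> X \<xi>)" using \<pi>_smult[OF k l] by blast
    hence "\<Phi> (\<pi> (c \<cdot>\<^sub>m X)) \<xi> = c *\<^sub>C \<pi> (shift_mat k X) \<xi>" for \<xi>
      using \<Phi>_scale[OF \<pi>_vN[OF k l]] smult.IH by simp
    thus ?case using \<pi>_smult[OF S shift_mat_carrier] by (auto simp: shift_mat_smult[OF l])
  next
    case (mult X Y)
    note l = lev[OF mult.hyps(1)] lev[OF mult.hyps(2)]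
    have "\<pi> (X * Y) = \<pi> X \<circ> \<pi> Y" using \<pi>_mult[OF k l] by auto
    hence "\<Phi> (\<pi> (X * Y)) \<xi> = \<pi> (shift_mat k X) (\<pi> (shift_mat k Y) \<xi>)" for \<xi>
      using \<Phi>_comp[OF \<pi>_vN[OF k l(1)] \<pi>_vN[OF k l(2)]] mult.IH by simp
    thus ?case using \<pi>_mult[OF S shift_mat_carrier shift_mat_carrier] by (auto simp: shift_mat_mult[OF l])
  next
    case (adjoint X)
    note l = lev[OF adjoint.hyps]
    show ?case
      using \<Phi>_hadj[OF \<pi>_vN[OF k l]] adjoint.IH \<pi>_adjoint[OF k l] \<pi>_adjoint[OF S shift_mat_carrier]
      by (simp add: shift_mat_adjoint[OF l])
  qed
qed

text \<open>The index s encodes a pair (p, q) in base n. The factor sqrt n normalizes, because e_pq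
  e_qp = e_pp has trace 1 / n.\<close>

definition basis :: "nat \<Rightarrow> 'h \<Rightarrow> 'h" where
  "basis s = (\<lambda>\<xi>. complex_of_real (sqrt n) *\<^sub>C \<pi> (mat_unit n (s div n) (s mod n)) \<xi>)"

lemma \<pi>_mult_first_site:
  assumes k: "k \<ge> 1" and X: "X \<in> level (Suc k)" and Y: "Y \<in> carrier_mat n n"
  shows "\<pi> X (\<pi> Y \<xi>) = \<pi> (X * kron Y (1\<^sub>m (n ^ k))) \<xi>"
proof -
  have S: "Suc k \<ge> 1" by simp
  have Y1: "Y \<in> level 1" using Y by simp
  have e: "embed a 1 (Suc k) Y = kron Y (1\<^sub>m (n ^ k))" by (simp add: embed_def)
  have "\<pi> (kron Y (1\<^sub>m (n ^ k))) = \<pi> Y" using \<pi>_embed[OF order_refl S Y1] unfolding e .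
  thus ?thesis using \<pi>_mult[OF S X, of "kron Y (1\<^sub>m (n ^ k))"] embed_carrier[OF S Y1] unfolding e by simp
qed

lemma basis_vN: "basis s \<in> vN"
proof -
  have "\<pi> (mat_unit n (s div n) (s mod n)) \<in> vN" by (rule \<pi>_vN[of 1]) simp_all
  thus ?thesis unfolding basis_def by (rule R.M_scale)
qed

text \<open>The product \<open>basis s \<circ> hadj (basis t)\<close> is n times a product of two
  matrix units at the first site. The trace splits off the trace of that product, which is 1 / n for
  s = t and 0 otherwise.\<close>

lemma basis_orthonormal:
  assumes st: "s < n\<^sup>2" "t < n\<^sup>2" and x: "x \<in> M"
  shows "tr (\<Phi> x \<circ> (basis s \<circ> hadj (basis t))) = (if s = t then tr (\<Phi> x) else 0)"
proof -
  obtain k X where k: "k \<ge> 1" "X \<in> level k" "x = \<pi> X" using x unfolding M_iff by blast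
  let ?A = "mat_unit n (s div n) (s mod n)" and ?B = "mat_unit n (t mod n) (t div n)"
  have dm: "s div n < n" "s mod n < n" "t div n < n" "t mod n < n"
    using st n_pos by (auto simp: power2_eq_square less_mult_imp_div_less)
  have A: "?A \<in> level 1" and B: "?B \<in> level 1" and B': "mat_unit n (t div n) (t mod n) \<in> level 1" by simp_all
  have AB: "?A * ?B \<in> carrier_mat n n" by (rule mult_carrier_mat[OF mat_unit_carrier mat_unit_carrier])
  have "hadj (basis t) = (\<lambda>\<xi>. complex_of_real (sqrt n) *\<^sub>C \<pi> ?B \<xi>)"
    using \<pi>_adjoint[OF order_refl B'] by (simp add: basis_def hadj_scale[OF \<pi>_bo[OF order_refl B']] mat_unit_adjoint)
  hence "(basis s \<circ> hadj (basis t)) \<Omega> = of_nat n *\<^sub>C \<pi> (?A * ?B) \<Omega>"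
    using bounded_ops_scaleC[OF \<pi>_bo[OF order_refl A]] \<pi>_mult[OF order_refl A B]
    by (simp add: basis_def scaleC_scaleC of_real_mult[symmetric] del: of_real_mult)
  hence "tr (\<Phi> x \<circ> (basis s \<circ> hadj (basis t))) = of_nat n * cinner (\<pi> (shift_mat k X) (\<pi> (?A * ?B) \<Omega>)) \<Omega>"
    using bounded_ops_scaleC[OF \<pi>_bo[OF _ shift_mat_carrier[of k X]]] k
    by (simp add: tr_def \<Phi>_\<pi> cinner_scaleC_left)
  also have "cinner (\<pi> (shift_mat k X) (\<pi> (?A * ?B) \<Omega>)) \<Omega> = ntrace (shift_mat k X * kron (?A * ?B) (1\<^sub>m (n ^ k)))"
    unfolding \<pi>_mult_first_site[OF k(1) shift_mat_carrier AB]
    by (rule \<pi>_trace[of "Suc k"]) (use kron_carrier[OF AB one_carrier_mat] in \<open>auto intro!: mult_carrier_mat[OF shift_mat_carrier]\<close>)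
  also have "\<dots> = ntrace X * ntrace (?A * ?B)" by (rule ntrace_shift_mat_kron[OF k(2) AB])
  also have "ntrace (?A * ?B) = (if s = t then 1 / of_nat n else 0)"
  proof (cases "s mod n = t mod n")
    case True
    have "s = t \<longleftrightarrow> s div n = t div n" using True by (metis div_mult_mod_eq)
    thus ?thesis using True dm by (simp add: mat_unit_mult ntrace_mat_unit)
  next
    case False
    hence "?A * ?B = 0\<^sub>m n n" using dm by (simp add: mat_unit_mult)
    thus ?thesis using False by (auto simp: ntrace_def)
  qed
  also have "ntrace X = tr (\<Phi> x)"
    using \<pi>_trace[OF _ shift_mat_carrier[of k X]] k by (simp add: tr_def \<Phi>_\<pi> ntrace_shift_mat)
  finally have "tr (\<Phi> x \<circ> (basis s \<circ> hadj (basis t))) =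
      of_nat n * (tr (\<Phi> x) * (if s = t then 1 / of_nat n else 0))" .
  thus ?thesis using n_pos by (simp only:) (auto simp del: sum_list_eq_0_iff)
qed

lemma basis_span:
  assumes x: "x \<in> M"
  shows "\<exists>y. (\<forall>s<n\<^sup>2. y s \<in> \<Phi> ` vN) \<and> x \<Omega> = (\<Sum>s<n\<^sup>2. y s (basis s \<Omega>))"
proof -
  obtain k where k: "k \<ge> 1" "\<And>l. l \<ge> k \<Longrightarrow> \<exists>X\<in>level l. x = \<pi> X" using M_level[OF x] by blast
  \<comment> \<open>x is represented one level higher, so that its coefficients have level k \<ge> 1
    and \<Phi> moves them to level \<open>Suc k\<close>.\<close>
  obtain X where X: "X \<in> level (Suc k)" "x = \<pi> X" using k(2)[of "Suc k"] by auto
  have S: "Suc k \<ge> 1" by simp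
  let ?K = "n ^ k" and ?sq = "{..<n ^ Suc k} \<times> {..<n ^ Suc k}"
  define C where "C s = coefficient k X (s div n) (s mod n)" for s
  \<comment> \<open>The factor 1 / sqrt n cancels the normalization of the basis.\<close>
  define y where "y s = (\<lambda>\<xi>. complex_of_real (1 / sqrt n) *\<^sub>C \<Phi> (\<pi> (C s)) \<xi>)" for s
  have C: "C s \<in> level k" for s by (simp add: C_def coefficient_def)
  have yP: "y s \<in> \<Phi> ` vN" for s
    unfolding y_def by (intro P.M_scale imageI \<pi>_vN[OF k(1) C])
  \<comment> \<open>The positions whose row and column indices at the first site form the pair
    encoded by s. These sets partition all positions, which allows the expansion of X to be
    regrouped.\<close>
  define B where "B s = {ij \<in> ?sq. fst ij div ?K * n + snd ij div ?K = s}" for s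
  have term_eq: "y s (basis s \<Omega>) = (\<Sum>(i, j)\<in>B s. X $$ (i, j) *\<^sub>C \<pi> (mat_unit (n ^ Suc k) i j) \<Omega>)" if s: "s < n\<^sup>2" for s
  proof -
    have dm: "s div n < n" "s mod n < n" using s n_pos by (auto simp: power2_eq_square less_mult_imp_div_less)
    have sb: "\<pi> (shift_mat k (C s)) \<in> bounded_ops" by (rule \<pi>_bo[OF S shift_mat_carrier])
    have "y s (basis s \<Omega>) = \<pi> (shift_mat k (C s)) (\<pi> (mat_unit n (s div n) (s mod n)) \<Omega>)"
      using n_pos by (simp add: y_def basis_def \<Phi>_\<pi>[OF k(1) C] bounded_ops_scaleC[OF sb] scaleC_scaleC
          del: sum_list_eq_0_iff)
    also have "\<dots> = \<pi> (shift_mat k (C s) * kron (mat_unit n (s div n) (s mod n)) (1\<^sub>m ?K)) \<Omega>"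
      by (rule \<pi>_mult_first_site[OF k(1) shift_mat_carrier mat_unit_carrier])
    also have "shift_mat k (C s) * kron (mat_unit n (s div n) (s mod n)) (1\<^sub>m ?K) =
        restrict_mat {(i, j). i div ?K = s div n \<and> j div ?K = s mod n} X"
      unfolding C_def by (rule shift_mat_coefficient[OF X(1) dm])
    also have "\<dots> = restrict_mat (B s) X"
    proof -
      have "{(i, j). i div ?K = s div n \<and> j div ?K = s mod n} \<inter> ?sq = B s"
      proof -
        have h: "i div ?K * n + j div ?K = s \<longleftrightarrow> i div ?K = s div n \<and> j div ?K = s mod n" if "j < n * ?K" for i j
          using div_mult_add[OF div_less_of_less_mult[OF that]] mod_less[OF div_less_of_less_mult[OF that]] by (auto simp: div_mult_mod_eq)
        have f: "(i, j) \<in> {(i, j). i div ?K = s div n \<and> j div ?K = s mod n} \<inter> ?sq \<longleftrightarrow> (i, j) \<in> B s" for i j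
        proof (cases "j < n * ?K")
          case True
          thus ?thesis unfolding B_def using h[OF True, of i] by auto
        qed (simp add: B_def)
        show ?thesis
        proof (rule Set.set_eqI)
          fix z
          show "z \<in> {(i, j). i div ?K = s div n \<and> j div ?K = s mod n} \<inter> ?sq \<longleftrightarrow> z \<in> B s"
            by (cases z) (simp only: f)
        qed
      qed
      thus ?thesis using restrict_mat_Int[OF X(1)] by metis
    qed
    also have "\<pi> (restrict_mat (B s) X) \<Omega> = (\<Sum>(i, j)\<in>B s. X $$ (i, j) *\<^sub>C \<pi> (mat_unit (n ^ Suc k) i j) \<Omega>)"
      by (rule \<pi>_restrict_mat[OF S X(1)]) (auto simp: B_def)
    finally show ?thesis .
  qed
  have "(\<Sum>s<n\<^sup>2. y s (basis s \<Omega>)) = (\<Sum>s<n\<^sup>2. \<Sum>(i, j)\<in>B s. X $$ (i, j) *\<^sub>C \<pi> (mat_unit (n ^ Suc k) i j) \<Omega>)"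
    by (rule sum.cong[OF refl]) (simp add: term_eq)
  also have "\<dots> = (\<Sum>(i, j)\<in>?sq. X $$ (i, j) *\<^sub>C \<pi> (mat_unit (n ^ Suc k) i j) \<Omega>)"
    unfolding B_def
  proof (rule sum.group)
    show "(\<lambda>ij. fst ij div ?K * n + snd ij div ?K) ` ?sq \<subseteq> {..<n\<^sup>2}"
    proof clarsimp
      fix i j assume "i < n * ?K" "j < n * ?K"
      hence ij: "i div ?K < n" "j div ?K < n" by (auto intro: div_less_of_less_mult)
      hence "i div ?K * n + j div ?K < i div ?K * n + n" by simp
      also have "\<dots> = (i div ?K + 1) * n" by simp
      also have "\<dots> \<le> n * n" using ij by (intro mult_right_mono) auto
      finally show "i div ?K * n + j div ?K < n\<^sup>2" by (simp add: power2_eq_square)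
    qed
  qed auto
  also have "\<dots> = \<pi> (restrict_mat ?sq X) \<Omega>" by (rule \<pi>_restrict_mat[OF S X(1) order_refl, symmetric])
  also have "\<dots> = x \<Omega>" using restrict_mat_all[OF X(1)] X(2) by simp
  finally show ?thesis using yP by (intro exI[of _ y]) auto
qed

sublocale basis: orthonormal_basis_over_range M \<Omega> "\<lambda>k. n ^ Suc k" "\<lambda>k i j. \<pi> (mat_unit (n ^ Suc k) i j)" \<Phi> "n\<^sup>2" basis
proof
  show "basis s \<in> vN" for s by (rule basis_vN)
qed (fact basis_orthonormal basis_span)+

end

theorem mainTheorem2:
  fixes a :: "nat list"
    and \<pi> :: "complex mat \<Rightarrow> 'h::complex_hilbert \<Rightarrow> 'h"
    and \<Omega> :: 'h
    and \<Phi> :: "('h \<Rightarrow> 'h) \<Rightarrow> 'h \<Rightarrow> 'h"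
  assumes "\<forall>m\<in>set a. m \<ge> 1"
    and "sum_list a \<ge> 2"
    and "GNS_representation a \<pi> \<Omega>"
    and "one_shift a \<pi> \<Phi>"
  shows "II1_factor (\<Phi> ` algR a \<pi>) \<and>
    jones_index (algR a \<pi>) (\<Phi> ` algR a \<pi>) \<Omega> = of_nat ((sum_list a)\<^sup>2)"
proof -
  interpret gns_shift a \<pi> \<Omega> \<Phi>
    by (intro gns_shift.intro block_sizes.intro gns_shift_axioms.intro assms)
  show ?thesis
    unfolding algR_eq by (intro conjI II1_factor_P basis.jones_index_P)
qed

end
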